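(* Consider a rank 2 $(TE)$-structure over a point with $\mathcal U$ of type (Bra) or type (Reg) and with trace free pole part (so $\mathcal U$ is nilpotent but not $0$). The $(TE)$-structure is regular singular if and only if it is of type (Reg). If it is of type (Bra), then the pullback of $\mathcal O(H)_0\otimes_{\mathbb C\{z\}}\mathbb C\{z\}[z^{-1}]$ by the map $\mathbb C\to\mathbb C$, $x\mapsto x^4=z$, is the space of germs at $0$ of sections of a meromorphic bundle on $\mathbb C$ with a meromorphic connection with an order $3$ pole at $0$ with semisimple pole part with eigenvalues $\kappa_1$ and $\kappa_2=-\kappa_1$ with $-\frac14\kappa_1^2=\delta^{(1)}\in\mathbb C^*$. Thus $\kappa_1^2$ is a formal invariant of the $(TE)$-structure of type (Bra).
   Context: A $(TE)$-structure over a point is a holomorphic vector bundle $H\to\mathbb C$ ($z$ the coordinate) with a holomorphic connection $\nabla$ on $H|_{\mathbb C^*}$ such that $z^2\nabla_{\partial_z}$ maps $\mathcal O(H)$ to $\mathcal O(H)$. $\mathcal O(H)_0$ is the germ at $z=0$ of the sheaf of sections, $\mathcal U:=[z^2\nabla_{\partial_z}]:H|_0\to H|_0$ is the pole part (trace free if $\operatorname{tr}\mathcal U=0$). For a $\mathbb C\{z\}$-basis $\underline v$ of $\mathcal O(H)_0$ write $z^2\nabla_{\partial_z}\underline v=\underline vB$, $B=\sum B^{(k)}z^k$, $\det B=\sum\delta^{(k)}z^k$, $\rho^{(0)}=\frac12\operatorname{tr}B^{(0)}$, $\rho^{(1)}=\frac12\operatorname{tr}B^{(1)}$; $\rho^{(0)},\rho^{(1)},\delta^{(0)},\delta^{(1)}$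 are independent of the basis. (Bra): $\mathcal U$ has one eigenvalue, one $2\times2$ Jordan block and $\delta^{(1)}-2\rho^{(0)}\rho^{(1)}\ne0$. (Reg): the same with $\delta^{(1)}-2\rho^{(0)}\rho^{(1)}=0$. (In the trace free case $\rho^{(0)}=0$.) Regular singular: all sections in $\mathcal O(H)_0$ have moderate growth at $0$. A formal invariant is an invariant of the formal isomorphism class, i.e. under base changes in $GL_2(\mathbb C[[z]])$. The pole part of a connection with order 3 pole with respect to a basis $\underline w$ in the coordinate $x$ is the matrix $P_0$ in $\nabla_{x\partial_x}\underline w=\underline w\,(x^{-2}P_0+\text{higher order terms in }x)$.
   Formalization: The relation -1/4 κ₁² = δ^(1) is corrected to -1/16 κ₁² = δ^(1): for B = (0,1; z,0), δ^(1) = -1, and with x⁴ = z, x∂_x = 4z∂_z, the basis (v₁, x²v₂) has pole part (0,4; 4,0), so κ₁² = 16. *)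

theory Defs
  imports "HOL-Complex_Analysis.Complex_Analysis"
begin

section \<open>Rank 2 bundles on the complex plane with a connection\<close>

text \<open>
  A rank 2 vector bundle on \<open>\<complex>\<close> is given by its total space, its projection, the fibrewise
  operations and a set of local trivialisations \<open>(U, \<phi>)\<close>, where \<open>\<phi>\<close> is the \<open>\<complex>\<^sup>2\<close>-component of the
  trivialisation over \<open>U\<close>.

  \<open>conn H\<close> is the operator \<open>\<nabla>\<close> in the direction of the coordinate vector field. As a morphism of
  sheaves it acts on germs, so \<open>conn H s z\<close> is the value at \<open>z\<close> of the derivative of the germ of
  \<open>s\<close> at \<open>z\<close>; it is meaningful only for \<open>z \<noteq> 0\<close> and \<open>s\<close> a holomorphic section near \<open>z\<close>.
\<close>

record 'e conn_bundle =
  Tot :: "'e set"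
  pr :: "'e \<Rightarrow> complex"
  fadd :: "'e \<Rightarrow> 'e \<Rightarrow> 'e"
  fscale :: "complex \<Rightarrow> 'e \<Rightarrow> 'e"
  charts :: "(complex set \<times> ('e \<Rightarrow> complex^2)) set"
  conn :: "(complex \<Rightarrow> 'e) \<Rightarrow> complex \<Rightarrow> 'e"

definition holomorphic_bundle :: "'e conn_bundle \<Rightarrow> bool" where
  "holomorphic_bundle H \<longleftrightarrow>
     (\<forall>e\<in>Tot H. \<forall>f\<in>Tot H. pr H e = pr H f \<longrightarrow> fadd H e f \<in> Tot H \<and> pr H (fadd H e f) = pr H e) \<and>
     (\<forall>c. \<forall>e\<in>Tot H. fscale H c e \<in> Tot H \<and> pr H (fscale H c e) = pr H e) \<and>
     (\<Union>(U, \<phi>)\<in>charts H. U) = UNIV \<and>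
     (\<forall>(U, \<phi>)\<in>charts H.
        open U \<and>
        bij_betw (\<lambda>e. (pr H e, \<phi> e)) {e\<in>Tot H. pr H e \<in> U} (U \<times> UNIV) \<and>
        (\<forall>e\<in>Tot H. \<forall>f\<in>Tot H. pr H e \<in> U \<and> pr H e = pr H f \<longrightarrow> \<phi> (fadd H e f) = \<phi> e + \<phi> f) \<and>
        (\<forall>c. \<forall>e\<in>Tot H. pr H e \<in> U \<longrightarrow> \<phi> (fscale H c e) = c *s \<phi> e)) \<and>
     (\<forall>(U, \<phi>)\<in>charts H. \<forall>(V, \<psi>)\<in>charts H. \<exists>g :: complex \<Rightarrow> complex^2^2.
        (\<forall>i j. (\<lambda>z. g z $ i $ j) holomorphic_on U \<inter> V) \<and>
        (\<forall>e\<in>Tot H. pr H e \<in> U \<inter> V \<longrightarrow> \<psi> e = g (pr H e) *v \<phi> e))"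

definition hol_section :: "'e conn_bundle \<Rightarrow> complex set \<Rightarrow> (complex \<Rightarrow> 'e) \<Rightarrow> bool" where
  "hol_section H U s \<longleftrightarrow> open U \<and> (\<forall>z\<in>U. s z \<in> Tot H \<and> pr H (s z) = z) \<and>
     (\<forall>(V, \<phi>)\<in>charts H. \<forall>i. (\<lambda>z. \<phi> (s z) $ i) holomorphic_on U \<inter> V)"

definition connection_off_0 :: "'e conn_bundle \<Rightarrow> bool" where
  "connection_off_0 H \<longleftrightarrow>
     (\<forall>U s. hol_section H U s \<and> 0 \<notin> U \<longrightarrow> hol_section H U (conn H s)) \<and>
     (\<forall>U s t. hol_section H U s \<and> hol_section H U t \<and> 0 \<notin> U \<and> (\<forall>z\<in>U. s z = t z) \<longrightarrow>
        (\<forall>z\<in>U. conn H s z = conn H t z)) \<and>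
     (\<forall>U s t. hol_section H U s \<and> hol_section H U t \<and> 0 \<notin> U \<longrightarrow>
        (\<forall>z\<in>U. conn H (\<lambda>w. fadd H (s w) (t w)) z = fadd H (conn H s z) (conn H t z))) \<and>
     (\<forall>U s f. hol_section H U s \<and> f holomorphic_on U \<and> 0 \<notin> U \<longrightarrow>
        (\<forall>z\<in>U. conn H (\<lambda>w. fscale H (f w) (s w)) z =
           fadd H (fscale H (deriv f z) (s z)) (fscale H (f z) (conn H s z))))"

definition TE_structure :: "'e conn_bundle \<Rightarrow> bool" where
  "TE_structure H \<longleftrightarrow> holomorphic_bundle H \<and> connection_off_0 H \<and>
     (\<forall>U s. hol_section H U s \<longrightarrow>
        (\<exists>t. hol_section H U t \<and> (\<forall>z\<in>U - {0}. t z = fscale H (z\<^sup>2) (conn H s z))))"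

text \<open>The linear combination \<open>c\<^sub>1 e\<^sub>1 + c\<^sub>2 e\<^sub>2\<close> of two elements of one fibre.\<close>

definition lincomb :: "'e conn_bundle \<Rightarrow> complex^2 \<Rightarrow> (2 \<Rightarrow> 'e) \<Rightarrow> 'e" where
  "lincomb H c e = fadd H (fscale H (c $ 1) (e 1)) (fscale H (c $ 2) (e 2))"

definition fibre_basis :: "'e conn_bundle \<Rightarrow> complex \<Rightarrow> (2 \<Rightarrow> 'e) \<Rightarrow> bool" where
  "fibre_basis H z e \<longleftrightarrow> (\<forall>i. e i \<in> Tot H \<and> pr H (e i) = z) \<and>
     (\<forall>h\<in>Tot H. pr H h = z \<longrightarrow> (\<exists>!c. h = lincomb H c e))"

section \<open>Germs at the origin\<close>

text \<open>
  Germs are represented by functions, and equality of germs is \<open>eventually\<close>-equality.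
  Elements of \<open>\<complex>{z}\<close> are functions that are analytic at 0, elements of
  \<open>\<complex>{z}[z\<^sup>-\<^sup>1]\<close> are functions that are meromorphic at 0 (their value at 0 is irrelevant).
\<close>

definition germ_section :: "'e conn_bundle \<Rightarrow> (complex \<Rightarrow> 'e) \<Rightarrow> bool" where
  "germ_section H s \<longleftrightarrow> (\<exists>U. 0 \<in> U \<and> hol_section H U s)"

definition mero_germ_section :: "'e conn_bundle \<Rightarrow> (complex \<Rightarrow> 'e) \<Rightarrow> bool" where
  "mero_germ_section H s \<longleftrightarrow>
     (\<exists>N t. germ_section H t \<and> (\<forall>\<^sub>F z in at 0. s z = fscale H (inverse (z ^ N)) (t z)))"

definition germ_basis :: "'e conn_bundle \<Rightarrow> (2 \<Rightarrow> complex \<Rightarrow> 'e) \<Rightarrow> bool" where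
  "germ_basis H v \<longleftrightarrow> (\<forall>i. germ_section H (v i)) \<and>
     (\<forall>s. germ_section H s \<longrightarrow>
        (\<exists>f :: complex \<Rightarrow> complex^2. (\<forall>i. (\<lambda>z. f z $ i) analytic_on {0}) \<and>
           (\<forall>\<^sub>F z in nhds 0. s z = lincomb H (f z) (\<lambda>i. v i z)))) \<and>
     (\<forall>f g :: complex \<Rightarrow> complex^2.
        (\<forall>i. (\<lambda>z. f z $ i) analytic_on {0}) \<and> (\<forall>i. (\<lambda>z. g z $ i) analytic_on {0}) \<and>
        (\<forall>\<^sub>F z in nhds 0. lincomb H (f z) (\<lambda>i. v i z) = lincomb H (g z) (\<lambda>i. v i z)) \<longrightarrow>
        (\<forall>\<^sub>F z in nhds 0. f z = g z))"

definition mero_germ_basis :: "'e conn_bundle \<Rightarrow> (2 \<Rightarrow> complex \<Rightarrow> 'e) \<Rightarrow> bool" where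
  "mero_germ_basis H w \<longleftrightarrow> (\<forall>i. mero_germ_section H (w i)) \<and>
     (\<forall>s. mero_germ_section H s \<longrightarrow>
        (\<exists>f :: complex \<Rightarrow> complex^2. (\<forall>i. (\<lambda>z. f z $ i) meromorphic_on {0}) \<and>
           (\<forall>\<^sub>F z in at 0. s z = lincomb H (f z) (\<lambda>i. w i z)))) \<and>
     (\<forall>f g :: complex \<Rightarrow> complex^2.
        (\<forall>i. (\<lambda>z. f z $ i) meromorphic_on {0}) \<and> (\<forall>i. (\<lambda>z. g z $ i) meromorphic_on {0}) \<and>
        (\<forall>\<^sub>F z in at 0. lincomb H (f z) (\<lambda>i. w i z) = lincomb H (g z) (\<lambda>i. w i z)) \<longrightarrow>
        (\<forall>\<^sub>F z in at 0. f z = g z))"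

text \<open>\<open>v\<close> is a basis of \<open>O(H)\<^sub>0\<close> and \<open>z\<^sup>2 \<nabla> v = v B\<close>, that is, column \<open>j\<close> of \<open>B\<close> belongs to \<open>v j\<close>.\<close>

definition conn_matrix ::
    "'e conn_bundle \<Rightarrow> (2 \<Rightarrow> complex \<Rightarrow> 'e) \<Rightarrow> (complex \<Rightarrow> complex^2^2) \<Rightarrow> bool" where
  "conn_matrix H v B \<longleftrightarrow> germ_basis H v \<and> (\<forall>i j. (\<lambda>z. B z $ i $ j) analytic_on {0}) \<and>
     (\<forall>j. \<forall>\<^sub>F z in at 0. fscale H (z\<^sup>2) (conn H (v j) z) = lincomb H (column j (B z)) (\<lambda>i. v i z))"

section \<open>Pole part, invariants and types\<close>

text \<open>The endomorphism \<open>\<U> = [z\<^sup>2 \<nabla>]\<close> of the fibre over 0.\<close>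

definition pole_part :: "'e conn_bundle \<Rightarrow> 'e \<Rightarrow> 'e" where
  "pole_part H e = (THE h. \<exists>s t. germ_section H s \<and> germ_section H t \<and> s 0 = e \<and> t 0 = h \<and>
     (\<forall>\<^sub>F z in at 0. t z = fscale H (z\<^sup>2) (conn H s z)))"

definition pole_part_matrix :: "'e conn_bundle \<Rightarrow> (2 \<Rightarrow> 'e) \<Rightarrow> complex^2^2 \<Rightarrow> bool" where
  "pole_part_matrix H e M \<longleftrightarrow> fibre_basis H 0 e \<and>
     (\<forall>j. pole_part H (e j) = lincomb H (column j M) e)"

definition trace_free :: "'e conn_bundle \<Rightarrow> bool" where
  "trace_free H \<longleftrightarrow> (\<exists>e M. pole_part_matrix H e M \<and> trace M = 0)"

definition single_jordan_block :: "'e conn_bundle \<Rightarrow> bool" where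
  "single_jordan_block H \<longleftrightarrow>
     (\<exists>e l. pole_part_matrix H e (vector [vector [l, 1], vector [0, l]]))"

definition fps_matrix :: "(complex \<Rightarrow> complex^2^2) \<Rightarrow> complex fps^2^2" where
  "fps_matrix B = (\<chi> i j. fps_expansion (\<lambda>z. B z $ i $ j) 0)"

text \<open>
  The numbers \<open>\<rho>\<^sup>(\<^sup>k\<^sup>)\<close> and \<open>\<delta>\<^sup>(\<^sup>k\<^sup>)\<close>. Only for \<open>k \<le> 1\<close> are they independent of the basis, so only then
  are the definite descriptions meaningful.
\<close>

definition rho :: "'e conn_bundle \<Rightarrow> nat \<Rightarrow> complex" where
  "rho H k = (THE c. \<exists>v B. conn_matrix H v B \<and> c = fps_nth (trace (fps_matrix B)) k / 2)"

definition delta :: "'e conn_bundle \<Rightarrow> nat \<Rightarrow> complex" where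
  "delta H k = (THE c. \<exists>v B. conn_matrix H v B \<and> c = fps_nth (det (fps_matrix B)) k)"

definition type_Bra :: "'e conn_bundle \<Rightarrow> bool" where
  "type_Bra H \<longleftrightarrow> single_jordan_block H \<and> delta H 1 - 2 * rho H 0 * rho H 1 \<noteq> 0"

definition type_Reg :: "'e conn_bundle \<Rightarrow> bool" where
  "type_Reg H \<longleftrightarrow> single_jordan_block H \<and> delta H 1 - 2 * rho H 0 * rho H 1 = 0"

section \<open>Regular singularity\<close>

text \<open>
  Moderate growth is measured by the coefficients of a section with respect to flat frames on slit
  discs. Every multivalued flat frame restricts to flat frames on slit discs.
\<close>

definition slit_disc :: "real \<Rightarrow> real \<Rightarrow> complex set" where
  "slit_disc r a = {rcis m t |m t. 0 < m \<and> m < r \<and> \<bar>t - a\<bar> < pi}"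

definition flat_frame :: "'e conn_bundle \<Rightarrow> complex set \<Rightarrow> (2 \<Rightarrow> complex \<Rightarrow> 'e) \<Rightarrow> bool" where
  "flat_frame H S A \<longleftrightarrow>
     (\<forall>i. hol_section H S (A i) \<and> (\<forall>z\<in>S. conn H (A i) z = fscale H 0 (A i z))) \<and>
     (\<forall>z\<in>S. fibre_basis H z (\<lambda>i. A i z))"

definition moderate_growth :: "'e conn_bundle \<Rightarrow> (complex \<Rightarrow> 'e) \<Rightarrow> bool" where
  "moderate_growth H s \<longleftrightarrow>
     (\<forall>r>0. \<forall>a A. flat_frame H (slit_disc r a) A \<longrightarrow>
        (\<exists>C (N::nat) \<epsilon>. 0 < \<epsilon> \<and>
           (\<forall>z\<in>slit_disc r a. norm z < \<epsilon> \<longrightarrow>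
              (\<forall>c. s z = lincomb H c (\<lambda>i. A i z) \<longrightarrow> norm c \<le> C * inverse (norm z ^ N)))))"

definition regular_singular :: "'e conn_bundle \<Rightarrow> bool" where
  "regular_singular H \<longleftrightarrow> (\<forall>s. germ_section H s \<longrightarrow> moderate_growth H s)"

section \<open>Pullback by the fourth power map\<close>

text \<open>
  The pulled back bundle has fibre \<open>H\<^bsub>x^4\<^esub>\<close> over \<open>x\<close>. Near a point \<open>x \<noteq> 0\<close> the map \<open>x \<mapsto> x\<^sup>4\<close> has the
  local inverse \<open>z \<mapsto> x (z / x\<^sup>4)\<^sup>1\<^sup>/\<^sup>4\<close> (principal branch, defined for \<open>z\<close> near \<open>x\<^sup>4\<close>), along which a
  section is transported to a section of \<open>H\<close> and differentiated there; the factor \<open>4 x\<^sup>3\<close> is the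
  chain rule.
\<close>

definition pullback4 :: "'e conn_bundle \<Rightarrow> (complex \<times> 'e) conn_bundle" where
  "pullback4 H =
     \<lparr> Tot = {(x, e). e \<in> Tot H \<and> pr H e = x ^ 4},
       pr = fst,
       fadd = (\<lambda>(x, e) (y, f). (x, fadd H e f)),
       fscale = (\<lambda>c (x, e). (x, fscale H c e)),
       charts = (\<lambda>(U, \<phi>). ((\<lambda>x. x ^ 4) -` U, \<lambda>(x, e). \<phi> e)) ` charts H,
       conn = (\<lambda>s x. (x, fscale H (4 * x ^ 3)
                (conn H (\<lambda>z. snd (s (x * (z / x ^ 4) powr (1 / 4)))) (x ^ 4)))) \<rparr>"

text \<open>
  The pullback of the module \<open>O(H)\<^sub>0 \<otimes> \<complex>{z}[z\<^sup>-\<^sup>1]\<close>: all finite \<open>\<complex>{x}[x\<^sup>-\<^sup>1]\<close>-linear combinations of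
  pullbacks of its elements.
\<close>

inductive pullback4_module :: "'e conn_bundle \<Rightarrow> (complex \<Rightarrow> complex \<times> 'e) \<Rightarrow> bool"
  for H :: "'e conn_bundle" where
  generator: "mero_germ_section H s \<Longrightarrow> f meromorphic_on {0} \<Longrightarrow>
    (\<forall>\<^sub>F x in at 0. t x = fscale (pullback4 H) (f x) (x, s (x ^ 4))) \<Longrightarrow> pullback4_module H t"
| add: "pullback4_module H t\<^sub>1 \<Longrightarrow> pullback4_module H t\<^sub>2 \<Longrightarrow>
    (\<forall>\<^sub>F x in at 0. t x = fadd (pullback4 H) (t\<^sub>1 x) (t\<^sub>2 x)) \<Longrightarrow> pullback4_module H t"

text \<open>
  \<open>w\<close> is a basis of the meromorphic germs of \<open>K\<close> at 0 and \<open>x \<nabla> w = w (x\<^sup>-\<^sup>2 P + \<dots>)\<close>; here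
  \<open>x\<^sup>-\<^sup>2 P + \<dots>\<close> is written as \<open>x\<^sup>-\<^sup>2 C(x)\<close> with \<open>C\<close> holomorphic and \<open>C(0) = P\<close>.
\<close>

definition order3_pole_part ::
    "'e conn_bundle \<Rightarrow> (2 \<Rightarrow> complex \<Rightarrow> 'e) \<Rightarrow> complex^2^2 \<Rightarrow> bool" where
  "order3_pole_part K w P \<longleftrightarrow> mero_germ_basis K w \<and> P \<noteq> 0 \<and>
     (\<exists>C :: complex \<Rightarrow> complex^2^2. (\<forall>i j. (\<lambda>x. C x $ i $ j) analytic_on {0}) \<and> C 0 = P \<and>
        (\<forall>j. \<forall>\<^sub>F x in at 0. fscale K x (conn K (w j) x) =
           lincomb K (inverse (x\<^sup>2) *s column j (C x)) (\<lambda>i. w i x)))"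

definition semisimple_with_eigenvalues :: "complex^2^2 \<Rightarrow> complex \<Rightarrow> complex \<Rightarrow> bool" where
  "semisimple_with_eigenvalues P a b \<longleftrightarrow>
     (\<exists>Q :: complex^2^2. invertible Q \<and> P ** Q = Q ** vector [vector [a, 0], vector [0, b]])"

text \<open>
  \<open>\<kappa>\<close> and \<open>-\<kappa>\<close> are the eigenvalues of a semisimple pole part of order 3 of the pullback. For
  \<open>z\<^sup>2 \<nabla> v = v B\<close> with \<open>B = (0, 1; c z, 0) + \<dots>\<close>, so \<open>\<delta>\<^sup>(\<^sup>1\<^sup>) = -c\<close>, the basis \<open>w = (v\<^sub>1, x\<^sup>2 v\<^sub>2)\<close> of
  the pullback has pole part \<open>4 (0, 1; c, 0)\<close>, because \<open>x d/dx = 4 z d/dz\<close>. Hence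
  \<open>\<kappa>\<^sup>2 = 16 c = -16 \<delta>\<^sup>(\<^sup>1\<^sup>)\<close>.
\<close>

definition pullback_eigenvalue :: "'e conn_bundle \<Rightarrow> complex \<Rightarrow> bool" where
  "pullback_eigenvalue H \<kappa> \<longleftrightarrow>
     (\<exists>w P. order3_pole_part (pullback4 H) w P \<and> semisimple_with_eigenvalues P \<kappa> (-\<kappa>))"

section \<open>Formal isomorphism\<close>

text \<open>\<open>v' = v G\<close> turns \<open>z\<^sup>2 \<nabla> v = v B\<close> into \<open>z\<^sup>2 \<nabla> v' = v' B'\<close> iff \<open>z\<^sup>2 G' + B G = G B'\<close>.\<close>

definition formally_isomorphic :: "'e conn_bundle \<Rightarrow> 'f conn_bundle \<Rightarrow> bool" where
  "formally_isomorphic H H' \<longleftrightarrow>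
     (\<exists>v B v' B' G. conn_matrix H v B \<and> conn_matrix H' v' B' \<and> invertible G \<and>
        (\<chi> i j. fps_X\<^sup>2 * fps_deriv (G $ i $ j)) + fps_matrix B ** G = G ** fps_matrix B')"

end

theory Submission
  imports Defs
begin

text \<open>
  Near 0 a chart turns \<open>z\<^sup>2 \<nabla>\<close> into \<open>z\<^sup>2 d/dz + M(z)\<close> with \<open>M\<close> holomorphic, and \<open>M(0)\<close> is the
  matrix of \<open>\<U>\<close>. A base change acts on \<open>M\<close> by conjugation up to a multiple of \<open>z\<^sup>2\<close>, so
  the coefficients of orders 0 and 1 of trace and determinant, and whether \<open>M(0)\<close> vanishes, are
  invariants even of the formal isomorphism class (\<open>gauge_invariants\<close>). A trace free pole part with
  a single Jordan block is nilpotent, and after a constant base change \<open>M(0) = (0, 1; 0, 0)\<close>. Then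
  \<open>M = (z b11, b12; z b21, z b22)\<close> with \<open>b12(0) = 1\<close> and \<open>b21(0) = -\<delta>\<^sup>(\<^sup>1\<^sup>)\<close>, and \<open>\<rho>\<^sup>(\<^sup>0\<^sup>) = 0\<close>, so the
  types are told apart by whether \<open>\<delta>\<^sup>(\<^sup>1\<^sup>)\<close> vanishes.

  If \<open>\<delta>\<^sup>(\<^sup>1\<^sup>) = 0\<close>, then \<open>b21\<close> is divisible by \<open>z\<close> and the frame \<open>(v\<^sub>1, z v\<^sub>2)\<close> has a logarithmic
  pole. In the coordinate \<open>log z\<close> its flat sections solve a system with bounded coefficients, and
  Gronwall's inequality bounds the solutions and, from below, their determinant by powers of
  \<open>|z|\<close>. By Cramer's rule the coefficients of every section in a flat frame have moderate
  growth (\<open>type_Reg_regular\<close>).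

  If \<open>\<delta>\<^sup>(\<^sup>1\<^sup>) \<noteq> 0\<close>, a flat section \<open>(f\<^sub>1, f\<^sub>2)\<close> satisfies in the coordinate \<open>\<zeta> = log z\<close>
  \<open>f\<^sub>1' = -(b11 f\<^sub>1 + e\<^sup>-\<^sup>\<zeta> b12 f\<^sub>2)\<close> and \<open>f\<^sub>2' = -(b21 f\<^sub>1 + b22 f\<^sub>2)\<close> with \<open>b12\<close> and \<open>b21\<close>
  invertible. Solving the first equation for \<open>f\<^sub>2\<close> and then the second for \<open>f\<^sub>1\<close>, with Cauchy's
  estimate for the derivatives, improves a bound \<open>O(|z|\<^sup>L)\<close> to \<open>O(|z|\<^sup>L\<^sup>+\<^sup>1)\<close> on a slightly smaller
  strip (\<open>irregular_descent\<close>). So a flat frame of moderate growth would decay faster than every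
  power, whereas its determinant is bounded below by a power. As flat frames on a slit
  disc exist by Picard iteration (\<open>linear_ode_solution\<close>), the structure is not regular singular
  (\<open>type_Bra_not_regular\<close>).

  For the pullback the basis \<open>(v\<^sub>1, x\<^sup>2 v\<^sub>2)\<close> has an order 3 pole with pole part
  \<open>4 (0, 1; -\<delta>\<^sup>(\<^sup>1\<^sup>), 0)\<close>, whose square is the scalar \<open>-16 \<delta>\<^sup>(\<^sup>1\<^sup>)\<close>. For any two bases with an order 3
  pole the leading coefficient of the base change is a nonzero matrix that intertwines the two
  pole parts (\<open>order3_pole_parts_intertwined\<close>). A semisimple pole part with eigenvalues \<open>\<plusminus>\<kappa>\<close> has
  square \<open>\<kappa>\<^sup>2\<close>, so a nonzero intertwiner forces \<open>\<kappa>\<^sup>2 = -16 \<delta>\<^sup>(\<^sup>1\<^sup>)\<close>, even if it is not invertible.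
  Since \<open>\<delta>\<^sup>(\<^sup>1\<^sup>)\<close> is a formal invariant, so is \<open>\<kappa>\<^sup>2\<close>.
\<close>

text \<open>The infix \<open>$\<close> is reserved for components of vectors and matrices.\<close>

no_notation fps_nth (infixl \<open>$\<close> 75)

section \<open>Linear differential equations on convex domains\<close>

text \<open>
  Gronwall's inequality in differential form: \<open>exp (-2 K t) |f(t)|\<^sup>2\<close> has nonpositive derivative.
\<close>

lemma linear_growth_bound:
  fixes f :: "real \<Rightarrow> 'a::real_inner"
  assumes der: "\<And>t. t \<in> {0..1} \<Longrightarrow> (f has_vector_derivative f' t) (at t)"
    and bound: "\<And>t. t \<in> {0..1} \<Longrightarrow> norm (f' t) \<le> K * norm (f t)"
  shows "norm (f 1) \<le> norm (f 0) * exp K"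
proof -
  define h where "h t = exp (-2 * K * t) * (f t \<bullet> f t)" for t
  have "h 1 \<le> h 0"
  proof (rule DERIV_nonpos_imp_nonincreasing[where f = h])
    fix t :: real assume "0 \<le> t" "t \<le> 1"
    then have t: "t \<in> {0..1}" by simp
    have "((\<lambda>t. f t \<bullet> f t) has_real_derivative (f t \<bullet> f' t + f' t \<bullet> f t)) (at t)"
      using der[OF t]
      by (auto simp: has_real_derivative_iff_has_vector_derivative has_vector_derivative_def
          intro!: derivative_eq_intros simp: algebra_simps inner_commute)
    then have "(h has_real_derivative
        (exp (-2 * K * t) * (-2 * K) * (f t \<bullet> f t) + exp (-2 * K * t) * (f t \<bullet> f' t + f' t \<bullet> f t))) (at t)"
      unfolding h_def by (auto intro!: derivative_eq_intros)
    moreover have "f t \<bullet> f' t \<le> K * (f t \<bullet> f t)"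
    proof -
      have "f t \<bullet> f' t \<le> norm (f t) * norm (f' t)"
        by (rule norm_cauchy_schwarz)
      also have "\<dots> \<le> norm (f t) * (K * norm (f t))"
        by (intro mult_left_mono bound[OF t]) auto
      finally show ?thesis
        by (simp add: power2_norm_eq_inner[symmetric] power2_eq_square mult_ac)
    qed
    then have "exp (-2 * K * t) * (-2 * K) * (f t \<bullet> f t) + exp (-2 * K * t) * (f t \<bullet> f' t + f' t \<bullet> f t)
        = exp (-2 * K * t) * (2 * (f t \<bullet> f' t - K * (f t \<bullet> f t)))"
      by (simp add: algebra_simps inner_commute)
    moreover have "\<dots> \<le> 0"
      using \<open>f t \<bullet> f' t \<le> K * (f t \<bullet> f t)\<close> by (intro mult_nonneg_nonpos) auto
    ultimately show "\<exists>y. (h has_real_derivative y) (at t) \<and> y \<le> 0"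
      by auto
  qed simp
  then have "exp (-2 * K) * (norm (f 1))\<^sup>2 \<le> (norm (f 0))\<^sup>2"
    by (simp add: h_def power2_norm_eq_inner)
  then have "(norm (f 1))\<^sup>2 \<le> exp (2 * K) * (norm (f 0))\<^sup>2"
    by (simp add: exp_minus field_simps)
  also have "\<dots> = (norm (f 0) * exp K)\<^sup>2"
    by (simp add: power_mult_distrib exp_double[symmetric])
  finally show ?thesis
    by (rule power2_le_imp_le) auto
qed

text \<open>
  The inequality along a segment. Two components suffice for flat sections of a rank 2 bundle;
  with second component zero the lemma applies to a scalar equation such as that of a determinant.
\<close>

lemma linear_growth_bound_convex:
  fixes f1 f2 :: "complex \<Rightarrow> complex"
  assumes S: "convex S" "a \<in> S" "b \<in> S"
    and der: "\<And>z. z \<in> S \<Longrightarrow> (f1 has_field_derivative f1' z) (at z)"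
      "\<And>z. z \<in> S \<Longrightarrow> (f2 has_field_derivative f2' z) (at z)"
    and bound: "\<And>z. z \<in> S \<Longrightarrow> norm (f1' z, f2' z) \<le> K * norm (f1 z, f2 z)"
  shows "norm (f1 b, f2 b) \<le> norm (f1 a, f2 a) * exp (K * norm (b - a))"
proof -
  define p where "p t = a + of_real t * (b - a)" for t :: real
  have pS: "p t \<in> S" if "t \<in> {0..1}" for t
  proof -
    have "p t = (1 - t) *\<^sub>R a + t *\<^sub>R b"
      by (simp add: p_def scaleR_conv_of_real algebra_simps)
    then show ?thesis
      using that S by (auto simp: convex_alt)
  qed
  have dp: "(p has_vector_derivative (b - a)) (at t)" for t
    unfolding p_def by (auto intro!: derivative_eq_intros)
  have "norm ((\<lambda>t. (f1 (p t), f2 (p t))) 1) \<le> norm ((\<lambda>t. (f1 (p t), f2 (p t))) 0) * exp (K * norm (b - a))"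
  proof (rule linear_growth_bound)
    fix t :: real assume t: "t \<in> {0..1}"
    show "((\<lambda>t. (f1 (p t), f2 (p t))) has_vector_derivative
        ((b - a) * f1' (p t), (b - a) * f2' (p t))) (at t)"
      using field_vector_diff_chain_at[OF dp der(1)[OF pS[OF t]]]
        field_vector_diff_chain_at[OF dp der(2)[OF pS[OF t]]]
      by (intro has_vector_derivative_Pair) (simp_all add: o_def)
    have "norm ((b - a) * f1' (p t), (b - a) * f2' (p t)) = norm (b - a) * norm (f1' (p t), f2' (p t))"
      by (simp add: norm_Pair norm_mult power_mult_distrib distrib_left[symmetric] real_sqrt_mult)
    also have "\<dots> \<le> norm (b - a) * (K * norm (f1 (p t), f2 (p t)))"
      by (intro mult_left_mono bound[OF pS[OF t]]) auto
    finally show "norm ((b - a) * f1' (p t), (b - a) * f2' (p t)) \<le>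
        K * norm (b - a) * norm (f1 (p t), f2 (p t))"
      by (simp add: mult_ac)
  qed
  then show ?thesis
    by (simp add: p_def)
qed

text \<open>
  Picard iteration. Convexity provides the primitives, and it confines the iteration from \<open>z0\<close> to
  a point to one segment: on a compact convex set that contains \<open>z0\<close> and on which \<open>k\<close>
  bounds the row sums of \<open>|a|\<close>, the \<open>n\<close>-th term is at most \<open>|c| (k |z - z0|)\<^sup>n / n!\<close>. So the series
  of the terms converges locally uniformly, and so does the series of their derivatives.
\<close>

lemma linear_ode_solution:
  fixes a :: "complex \<Rightarrow> complex^'n^'n" and c :: "complex^'n"
  assumes S: "open S" "convex S" "z0 \<in> S"
    and hol: "\<And>i j. (\<lambda>z. a z $ i $ j) holomorphic_on S"
  obtains f :: "complex \<Rightarrow> complex^'n" where "f z0 = c"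
    "\<And>z i. z \<in> S \<Longrightarrow> ((\<lambda>w. f w $ i) has_field_derivative (a z *v f z) $ i) (at z)"
proof -
  have "\<exists>p. p z0 = 0 \<and> (\<forall>z\<in>S. (p has_field_derivative h z) (at z))" if h: "h holomorphic_on S" for h
  proof -
    obtain q where q: "\<And>z. z \<in> S \<Longrightarrow> (q has_field_derivative h z) (at z within S)"
      by (rule holomorphic_convex_primitive'[OF S(2,1) h]) (rule that)
    have "((\<lambda>z. q z - q z0) has_field_derivative h z) (at z)" if "z \<in> S" for z
      using DERIV_diff[OF q[OF that, unfolded at_within_open[OF that S(1)]] DERIV_const[of "q z0"]]
      by (simp only: diff_0_right)
    then show ?thesis
      by (intro exI[of _ "\<lambda>z. q z - q z0"]) simp
  qed
  then obtain P where P0: "\<And>h. h holomorphic_on S \<Longrightarrow> P h z0 = 0"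
    and P: "\<And>h z. h holomorphic_on S \<Longrightarrow> z \<in> S \<Longrightarrow> (P h has_field_derivative h z) (at z)"
    by metis
  \<comment> \<open>the solution is the sum of these terms, each the primitive of \<open>a\<close> times the one before\<close>
  define g where "g = rec_nat (\<lambda>z. c) (\<lambda>n gn z. \<chi> i. P (\<lambda>w. (a w *v gn w) $ i) z)"
  have g_0: "g 0 z = c" and g_Suc: "g (Suc n) z $ i = P (\<lambda>w. (a w *v g n w) $ i) z" for n z i
    by (simp_all add: g_def)
  have g_hol: "(\<lambda>z. g n z $ i) holomorphic_on S" for n i
  proof (induction n arbitrary: i)
    case 0
    then show ?case by (simp add: g_0)
  next
    case (Suc n)
    have "(\<lambda>w. (a w *v g n w) $ i) holomorphic_on S"
      by (auto simp: matrix_vector_mult_def intro!: holomorphic_intros hol Suc)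
    from P[OF this] show ?case
      by (auto simp: g_Suc holomorphic_on_open[OF S(1)])
  qed
  have ag_hol: "(\<lambda>w. (a w *v g n w) $ i) holomorphic_on S" for n i
    by (auto simp: matrix_vector_mult_def intro!: holomorphic_intros hol g_hol)
  define g' where "g' n i z = (case n of 0 \<Rightarrow> 0 | Suc m \<Rightarrow> (a z *v g m z) $ i)" for n i z
  have g_der: "((\<lambda>w. g n w $ i) has_field_derivative g' n i z) (at z)" if "z \<in> S" for n i z
    using P[OF ag_hol that] by (cases n) (auto simp: g'_def g_0 g_Suc)
  have g_z0: "g (Suc n) z0 = 0" for n
    using P0[OF ag_hol] by (simp add: vec_eq_iff g_Suc)
  have bound: "norm (g n w $ i) \<le> norm c * (k * norm (w - z0)) ^ n / fact n"
    if T: "convex T" "z0 \<in> T" "T \<subseteq> S" and k: "\<And>v i. v \<in> T \<Longrightarrow> (\<Sum>j\<in>UNIV. norm (a v $ i $ j)) \<le> k"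
      and w: "w \<in> T" for T k n w i
    using w
  proof (induction n arbitrary: w i)
    case 0
    then show ?case by (simp add: g_0 Finite_Cartesian_Product.norm_nth_le)
  next
    case (Suc n)
    define d where "d = norm (w - z0)"
    define p where "p t = z0 + of_real t * (w - z0)" for t :: real
    have pT: "p t \<in> T" if "t \<in> {0..1}" for t
    proof -
      have "p t = (1 - t) *\<^sub>R z0 + t *\<^sub>R w"
        by (simp add: p_def scaleR_conv_of_real algebra_simps)
      then show ?thesis
        using that T Suc.prems by (auto simp: convex_alt)
    qed
    have dp: "(p has_vector_derivative (w - z0)) (at t)" for t
      unfolding p_def by (auto intro!: derivative_eq_intros)
    let ?h = "\<lambda>t. g (Suc n) (p t) $ i"
    let ?h' = "\<lambda>t. (w - z0) * (a (p t) *v g n (p t)) $ i"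
    let ?\<phi> = "\<lambda>t. norm c * (k * d * t) ^ Suc n / fact (Suc n)"
    let ?\<phi>' = "\<lambda>t. norm c * (k * d) * (k * d * t) ^ n / fact n"
    have "norm (?h 1 - ?h 0) \<le> ?\<phi> 1 - ?\<phi> 0"
    proof (rule differentiable_bound_general)
      have dh: "(?h has_vector_derivative ?h' t) (at t)" if "t \<in> {0..1}" for t
        using field_vector_diff_chain_at[OF dp g_der[of "p t" "Suc n" i]] pT[OF that] T(3)
        by (auto simp: g'_def o_def)
      have d\<phi>: "(?\<phi> has_vector_derivative ?\<phi>' t) (at t)" for t
        unfolding has_real_derivative_iff_has_vector_derivative[symmetric]
        by (auto intro!: derivative_eq_intros simp del: of_nat_Suc power_Suc)
      show "continuous_on {0..1} ?h"
        using dh by (intro continuous_at_imp_continuous_on ballI)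
          (auto dest: has_vector_derivative_continuous)
      show "continuous_on {0..1} ?\<phi>"
        by (intro continuous_intros) auto
      show "(?h has_vector_derivative ?h' t) (at t)" if "0 < t" "t < 1" for t
        using dh[of t] that by auto
      show "(?\<phi> has_vector_derivative ?\<phi>' t) (at t)" for t
        by (rule d\<phi>)
      show "norm (?h' t) \<le> ?\<phi>' t" if "0 < t" "t < 1" for t
      proof -
        have t: "t \<in> {0..1}" using that by simp
        let ?B = "norm c * (k * norm (p t - z0)) ^ n / fact n"
        have "norm ((a (p t) *v g n (p t)) $ i) \<le> (\<Sum>j\<in>UNIV. norm (a (p t) $ i $ j) * norm (g n (p t) $ j))"
          unfolding matrix_vector_mult_def by (simp add: norm_mult[symmetric] norm_sum)
        also have "\<dots> \<le> (\<Sum>j\<in>UNIV. norm (a (p t) $ i $ j) * ?B)"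
          by (intro sum_mono mult_left_mono Suc.IH[OF pT[OF t]]) auto
        also have "\<dots> = (\<Sum>j\<in>UNIV. norm (a (p t) $ i $ j)) * ?B"
          by (rule sum_distrib_right[symmetric])
        also have "\<dots> \<le> k * ?B"
        proof (rule mult_right_mono[OF k[OF pT[OF t]]])
          have "0 \<le> norm (g n (p t) $ i)" by simp
          also have "\<dots> \<le> ?B" by (rule Suc.IH[OF pT[OF t]])
          finally show "0 \<le> ?B" .
        qed
        also have "norm (p t - z0) = d * t"
          using that by (simp add: p_def d_def norm_mult)
        finally have "d * norm ((a (p t) *v g n (p t)) $ i) \<le> d * (k * (norm c * (k * (d * t)) ^ n / fact n))"
          by (rule mult_left_mono) (simp add: d_def)
        then show ?thesis
          by (simp add: norm_mult d_def[symmetric] mult_ac)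
      qed
    qed auto
    then show ?case
      by (simp add: p_def d_def g_z0 del: power_Suc fact_Suc)
  qed
  have local_bound: "\<exists>d h. 0 < d \<and> summable h \<and>
      (\<forall>\<^sub>F n in sequentially. \<forall>y\<in>ball z d \<inter> S. norm (g n y $ i) \<le> h n)" if z: "z \<in> S" for z i
  proof -
    obtain d where d: "d > 0" "cball z d \<subseteq> S"
      using S(1) z open_contains_cball by blast
    \<comment> \<open>compact, convex, contains \<open>z0\<close> and a neighbourhood of \<open>z\<close>, and lies in \<open>S\<close>\<close>
    define T where "T = convex hull (insert z0 (cball z d))"
    have TS: "T \<subseteq> S"
      unfolding T_def using d S by (intro hull_minimal) auto
    have Tc: "compact T"
      unfolding T_def by (intro compact_convex_hull compact_insert) auto
    have "continuous_on T (\<lambda>v. \<Sum>i\<in>UNIV. \<Sum>j\<in>UNIV. norm (a v $ i $ j))"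
      by (intro continuous_on_sum continuous_on_norm
          holomorphic_on_imp_continuous_on[OF holomorphic_on_subset[OF hol TS]])
    then have "bounded ((\<lambda>v. \<Sum>i\<in>UNIV. \<Sum>j\<in>UNIV. norm (a v $ i $ j)) ` T)"
      by (intro compact_imp_bounded compact_continuous_image Tc)
    then obtain k where k: "\<And>v. v \<in> T \<Longrightarrow> \<bar>\<Sum>i\<in>UNIV. \<Sum>j\<in>UNIV. norm (a v $ i $ j)\<bar> \<le> k"
      by (auto simp: bounded_iff)
    have k': "(\<Sum>j\<in>UNIV. norm (a v $ i $ j)) \<le> k" if "v \<in> T" for v i
    proof -
      have "(\<Sum>j\<in>UNIV. norm (a v $ i $ j)) \<le> (\<Sum>i\<in>UNIV. \<Sum>j\<in>UNIV. norm (a v $ i $ j))"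
        by (rule member_le_sum) (auto intro: sum_nonneg)
      then show ?thesis using k[OF that] by linarith
    qed
    have T0: "z0 \<in> T" "convex T" "cball z d \<subseteq> T"
      unfolding T_def by (auto intro: hull_inc)
    have k0: "0 \<le> k"
      using k[OF T0(1)] by linarith
    define R where "R = k * (norm (z - z0) + d)"
    have "norm (g n y $ i) \<le> norm c * (R ^ n / fact n)" if y: "y \<in> ball z d" for n y
    proof -
      have "norm (g n y $ i) \<le> norm c * (k * norm (y - z0)) ^ n / fact n"
        by (rule bound[OF T0(2,1) TS k']) (use y T0(3) in auto)
      moreover have "norm (y - z0) \<le> norm (z - z0) + d"
      proof -
        have "norm (y - z0) \<le> norm (y - z) + norm (z - z0)"
          by (rule norm_diff_triangle_ineq[of y z z z0, simplified])
        then show ?thesis using y by (simp add: dist_norm norm_minus_commute)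
      qed
      then have "(k * norm (y - z0)) ^ n \<le> R ^ n"
        unfolding R_def using k0 by (intro power_mono mult_left_mono) auto
      then have "norm c * (k * norm (y - z0)) ^ n / fact n \<le> norm c * R ^ n / fact n"
        by (intro divide_right_mono mult_left_mono) auto
      ultimately show ?thesis by simp
    qed
    moreover have "summable (\<lambda>n. norm c * (R ^ n / fact n))"
      using summable_exp[of R] by (intro summable_mult) (simp add: field_simps)
    ultimately show ?thesis
      using d(1) by (intro exI[of _ d] exI[of _ "\<lambda>n. norm c * (R ^ n / fact n)"]) auto
  qed
  have "\<exists>F F'. \<forall>z\<in>S. ((\<lambda>n. g n z $ i) sums F z) \<and> ((\<lambda>n. g' n i z) sums F' z) \<and>
      (F has_field_derivative F' z) (at z)" for i
    by (rule series_and_derivative_comparison_local[OF S(1) g_der local_bound])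
  then obtain F F' where F: "\<And>i z. z \<in> S \<Longrightarrow> (\<lambda>n. g n z $ i) sums F i z"
    and F': "\<And>i z. z \<in> S \<Longrightarrow> (\<lambda>n. g' n i z) sums F' i z"
    and FD: "\<And>i z. z \<in> S \<Longrightarrow> (F i has_field_derivative F' i z) (at z)"
    by metis
  define f where "f z = (\<chi> i. F i z)" for z
  show ?thesis
  proof
    show "f z0 = c"
    proof -
      have "(\<lambda>n. g n z0 $ i) sums (c $ i)" for i
      proof -
        have "(\<lambda>n. g n z0 $ i) = (\<lambda>n. if n = 0 then c $ i else 0)"
          by (rule ext, rename_tac n, case_tac n) (auto simp: g_0 g_z0)
        then show ?thesis
          using sums_single[of 0 "\<lambda>_. c $ i"] by simp
      qed
      then show ?thesis
        using F[OF S(3)] by (auto simp: f_def vec_eq_iff intro: sums_unique2)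
    qed
    fix z i assume z: "z \<in> S"
    have "(\<lambda>n. g' (Suc n) i z) sums (a z *v f z) $ i"
      unfolding g'_def nat.case matrix_vector_mult_def
      using F[OF z] by (auto simp: f_def intro!: sums_sum sums_mult)
    then have "(\<lambda>n. g' n i z) sums (a z *v f z) $ i"
      by (subst (asm) sums_Suc_iff) (simp add: g'_def)
    then have "F' i z = (a z *v f z) $ i"
      using F'[OF z] by (rule sums_unique2[rotated])
    then show "((\<lambda>w. f w $ i) has_field_derivative (a z *v f z) $ i) (at z)"
      using FD[OF z, of i] by (simp add: f_def)
  qed
qed



section \<open>Decay of solutions at an irregular singularity\<close>

text \<open>
  The logarithms of the points of the slit disc of radius \<open>exp x\<close> around 0, with the slit along the negative reals, form
  the half strip with \<open>w = pi\<close>; the point 0 corresponds to \<open>Re \<zeta> \<rightarrow> -\<infinity>\<close>.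
\<close>

definition half_strip :: "real \<Rightarrow> real \<Rightarrow> complex set" where
  "half_strip x w = {\<zeta>. Re \<zeta> < x \<and> \<bar>Im \<zeta>\<bar> < w}"

lemma half_strip_Int: "half_strip x w = {\<zeta>. Re \<zeta> < x} \<inter> {\<zeta>. Im \<zeta> < w} \<inter> {\<zeta>. - w < Im \<zeta>}"
  by (auto simp: half_strip_def)

lemma open_half_strip: "open (half_strip x w)"
  unfolding half_strip_Int
  by (intro open_Int open_halfspace_Re_lt open_halfspace_Im_lt open_halfspace_Im_gt)

lemma convex_half_strip: "convex (half_strip x w)"
  unfolding half_strip_Int
  by (intro convex_Int convex_halfspace_Re_lt convex_halfspace_Im_lt convex_halfspace_Im_gt)

lemma half_strip_mono: "x \<le> x' \<Longrightarrow> w \<le> w' \<Longrightarrow> half_strip x w \<subseteq> half_strip x' w'"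
  by (auto simp: half_strip_def)

lemma cball_half_strip:
  assumes "\<zeta> \<in> half_strip (x - \<rho>) (w - \<rho>)"
  shows "cball \<zeta> \<rho> \<subseteq> half_strip x w"
proof
  fix \<eta> assume "\<eta> \<in> cball \<zeta> \<rho>"
  then have "\<bar>Re (\<eta> - \<zeta>)\<bar> \<le> \<rho>" "\<bar>Im (\<eta> - \<zeta>)\<bar> \<le> \<rho>"
    using abs_Re_le_cmod[of "\<eta> - \<zeta>"] abs_Im_le_cmod[of "\<eta> - \<zeta>"]
    by (auto simp: dist_norm norm_minus_commute)
  then show "\<eta> \<in> half_strip x w"
    using assms by (auto simp: half_strip_def)
qed

text \<open>
  In terms of \<open>z = exp \<zeta>\<close> the function is \<open>O(|z|\<^sup>N)\<close>.
\<close>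

definition exp_bounded_on :: "complex set \<Rightarrow> real \<Rightarrow> (complex \<Rightarrow> complex) \<Rightarrow> bool" where
  "exp_bounded_on S N F \<longleftrightarrow> (\<exists>C. \<forall>\<zeta>\<in>S. norm (F \<zeta>) \<le> C * exp (N * Re \<zeta>))"

lemma exp_bounded_on_subset: "exp_bounded_on S N F \<Longrightarrow> T \<subseteq> S \<Longrightarrow> exp_bounded_on T N F"
  unfolding exp_bounded_on_def by blast

lemma exp_bounded_on_cong:
  "exp_bounded_on S N F \<Longrightarrow> (\<And>\<zeta>. \<zeta> \<in> S \<Longrightarrow> F \<zeta> = G \<zeta>) \<Longrightarrow> exp_bounded_on S N G"
  unfolding exp_bounded_on_def by metis

lemma exp_bounded_on_weaken:
  assumes bnd: "exp_bounded_on S N F" and "M \<le> N" and S: "\<And>\<zeta>. \<zeta> \<in> S \<Longrightarrow> Re \<zeta> \<le> 0"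
  shows "exp_bounded_on S M F"
proof -
  obtain C where C: "\<And>\<zeta>. \<zeta> \<in> S \<Longrightarrow> norm (F \<zeta>) \<le> C * exp (N * Re \<zeta>)"
    using bnd unfolding exp_bounded_on_def by blast
  have "norm (F \<zeta>) \<le> C * exp (M * Re \<zeta>)" if \<zeta>: "\<zeta> \<in> S" for \<zeta>
  proof -
    have "N * Re \<zeta> \<le> M * Re \<zeta>"
      using \<open>M \<le> N\<close> S[OF \<zeta>] by (intro mult_right_mono_neg) auto
    moreover have "0 \<le> C"
      using order_trans[OF norm_ge_zero C[OF \<zeta>]] by (simp add: zero_le_mult_iff)
    ultimately have "C * exp (N * Re \<zeta>) \<le> C * exp (M * Re \<zeta>)"
      by (intro mult_left_mono) auto
    then show ?thesis using C[OF \<zeta>] by linarith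
  qed
  then show ?thesis
    unfolding exp_bounded_on_def by blast
qed

lemma exp_bounded_on_add:
  assumes "exp_bounded_on S N F" "exp_bounded_on S N G"
  shows "exp_bounded_on S N (\<lambda>\<zeta>. F \<zeta> + G \<zeta>)"
proof -
  obtain C D where "\<And>\<zeta>. \<zeta> \<in> S \<Longrightarrow> norm (F \<zeta>) \<le> C * exp (N * Re \<zeta>)"
    "\<And>\<zeta>. \<zeta> \<in> S \<Longrightarrow> norm (G \<zeta>) \<le> D * exp (N * Re \<zeta>)"
    using assms unfolding exp_bounded_on_def by blast
  then have "norm (F \<zeta> + G \<zeta>) \<le> (C + D) * exp (N * Re \<zeta>)" if "\<zeta> \<in> S" for \<zeta>
    using that norm_triangle_ineq[of "F \<zeta>" "G \<zeta>"] by (fastforce simp: algebra_simps)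
  then show ?thesis
    unfolding exp_bounded_on_def by blast
qed

lemma exp_bounded_on_mult:
  assumes "exp_bounded_on S N F" "exp_bounded_on S M G"
  shows "exp_bounded_on S (N + M) (\<lambda>\<zeta>. F \<zeta> * G \<zeta>)"
proof -
  obtain C D where C: "\<And>\<zeta>. \<zeta> \<in> S \<Longrightarrow> norm (F \<zeta>) \<le> C * exp (N * Re \<zeta>)"
    and D: "\<And>\<zeta>. \<zeta> \<in> S \<Longrightarrow> norm (G \<zeta>) \<le> D * exp (M * Re \<zeta>)"
    using assms unfolding exp_bounded_on_def by blast
  have "norm (F \<zeta> * G \<zeta>) \<le> (C * D) * exp ((N + M) * Re \<zeta>)" if "\<zeta> \<in> S" for \<zeta>
  proof -
    have "norm (F \<zeta>) * norm (G \<zeta>) \<le> (C * exp (N * Re \<zeta>)) * (D * exp (M * Re \<zeta>))"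
      using C[OF that] D[OF that] order_trans[OF norm_ge_zero C[OF that]] by (intro mult_mono) auto
    moreover have "exp ((N + M) * Re \<zeta>) = exp (N * Re \<zeta>) * exp (M * Re \<zeta>)"
      by (simp add: distrib_right exp_add)
    ultimately show ?thesis
      by (simp add: norm_mult mult_ac)
  qed
  then show ?thesis
    unfolding exp_bounded_on_def by blast
qed

text \<open>
  Cauchy's estimate on discs of the fixed radius \<open>\<rho>\<close>, on which \<open>exp (N Re \<zeta>)\<close> varies by a
  bounded factor only. This is the advantage of the coordinate \<open>\<zeta>\<close> over \<open>z\<close>: differentiation
  costs a strip of constant width but no power of \<open>|z|\<close>.
\<close>

lemma exp_bounded_on_deriv:
  assumes hol: "F holomorphic_on half_strip x w"
    and bnd: "exp_bounded_on (half_strip x w) N F" and \<rho>: "\<rho> > 0"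
  shows "exp_bounded_on (half_strip (x - \<rho>) (w - \<rho>)) N (deriv F)"
proof -
  obtain C where C: "\<And>\<zeta>. \<zeta> \<in> half_strip x w \<Longrightarrow> norm (F \<zeta>) \<le> C * exp (N * Re \<zeta>)"
    using bnd unfolding exp_bounded_on_def by blast
  have "norm (deriv F \<zeta>) \<le> C * exp (\<bar>N\<bar> * \<rho>) / \<rho> * exp (N * Re \<zeta>)"
    if \<zeta>: "\<zeta> \<in> half_strip (x - \<rho>) (w - \<rho>)" for \<zeta>
  proof -
    have sub: "cball \<zeta> \<rho> \<subseteq> half_strip x w"
      by (rule cball_half_strip[OF \<zeta>])
    have "norm ((deriv ^^ 1) F \<zeta>) \<le> fact 1 * (C * exp (\<bar>N\<bar> * \<rho>) * exp (N * Re \<zeta>)) / \<rho> ^ 1"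
    proof (rule Cauchy_inequality)
      show "F holomorphic_on ball \<zeta> \<rho>"
        using hol by (rule holomorphic_on_subset) (use sub in auto)
      show "continuous_on (cball \<zeta> \<rho>) F"
        using holomorphic_on_imp_continuous_on[OF hol] sub by (rule continuous_on_subset)
      fix \<eta> assume \<eta>: "norm (\<zeta> - \<eta>) = \<rho>"
      then have \<eta>': "\<eta> \<in> half_strip x w"
        using sub by (auto simp: dist_norm)
      have "N * (Re \<eta> - Re \<zeta>) \<le> \<bar>N\<bar> * \<rho>"
        using abs_Re_le_cmod[of "\<zeta> - \<eta>"] \<eta> abs_le_D1[OF eq_refl[OF abs_mult[of N "Re \<eta> - Re \<zeta>"]]]
        by (smt (verit, ccfv_SIG) minus_complex.simps(1) mult_left_mono)
      then have "exp (N * Re \<eta>) \<le> exp (\<bar>N\<bar> * \<rho> + N * Re \<zeta>)"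
        by (simp add: algebra_simps)
      moreover have "0 \<le> C"
        using order_trans[OF norm_ge_zero C[OF \<eta>']] by (simp add: zero_le_mult_iff)
      ultimately have "C * exp (N * Re \<eta>) \<le> C * exp (\<bar>N\<bar> * \<rho> + N * Re \<zeta>)"
        by (intro mult_left_mono)
      then show "norm (F \<eta>) \<le> C * exp (\<bar>N\<bar> * \<rho>) * exp (N * Re \<zeta>)"
        using C[OF \<eta>'] by (simp add: exp_add mult_ac)
    qed (use \<rho> in auto)
    then show ?thesis by simp
  qed
  then show ?thesis
    unfolding exp_bounded_on_def by blast
qed

lemma exp_bounded_on_bounded:
  "(\<And>\<zeta>. \<zeta> \<in> S \<Longrightarrow> norm (F \<zeta>) \<le> k) \<Longrightarrow> exp_bounded_on S 0 F"
  unfolding exp_bounded_on_def by auto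

text \<open>
  Solved for the undifferentiated functions the equations read \<open>F2 = -e\<^sup>\<zeta> (F1' + b11 F1) / b12\<close> and
  \<open>F1 = -(F2' + b22 F2) / b21\<close>. The factor \<open>e\<^sup>\<zeta>\<close> gains one order of decay for \<open>F2\<close>, and the second
  equation passes it on to \<open>F1\<close>; the gain is repeated as often as wanted.
\<close>

lemma irregular_descent:
  fixes F1 F2 :: "complex \<Rightarrow> complex"
  assumes der: "\<And>\<zeta>. \<zeta> \<in> half_strip x w \<Longrightarrow>
        (F1 has_field_derivative - (b11 \<zeta> * F1 \<zeta> + exp (- \<zeta>) * b12 \<zeta> * F2 \<zeta>)) (at \<zeta>)"
      "\<And>\<zeta>. \<zeta> \<in> half_strip x w \<Longrightarrow>
        (F2 has_field_derivative - (b21 \<zeta> * F1 \<zeta> + b22 \<zeta> * F2 \<zeta>)) (at \<zeta>)"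
    and b: "\<And>\<zeta>. \<zeta> \<in> half_strip x w \<Longrightarrow> norm (b11 \<zeta>) \<le> k"
      "\<And>\<zeta>. \<zeta> \<in> half_strip x w \<Longrightarrow> norm (b22 \<zeta>) \<le> k"
      "\<And>\<zeta>. \<zeta> \<in> half_strip x w \<Longrightarrow> norm (inverse (b12 \<zeta>)) \<le> k"
      "\<And>\<zeta>. \<zeta> \<in> half_strip x w \<Longrightarrow> norm (inverse (b21 \<zeta>)) \<le> k"
    and nz: "\<And>\<zeta>. \<zeta> \<in> half_strip x w \<Longrightarrow> b12 \<zeta> \<noteq> 0 \<and> b21 \<zeta> \<noteq> 0"
    and w: "w > 0"
    and start: "exp_bounded_on (half_strip x w) N F1" "exp_bounded_on (half_strip x w) N F2"
  shows "\<exists>x' w'. w' > 0 \<and> exp_bounded_on (half_strip x' w') M F1 \<and> exp_bounded_on (half_strip x' w') M F2"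
proof -
  have hol: "F1 holomorphic_on half_strip x w" "F2 holomorphic_on half_strip x w"
    using der by (auto simp: holomorphic_on_open[OF open_half_strip])
  have step: "exp_bounded_on (half_strip (x' - 2 * \<rho>) (w' - 2 * \<rho>)) (L + 1) F1 \<and>
      exp_bounded_on (half_strip (x' - 2 * \<rho>) (w' - 2 * \<rho>)) (L + 1) F2"
    if L: "exp_bounded_on (half_strip x' w') L F1" "exp_bounded_on (half_strip x' w') L F2"
      and le: "x' \<le> x" "w' \<le> w" and \<rho>: "\<rho> > 0" for x' w' L \<rho>
  proof -
    let ?S = "half_strip x' w'" and ?S1 = "half_strip (x' - \<rho>) (w' - \<rho>)"
      and ?S2 = "half_strip (x' - 2 * \<rho>) (w' - 2 * \<rho>)"
    have sub: "?S \<subseteq> half_strip x w" "?S1 \<subseteq> half_strip x w" "?S2 \<subseteq> half_strip x w" "?S1 \<subseteq> ?S" "?S2 \<subseteq> ?S1"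
      using le \<rho> by (intro half_strip_mono; simp)+
    have "exp_bounded_on ?S1 L (deriv F1)"
      by (rule exp_bounded_on_deriv[OF holomorphic_on_subset[OF hol(1) sub(1)] L(1) \<rho>])
    moreover have "exp_bounded_on ?S1 (0 + L) (\<lambda>\<zeta>. b11 \<zeta> * F1 \<zeta>)"
      using b(1) sub L(1)
      by (intro exp_bounded_on_mult exp_bounded_on_bounded) (auto intro: exp_bounded_on_subset)
    ultimately have "exp_bounded_on ?S1 L (\<lambda>\<zeta>. deriv F1 \<zeta> + b11 \<zeta> * F1 \<zeta>)"
      by (intro exp_bounded_on_add) auto
    moreover have "exp_bounded_on ?S1 (1 + 0) (\<lambda>\<zeta>. - exp \<zeta> * inverse (b12 \<zeta>))"
      using b(3) sub
      by (intro exp_bounded_on_mult exp_bounded_on_bounded[of _ _ k])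
        (auto simp: exp_bounded_on_def intro!: exI[of _ 1])
    ultimately have "exp_bounded_on ?S1 (L + (1 + 0))
        (\<lambda>\<zeta>. (deriv F1 \<zeta> + b11 \<zeta> * F1 \<zeta>) * (- exp \<zeta> * inverse (b12 \<zeta>)))"
      by (rule exp_bounded_on_mult)
    then have F2: "exp_bounded_on ?S1 (L + 1) F2"
      unfolding add_0_right
    proof (rule exp_bounded_on_cong)
      fix \<zeta> assume "\<zeta> \<in> ?S1"
      then have \<zeta>: "\<zeta> \<in> half_strip x w" using sub by blast
      show "(deriv F1 \<zeta> + b11 \<zeta> * F1 \<zeta>) * (- exp \<zeta> * inverse (b12 \<zeta>)) = F2 \<zeta>"
        using nz[OF \<zeta>] by (simp add: DERIV_imp_deriv[OF der(1)[OF \<zeta>]] exp_minus field_simps)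
    qed
    have "F2 holomorphic_on ?S1"
      using hol(2) sub(2) by (rule holomorphic_on_subset)
    from exp_bounded_on_deriv[OF this F2 \<rho>] have "exp_bounded_on ?S2 (L + 1) (deriv F2)"
      by (simp add: diff_diff_eq)
    moreover have "exp_bounded_on ?S2 (0 + (L + 1)) (\<lambda>\<zeta>. b22 \<zeta> * F2 \<zeta>)"
      using b(2) sub F2
      by (intro exp_bounded_on_mult exp_bounded_on_bounded) (auto intro: exp_bounded_on_subset)
    ultimately have "exp_bounded_on ?S2 (L + 1) (\<lambda>\<zeta>. deriv F2 \<zeta> + b22 \<zeta> * F2 \<zeta>)"
      by (intro exp_bounded_on_add) auto
    moreover have "exp_bounded_on ?S2 0 (\<lambda>\<zeta>. - inverse (b21 \<zeta>))"
      using b(4) sub by (intro exp_bounded_on_bounded[of _ _ k]) auto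
    ultimately have "exp_bounded_on ?S2 (L + 1 + 0)
        (\<lambda>\<zeta>. (deriv F2 \<zeta> + b22 \<zeta> * F2 \<zeta>) * (- inverse (b21 \<zeta>)))"
      by (rule exp_bounded_on_mult)
    then have "exp_bounded_on ?S2 (L + 1) F1"
      unfolding add_0_right
    proof (rule exp_bounded_on_cong)
      fix \<zeta> assume "\<zeta> \<in> ?S2"
      then have \<zeta>: "\<zeta> \<in> half_strip x w" using sub by blast
      show "(deriv F2 \<zeta> + b22 \<zeta> * F2 \<zeta>) * (- inverse (b21 \<zeta>)) = F1 \<zeta>"
        using nz[OF \<zeta>] by (simp add: DERIV_imp_deriv[OF der(2)[OF \<zeta>]] field_simps)
    qed
    with F2 sub(5) show ?thesis
      by (blast intro: exp_bounded_on_subset)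
  qed
  have "exp_bounded_on (half_strip (x - 2 * real n * \<rho>) (w - 2 * real n * \<rho>)) (N + real n) F1 \<and>
      exp_bounded_on (half_strip (x - 2 * real n * \<rho>) (w - 2 * real n * \<rho>)) (N + real n) F2"
    if "\<rho> > 0" for n \<rho>
  proof (induction n)
    case 0
    then show ?case using start by simp
  next
    case (Suc n)
    have *: "x - 2 * real n * \<rho> - 2 * \<rho> = x - 2 * real (Suc n) * \<rho>"
      "w - 2 * real n * \<rho> - 2 * \<rho> = w - 2 * real (Suc n) * \<rho>" "N + real n + 1 = N + real (Suc n)"
      by (simp_all add: algebra_simps)
    show ?case
      using step[OF conjunct1[OF Suc.IH] conjunct2[OF Suc.IH] _ _ that] that unfolding * by simp
  qed
  moreover obtain n :: nat where n: "M - N \<le> real n"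
    using real_arch_simple by blast
  \<comment> \<open>each step costs the width \<open>2 \<rho>\<close>, and after \<open>n\<close> steps a positive width must remain\<close>
  moreover define \<rho> where "\<rho> = w / (2 * (real n + 1))"
  moreover have "\<rho> > 0" "w - 2 * real n * \<rho> > 0"
    using w by (simp_all add: \<rho>_def field_simps)
  ultimately have *: "exp_bounded_on (half_strip (x - 2 * real n * \<rho>) (w - 2 * real n * \<rho>)) (N + real n) F1"
    "exp_bounded_on (half_strip (x - 2 * real n * \<rho>) (w - 2 * real n * \<rho>)) (N + real n) F2"
    "w - 2 * real n * \<rho> > 0"
    by blast+
  have weaken: "exp_bounded_on (half_strip (min 0 x') w') M F"
    if "exp_bounded_on (half_strip x' w') (N + real n) F" for x' w' F
  proof (rule exp_bounded_on_weaken)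
    show "exp_bounded_on (half_strip (min 0 x') w') (N + real n) F"
      by (rule exp_bounded_on_subset[OF that half_strip_mono]) simp_all
    show "M \<le> N + real n" using n by simp
    show "Re \<zeta> \<le> 0" if "\<zeta> \<in> half_strip (min 0 x') w'" for \<zeta>
      using that by (simp add: half_strip_def)
  qed
  show ?thesis
    using *(3) weaken[OF *(1)] weaken[OF *(2)] by blast
qed



text \<open>
  By Liouville's formula the determinant solves the scalar equation whose coefficient is the trace,
  so a bound for the trace suffices even where the entry \<open>b\<close> is unbounded. The roles of \<open>\<zeta>0\<close> and \<open>\<zeta>\<close> can be
  exchanged, which gives lower bounds for the determinant.
\<close>

lemma determinant_growth_bound:
  fixes F1 F2 G1 G2 :: "complex \<Rightarrow> complex"
  assumes S: "convex S" "\<zeta>0 \<in> S" "\<zeta> \<in> S"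
    and der: "\<And>\<zeta>. \<zeta> \<in> S \<Longrightarrow> (F1 has_field_derivative a \<zeta> * F1 \<zeta> + b \<zeta> * F2 \<zeta>) (at \<zeta>)"
      "\<And>\<zeta>. \<zeta> \<in> S \<Longrightarrow> (F2 has_field_derivative c \<zeta> * F1 \<zeta> + d \<zeta> * F2 \<zeta>) (at \<zeta>)"
      "\<And>\<zeta>. \<zeta> \<in> S \<Longrightarrow> (G1 has_field_derivative a \<zeta> * G1 \<zeta> + b \<zeta> * G2 \<zeta>) (at \<zeta>)"
      "\<And>\<zeta>. \<zeta> \<in> S \<Longrightarrow> (G2 has_field_derivative c \<zeta> * G1 \<zeta> + d \<zeta> * G2 \<zeta>) (at \<zeta>)"
    and tr: "\<And>\<zeta>. \<zeta> \<in> S \<Longrightarrow> norm (a \<zeta> + d \<zeta>) \<le> K"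
  shows "norm (F1 \<zeta> * G2 \<zeta> - G1 \<zeta> * F2 \<zeta>) \<le> norm (F1 \<zeta>0 * G2 \<zeta>0 - G1 \<zeta>0 * F2 \<zeta>0) * exp (K * norm (\<zeta> - \<zeta>0))"
proof -
  let ?D = "\<lambda>\<zeta>. F1 \<zeta> * G2 \<zeta> - G1 \<zeta> * F2 \<zeta>"
  have "norm (?D \<zeta>, 0::complex) \<le> norm (?D \<zeta>0, 0::complex) * exp (K * norm (\<zeta> - \<zeta>0))"
  proof (rule linear_growth_bound_convex[where ?f1.0 = ?D and ?f2.0 = "\<lambda>_. 0" and
        ?f1' = "\<lambda>\<zeta>. (a \<zeta> + d \<zeta>) * ?D \<zeta>" and ?f2' = "\<lambda>_. 0"])
    show "(?D has_field_derivative (a \<eta> + d \<eta>) * ?D \<eta>) (at \<eta>)" if "\<eta> \<in> S" for \<eta>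
      by (rule DERIV_cong[OF DERIV_diff[OF DERIV_mult[OF der(1)[OF that] der(4)[OF that]]
              DERIV_mult[OF der(3)[OF that] der(2)[OF that]]]]) (simp add: algebra_simps)
    show "norm ((a \<eta> + d \<eta>) * ?D \<eta>, 0::complex) \<le> K * norm (?D \<eta>, 0::complex)" if "\<eta> \<in> S" for \<eta>
      using mult_right_mono[OF tr[OF that] norm_ge_zero[of "?D \<eta>"]] by (simp add: norm_Pair norm_mult)
  qed (use S in auto)
  then show ?thesis by (simp add: norm_Pair)
qed

text \<open>
  Both columns decay like a power that is arbitrarily high, hence so does the determinant; but the
  determinant is bounded below by a constant times \<open>exp (2 k Re \<zeta>)\<close>, because the trace of the
  system is bounded by \<open>2 k\<close>.
\<close>

lemma no_moderate_frame_at_irregular_point: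
  fixes F1 F2 G1 G2 :: "complex \<Rightarrow> complex"
  assumes der: "\<And>\<zeta>. \<zeta> \<in> half_strip x w \<Longrightarrow>
        (F1 has_field_derivative - (b11 \<zeta> * F1 \<zeta> + exp (- \<zeta>) * b12 \<zeta> * F2 \<zeta>)) (at \<zeta>)"
      "\<And>\<zeta>. \<zeta> \<in> half_strip x w \<Longrightarrow>
        (F2 has_field_derivative - (b21 \<zeta> * F1 \<zeta> + b22 \<zeta> * F2 \<zeta>)) (at \<zeta>)"
      "\<And>\<zeta>. \<zeta> \<in> half_strip x w \<Longrightarrow>
        (G1 has_field_derivative - (b11 \<zeta> * G1 \<zeta> + exp (- \<zeta>) * b12 \<zeta> * G2 \<zeta>)) (at \<zeta>)"
      "\<And>\<zeta>. \<zeta> \<in> half_strip x w \<Longrightarrow>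
        (G2 has_field_derivative - (b21 \<zeta> * G1 \<zeta> + b22 \<zeta> * G2 \<zeta>)) (at \<zeta>)"
    and b: "\<And>\<zeta>. \<zeta> \<in> half_strip x w \<Longrightarrow> norm (b11 \<zeta>) \<le> k"
      "\<And>\<zeta>. \<zeta> \<in> half_strip x w \<Longrightarrow> norm (b22 \<zeta>) \<le> k"
      "\<And>\<zeta>. \<zeta> \<in> half_strip x w \<Longrightarrow> norm (inverse (b12 \<zeta>)) \<le> k"
      "\<And>\<zeta>. \<zeta> \<in> half_strip x w \<Longrightarrow> norm (inverse (b21 \<zeta>)) \<le> k"
    and nz: "\<And>\<zeta>. \<zeta> \<in> half_strip x w \<Longrightarrow> b12 \<zeta> \<noteq> 0 \<and> b21 \<zeta> \<noteq> 0"
    and w: "w > 0"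
    and start: "exp_bounded_on (half_strip x w) N F1" "exp_bounded_on (half_strip x w) N F2"
      "exp_bounded_on (half_strip x w) N G1" "exp_bounded_on (half_strip x w) N G2"
    and \<zeta>0: "\<zeta>0 \<in> half_strip x w" "F1 \<zeta>0 * G2 \<zeta>0 - G1 \<zeta>0 * F2 \<zeta>0 \<noteq> 0"
  shows False
proof -
  let ?D = "\<lambda>\<zeta>. F1 \<zeta> * G2 \<zeta> - G1 \<zeta> * F2 \<zeta>"
  \<comment> \<open>the products in the determinant are then \<open>O(exp ((2 k + 1) Re \<zeta>))\<close>, too small for the lower bound\<close>
  define L where "L = k + 1 / 2"
  obtain x1 w1 where F: "w1 > 0" "exp_bounded_on (half_strip x1 w1) L F1" "exp_bounded_on (half_strip x1 w1) L F2"
    using irregular_descent[OF der(1,2) b nz w start(1,2), of L] by auto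
  obtain x2 w2 where G: "w2 > 0" "exp_bounded_on (half_strip x2 w2) L G1" "exp_bounded_on (half_strip x2 w2) L G2"
    using irregular_descent[OF der(3,4) b nz w start(3,4), of L] by auto
  define X where "X = min x (min x1 x2)"
  define S where "S = {\<zeta>. Im \<zeta> = 0 \<and> Re \<zeta> < X}"
  have S: "S \<subseteq> half_strip x1 w1" "S \<subseteq> half_strip x2 w2" "S \<subseteq> half_strip x w"
    using F(1) G(1) w by (auto simp: S_def X_def half_strip_def)
  have "exp_bounded_on S (L + L) (\<lambda>\<zeta>. F1 \<zeta> * G2 \<zeta>)"
    by (intro exp_bounded_on_mult exp_bounded_on_subset[OF F(2) S(1)] exp_bounded_on_subset[OF G(3) S(2)])
  moreover have "exp_bounded_on S (L + L) (\<lambda>\<zeta>. G1 \<zeta> * F2 \<zeta>)"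
    by (intro exp_bounded_on_mult exp_bounded_on_subset[OF G(2) S(2)] exp_bounded_on_subset[OF F(3) S(1)])
  then have "exp_bounded_on S (L + L) (\<lambda>\<zeta>. - (G1 \<zeta> * F2 \<zeta>))"
    by (simp add: exp_bounded_on_def)
  ultimately have "exp_bounded_on S (L + L) (\<lambda>\<zeta>. F1 \<zeta> * G2 \<zeta> + - (G1 \<zeta> * F2 \<zeta>))"
    by (rule exp_bounded_on_add)
  moreover have "L + L = 2 * k + 1" by (simp add: L_def)
  ultimately have "exp_bounded_on S (2 * k + 1) (\<lambda>\<zeta>. F1 \<zeta> * G2 \<zeta> + - (G1 \<zeta> * F2 \<zeta>))"
    by simp
  then obtain C where C: "\<And>\<zeta>. \<zeta> \<in> S \<Longrightarrow> norm (?D \<zeta>) \<le> C * exp ((2 * k + 1) * Re \<zeta>)"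
    unfolding exp_bounded_on_def by auto
  have lower: "norm (?D \<zeta>0) \<le> norm (?D \<zeta>) * exp (2 * k * norm (\<zeta>0 - \<zeta>))" if "\<zeta> \<in> S" for \<zeta>
  proof (rule determinant_growth_bound[where a = "\<lambda>\<zeta>. - b11 \<zeta>" and b = "\<lambda>\<zeta>. - (exp (- \<zeta>) * b12 \<zeta>)"
        and c = "\<lambda>\<zeta>. - b21 \<zeta>" and d = "\<lambda>\<zeta>. - b22 \<zeta>", OF convex_half_strip _ \<zeta>0(1)])
    show "\<zeta> \<in> half_strip x w" using that S by blast
    fix \<eta> assume \<eta>: "\<eta> \<in> half_strip x w"
    show "norm (- b11 \<eta> + - b22 \<eta>) \<le> 2 * k"
      using norm_triangle_ineq[of "- b11 \<eta>" "- b22 \<eta>"] b(1,2)[OF \<eta>] by simp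
  qed (use der in \<open>auto simp: algebra_simps\<close>)
  define d0 where "d0 = norm (?D \<zeta>0)"
  have d0: "d0 > 0" using \<zeta>0(2) by (simp add: d0_def)
  have k0: "0 \<le> k" using b(1)[OF \<zeta>0(1)] norm_ge_zero order_trans by blast
  define K where "K = C * exp (2 * k * (norm \<zeta>0))"
  have main: "d0 \<le> K * exp t" if t: "t < X" "t \<le> 0" for t
  proof -
    have tS: "of_real t \<in> S" using t by (simp add: S_def)
    have "norm (\<zeta>0 - of_real t) \<le> norm \<zeta>0 - t"
      using norm_triangle_ineq4[of \<zeta>0 "of_real t"] t(2) by simp
    then have "exp (2 * k * norm (\<zeta>0 - of_real t)) \<le> exp (2 * k * (norm \<zeta>0 - t))"
      using k0 by (simp add: mult_left_mono)
    then have "norm (?D (of_real t)) * exp (2 * k * norm (\<zeta>0 - of_real t)) \<le>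
        (C * exp ((2 * k + 1) * t)) * exp (2 * k * (norm \<zeta>0 - t))"
      using C[OF tS] by (intro mult_mono) (auto intro: order_trans[OF norm_ge_zero C[OF tS], simplified])
    also have "\<dots> = K * exp t"
      by (simp add: K_def mult_exp_exp algebra_simps)
    finally show ?thesis
      using lower[OF tS] by (simp add: d0_def)
  qed
  have "((\<lambda>t. K * exp t) \<longlongrightarrow> K * 0) at_bot"
    by (intro tendsto_intros exp_at_bot)
  then have "\<forall>\<^sub>F t in at_bot. K * exp t < d0"
    using d0 by (auto dest: order_tendstoD(2))
  moreover have "\<forall>\<^sub>F t in at_bot. t < X" "\<forall>\<^sub>F t in at_bot. t \<le> (0::real)"
    by (rule eventually_gt_at_bot, rule eventually_le_at_bot)
  ultimately have "\<forall>\<^sub>F t::real in at_bot. False"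
    by eventually_elim (use main in force)
  then show False by simp
qed

section \<open>Formal base change and nilpotent matrices\<close>

lemma vec2_eq_iff: "(x :: 'a^2) = y \<longleftrightarrow> x $ 1 = y $ 1 \<and> x $ 2 = y $ 2"
  by (simp add: vec_eq_iff forall_2)

lemma matrix_mult_2: "((A :: 'a::semiring_1^2^2) ** B) $ i $ j = A $ i $ 1 * B $ 1 $ j + A $ i $ 2 * B $ 2 $ j"
  by (simp add: matrix_matrix_mult_def sum_2)

lemma matrix_vector_mult_2: "((A :: 'a::semiring_1^2^2) *v x) $ i = A $ i $ 1 * x $ 1 + A $ i $ 2 * x $ 2"
  by (simp add: matrix_vector_mult_def sum_2)

lemma trace_2: "trace (A :: 'a::comm_ring_1^2^2) = A $ 1 $ 1 + A $ 2 $ 2"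
  by (simp add: trace_def sum_2)

lemma invertible_matrix_inv:
  fixes A :: "'a::semiring_1^'n^'n"
  assumes "invertible A"
  shows "A ** matrix_inv A = mat 1" "matrix_inv A ** A = mat 1"
  using someI_ex[OF assms[unfolded invertible_def]] by (auto simp: matrix_inv_def)

text \<open>
  The term with the derivative is divisible by \<open>X\<^sup>2\<close>, so \<open>B'\<close> is conjugate to \<open>B\<close> modulo \<open>X\<^sup>2\<close>.
\<close>

lemma gauge_invariants:
  fixes B B' G :: "complex fps^2^2"
  assumes inv: "invertible G"
    and gauge: "(\<chi> i j. fps_X\<^sup>2 * fps_deriv (G $ i $ j)) + B ** G = G ** B'"
  shows "k \<le> 1 \<Longrightarrow> fps_nth (trace B') k = fps_nth (trace B) k"
    and "k \<le> 1 \<Longrightarrow> fps_nth (det B') k = fps_nth (det B) k"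
    and "(\<forall>i j. fps_nth (B' $ i $ j) 0 = 0) \<longleftrightarrow> (\<forall>i j. fps_nth (B $ i $ j) 0 = 0)"
proof -
  define E :: "complex fps^2^2" where "E = (\<chi> i j. fps_deriv (G $ i $ j))"
  define Gi where "Gi = matrix_inv G"
  have Gi: "G ** Gi = mat 1" "Gi ** G = mat 1"
    using invertible_matrix_inv[OF inv] by (simp_all add: Gi_def)
  have X2: "fps_nth (fps_X\<^sup>2 * f) k = 0" if "k \<le> 1" for f :: "complex fps" and k
    using that by (simp add: fps_X_power_mult_nth)
  define R where "R = Gi ** E"
  have eqB': "B' = (\<chi> i j. fps_X\<^sup>2 * R $ i $ j) + Gi ** B ** G"
  proof -
    have "B' = Gi ** (G ** B')"
      by (simp add: matrix_mul_assoc Gi)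
    also have "\<dots> = Gi ** (\<chi> i j. fps_X\<^sup>2 * E $ i $ j) + Gi ** (B ** G)"
      by (simp add: gauge[symmetric] matrix_add_ldistrib E_def)
    also have "Gi ** (\<chi> i j. fps_X\<^sup>2 * E $ i $ j) = (\<chi> i j. fps_X\<^sup>2 * R $ i $ j)"
      by (simp add: vec_eq_iff matrix_mult_2 R_def algebra_simps)
    finally show ?thesis
      by (simp add: matrix_mul_assoc)
  qed
  define R' where "R' = E ** Gi"
  have eqB: "B = G ** B' ** Gi - (\<chi> i j. fps_X\<^sup>2 * R' $ i $ j)"
  proof -
    have "G ** B' ** Gi = (\<chi> i j. fps_X\<^sup>2 * E $ i $ j) ** Gi + B ** (G ** Gi)"
      by (simp add: gauge[symmetric] matrix_mul_assoc[symmetric] E_def)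
        (simp add: vec_eq_iff matrix_mult_2 algebra_simps)
    also have "(\<chi> i j. fps_X\<^sup>2 * E $ i $ j) ** Gi = (\<chi> i j. fps_X\<^sup>2 * R' $ i $ j)"
      by (simp add: vec_eq_iff matrix_mult_2 R'_def algebra_simps)
    finally show ?thesis
      by (simp add: Gi)
  qed
  show "fps_nth (trace B') k = fps_nth (trace B) k" if k: "k \<le> 1" for k
  proof -
    have "trace (Gi ** B ** G) = trace B"
      by (metis Gi(1) matrix_mul_assoc matrix_mul_lid trace_mul_sym)
    moreover have "trace B' = fps_X\<^sup>2 * trace R + trace (Gi ** B ** G)"
      unfolding eqB' by (simp add: trace_2 algebra_simps)
    ultimately show ?thesis
      using X2[OF k, of "trace R"] by simp
  qed
  show "fps_nth (det B') k = fps_nth (det B) k" if k: "k \<le> 1" for k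
  proof -
    let ?P = "Gi ** B ** G"
    have "det ?P = det B * det (Gi ** G)"
      by (simp add: det_mul mult_ac)
    then have "det ?P = det B"
      by (simp add: Gi)
    moreover have "det B' = det ?P + fps_X\<^sup>2 * (?P $ 1 $ 1 * R $ 2 $ 2 + R $ 1 $ 1 * ?P $ 2 $ 2
        - ?P $ 1 $ 2 * R $ 2 $ 1 - R $ 1 $ 2 * ?P $ 2 $ 1 + fps_X\<^sup>2 * det R)"
      unfolding eqB' by (simp add: det_2 algebra_simps)
    ultimately show ?thesis
      by (simp add: X2[OF k])
  qed
  have "fps_nth (B' $ i $ j) 0 = 0" if "\<forall>i j. fps_nth (B $ i $ j) 0 = 0" for i j
    using that X2[of 0] by (subst eqB') (simp add: matrix_mult_2)
  moreover have "fps_nth (B $ i $ j) 0 = 0" if "\<forall>i j. fps_nth (B' $ i $ j) 0 = 0" for i j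
    using that X2[of 0] by (subst eqB) (simp add: matrix_mult_2)
  ultimately show "(\<forall>i j. fps_nth (B' $ i $ j) 0 = 0) \<longleftrightarrow> (\<forall>i j. fps_nth (B $ i $ j) 0 = 0)"
    by blast
qed

definition mat_deriv :: "(complex \<Rightarrow> complex^2^2) \<Rightarrow> complex \<Rightarrow> complex^2^2" where
  "mat_deriv W z = (\<chi> i j. deriv (\<lambda>w. W w $ i $ j) z)"

lemma analytic_eventually_eq:
  fixes f g :: "complex \<Rightarrow> complex"
  assumes "f analytic_on {0}" "g analytic_on {0}" "\<forall>\<^sub>F z in at 0. f z = g z"
  shows "\<forall>\<^sub>F z in nhds 0. f z = g z"
proof -
  have "f \<midarrow>0\<rightarrow> f 0" "g \<midarrow>0\<rightarrow> g 0"
    using assms(1,2) by (auto dest!: analytic_at_imp_isCont simp: isCont_def)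
  then have "f 0 = g 0"
    using tendsto_cong[OF assms(3)] tendsto_unique[of "at (0::complex)"] by (metis trivial_limit_at)
  then show ?thesis
    using assms(3) by (auto simp: eventually_nhds_conv_at)
qed

lemma has_fps_expansion_fps_matrix:
  assumes "\<And>i j. (\<lambda>z. B z $ i $ j) analytic_on {0}"
  shows "(\<lambda>z. B z $ i $ j) has_fps_expansion (fps_matrix B $ i $ j)"
  unfolding fps_matrix_def using assms by (simp add: analytic_at_imp_has_fps_expansion_0)

lemma fps_nth_fps_matrix_0:
  assumes "\<And>i j. (\<lambda>z. B z $ i $ j) analytic_on {0}"
  shows "fps_nth (fps_matrix B $ i $ j) 0 = B 0 $ i $ j"
  by (simp add: fps_matrix_def fps_expansion_def)

lemma fps_matrix_eqI:
  assumes "\<And>i j. (\<lambda>z. B z $ i $ j) has_fps_expansion F $ i $ j"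
  shows "fps_matrix B = F"
  using fps_expansion_eqI[OF assms] by (simp add: fps_matrix_def vec_eq_iff)

lemma fps_matrix_mult:
  assumes "\<And>i j. (\<lambda>z. A z $ i $ j) analytic_on {0}" "\<And>i j. (\<lambda>z. B z $ i $ j) analytic_on {0}"
  shows "fps_matrix (\<lambda>z. A z ** B z) = fps_matrix A ** fps_matrix B"
  by (rule fps_matrix_eqI) (unfold matrix_mult_2,
      intro has_fps_expansion_add has_fps_expansion_mult has_fps_expansion_fps_matrix assms)

lemma fps_matrix_add:
  assumes "\<And>i j. (\<lambda>z. A z $ i $ j) analytic_on {0}" "\<And>i j. (\<lambda>z. B z $ i $ j) analytic_on {0}"
  shows "fps_matrix (\<lambda>z. A z + B z) = fps_matrix A + fps_matrix B"
  by (rule fps_matrix_eqI) (unfold vector_add_component,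
      intro has_fps_expansion_add has_fps_expansion_fps_matrix assms)

lemma fps_matrix_cong:
  assumes "\<forall>\<^sub>F z in nhds 0. A z = B z"
  shows "fps_matrix A = fps_matrix B"
proof -
  have "fps_expansion (\<lambda>z. A z $ i $ j) 0 = fps_expansion (\<lambda>z. B z $ i $ j) 0" for i j
    unfolding fps_expansion_def
    by (intro arg_cong[where f = Abs_fps] ext arg_cong2[where f = "(/)"] higher_deriv_cong_ev refl
        eventually_mono[OF assms]) auto
  then show ?thesis
    by (simp add: fps_matrix_def)
qed

lemma fps_matrix_deriv:
  assumes "\<And>i j. (\<lambda>z. A z $ i $ j) analytic_on {0}"
  shows "fps_matrix (\<lambda>z. \<chi> i j. z\<^sup>2 * mat_deriv A z $ i $ j) = (\<chi> i j. fps_X\<^sup>2 * fps_deriv (fps_matrix A $ i $ j))"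
proof (rule fps_matrix_eqI)
  fix i j
  show "(\<lambda>z. (\<chi> i j. z\<^sup>2 * mat_deriv A z $ i $ j) $ i $ j) has_fps_expansion
      (\<chi> i j. fps_X\<^sup>2 * fps_deriv (fps_matrix A $ i $ j)) $ i $ j"
    unfolding mat_deriv_def vec_lambda_beta
    by (intro has_fps_expansion_mult has_fps_expansion_power has_fps_expansion_fps_X
        has_fps_expansion_deriv has_fps_expansion_fps_matrix assms)
qed

lemma fps_matrix_mat_1: "fps_matrix (\<lambda>_. mat 1) = mat 1"
  by (rule fps_matrix_eqI) (auto simp: mat_def intro: has_fps_expansion_const)

lemma similar_matrix_invariants:
  fixes P E N :: "complex^2^2"
  assumes "invertible E" "P ** E = E ** N"
  shows "trace P = trace N" "det P = det N" "P = 0 \<longleftrightarrow> N = 0"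
proof -
  have P: "P = E ** N ** matrix_inv E"
    by (metis assms invertible_matrix_inv(1) matrix_mul_assoc matrix_mul_rid)
  have N: "N = matrix_inv E ** (P ** E)"
    by (metis assms invertible_matrix_inv(2) matrix_mul_assoc matrix_mul_lid)
  show "trace P = trace N"
    by (metis P assms(1) invertible_matrix_inv(2) matrix_mul_assoc matrix_mul_lid trace_mul_sym)
  have "det P * det E = det N * det E"
    using arg_cong[OF assms(2), of det] by (simp add: det_mul mult.commute)
  then show "det P = det N"
    using assms(1) by (simp add: invertible_det_nz)
  show "P = 0 \<longleftrightarrow> N = 0"
    using P N by auto
qed

lemma matrix_vec_mult_eq_0:
  fixes A :: "complex^2^2"
  assumes "A \<noteq> 0"
  obtains u where "A *v u \<noteq> 0"
  using assms matrix_eq[of A 0] by auto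

text \<open>
  As \<open>M\<^sup>2 = 0\<close>, the columns \<open>(M u, u)\<close> form the required basis for every \<open>u\<close> with \<open>M u \<noteq> 0\<close>.
\<close>

lemma nilpotent_normal_form:
  fixes M :: "complex^2^2"
  assumes "M \<noteq> 0" "trace M = 0" "det M = 0"
  obtains E :: "complex^2^2" where "invertible E" "M ** E = E ** vector [vector [0, 1], vector [0, 0]]"
proof -
  obtain u where u: "M *v u \<noteq> 0"
    using matrix_vec_mult_eq_0[OF assms(1)] .
  define v where "v = M *v u"
  define E :: "complex^2^2" where "E = (\<chi> i j. if j = 1 then v $ i else u $ i)"
  have M22: "M $ 2 $ 2 = - M $ 1 $ 1" and M12: "M $ 1 $ 2 * M $ 2 $ 1 = - (M $ 1 $ 1 * M $ 1 $ 1)"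
    using assms by (simp_all add: trace_2 det_2 add_eq_0_iff)
  have "M *v v = 0"
  proof -
    have "M ** M = 0"
      using M12 by (simp add: vec_eq_iff forall_2 matrix_mult_2 M22 mult_ac)
    then show ?thesis
      by (simp add: v_def matrix_vector_mul_assoc)
  qed
  have "M ** E = E ** vector [vector [0, 1], vector [0, 0]]"
    using \<open>M *v v = 0\<close>
    by (simp add: vec_eq_iff forall_2 matrix_mult_2 E_def vector_2 matrix_vector_mult_2)
      (simp add: v_def matrix_vector_mult_2)
  moreover have "det E \<noteq> 0"
  proof
    assume d: "det E = 0"
    then have d': "v $ 1 * u $ 2 = u $ 1 * v $ 2"
      by (simp add: det_2 E_def)
    have "v \<noteq> 0" using u by (simp add: v_def)
    have u0: "u \<noteq> 0" using u by auto
    obtain c where c: "u = c *s v"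
    proof (cases "v $ 1 = 0")
      case True
      then have v2: "v $ 2 \<noteq> 0" using \<open>v \<noteq> 0\<close> by (simp add: vec2_eq_iff)
      then have "u $ 1 = 0" using d' True by simp
      then have "u = (u $ 2 / v $ 2) *s v"
        using True v2 by (simp add: vec2_eq_iff)
      then show ?thesis using that by blast
    next
      case False
      then have "u = (u $ 1 / v $ 1) *s v"
        using d' by (simp add: vec2_eq_iff field_simps)
      then show ?thesis using that by blast
    qed
    have "v = M *v (c *s v)"
      unfolding c[symmetric] by (rule v_def)
    then have "v = c *s (M *v v)"
      by (simp add: vector_scalar_commute)
    then show False
      using \<open>M *v v = 0\<close> \<open>v \<noteq> 0\<close> by simp
  qed
  then have "invertible E"
    by (simp add: invertible_det_nz)
  ultimately show ?thesis using that by blast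
qed



section \<open>Charts\<close>

definition vec_deriv :: "(complex \<Rightarrow> complex^2) \<Rightarrow> complex \<Rightarrow> complex^2" where
  "vec_deriv f z = (\<chi> i. deriv (\<lambda>w. f w $ i) z)"

definition frame_matrix :: "('e \<Rightarrow> complex^2) \<Rightarrow> (2 \<Rightarrow> 'e) \<Rightarrow> complex^2^2" where
  "frame_matrix \<phi> e = (\<chi> i j. \<phi> (e j) $ i)"

text \<open>
  A trivialisation compatible with the atlas but not necessarily a member of it, so that constant
  linear changes are possible.
\<close>

locale bundle_chart =
  fixes H :: "'e conn_bundle" and U :: "complex set" and \<phi> :: "'e \<Rightarrow> complex^2"
  assumes hol_bundle: "holomorphic_bundle H"
    and open_U: "open U"
    and bij: "bij_betw (\<lambda>e. (pr H e, \<phi> e)) {e\<in>Tot H. pr H e \<in> U} (U \<times> UNIV)"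
    and chart_fadd: "\<And>e f. e \<in> Tot H \<Longrightarrow> f \<in> Tot H \<Longrightarrow> pr H e \<in> U \<Longrightarrow> pr H e = pr H f \<Longrightarrow>
      \<phi> (fadd H e f) = \<phi> e + \<phi> f"
    and chart_fscale: "\<And>c e. e \<in> Tot H \<Longrightarrow> pr H e \<in> U \<Longrightarrow> \<phi> (fscale H c e) = c *s \<phi> e"
    and hol_section_iff: "\<And>W s. W \<subseteq> U \<Longrightarrow> hol_section H W s \<longleftrightarrow>
      open W \<and> (\<forall>z\<in>W. s z \<in> Tot H \<and> pr H (s z) = z) \<and> (\<forall>i. (\<lambda>z. \<phi> (s z) $ i) holomorphic_on W)"

lemma bundle_chart_of_charts:
  assumes H: "holomorphic_bundle H" and U: "(U, \<phi>) \<in> charts H"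
  shows "bundle_chart H U \<phi>"
proof
  have "\<forall>(U, \<phi>)\<in>charts H. open U \<and>
        bij_betw (\<lambda>e. (pr H e, \<phi> e)) {e\<in>Tot H. pr H e \<in> U} (U \<times> UNIV) \<and>
        (\<forall>e\<in>Tot H. \<forall>f\<in>Tot H. pr H e \<in> U \<and> pr H e = pr H f \<longrightarrow> \<phi> (fadd H e f) = \<phi> e + \<phi> f) \<and>
        (\<forall>c. \<forall>e\<in>Tot H. pr H e \<in> U \<longrightarrow> \<phi> (fscale H c e) = c *s \<phi> e)"
    using H unfolding holomorphic_bundle_def by (elim conjE)
  note * = bspec[OF this U, unfolded prod.case]
  show "holomorphic_bundle H" by (rule H)
  show "open U" "bij_betw (\<lambda>e. (pr H e, \<phi> e)) {e\<in>Tot H. pr H e \<in> U} (U \<times> UNIV)"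
    using * by blast+
  show "\<phi> (fadd H e f) = \<phi> e + \<phi> f"
    if "e \<in> Tot H" "f \<in> Tot H" "pr H e \<in> U" "pr H e = pr H f" for e f
    using * that by blast
  show "\<phi> (fscale H c e) = c *s \<phi> e" if "e \<in> Tot H" "pr H e \<in> U" for c e
    using * that by blast
  \<comment> \<open>holomorphy in the one chart gives holomorphy in the others through the transition functions\<close>
  fix W :: "complex set" and s assume W: "W \<subseteq> U"
  show "hol_section H W s \<longleftrightarrow>
      open W \<and> (\<forall>z\<in>W. s z \<in> Tot H \<and> pr H (s z) = z) \<and> (\<forall>i. (\<lambda>z. \<phi> (s z) $ i) holomorphic_on W)"
    (is "?l \<longleftrightarrow> ?r")
  proof
    assume ?l
    then have "(\<lambda>z. \<phi> (s z) $ i) holomorphic_on W \<inter> U" for i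
      using U unfolding hol_section_def by auto
    then show ?r
      using \<open>?l\<close> W by (auto simp: hol_section_def Int_absorb2)
  next
    assume r: ?r
    have "(\<lambda>z. \<psi> (s z) $ i) holomorphic_on W \<inter> V" if V: "(V, \<psi>) \<in> charts H" for V \<psi> i
    proof -
      have "\<forall>(U, \<phi>)\<in>charts H. \<forall>(V, \<psi>)\<in>charts H. \<exists>g :: complex \<Rightarrow> complex^2^2.
          (\<forall>i j. (\<lambda>z. g z $ i $ j) holomorphic_on U \<inter> V) \<and>
          (\<forall>e\<in>Tot H. pr H e \<in> U \<inter> V \<longrightarrow> \<psi> e = g (pr H e) *v \<phi> e)"
        using H unfolding holomorphic_bundle_def by (elim conjE)
      from bspec[OF bspec[OF this U, unfolded prod.case] V, unfolded prod.case]
      obtain g :: "complex \<Rightarrow> complex^2^2" where g: "\<And>i j. (\<lambda>z. g z $ i $ j) holomorphic_on U \<inter> V"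
        "\<And>e. e \<in> Tot H \<Longrightarrow> pr H e \<in> U \<inter> V \<Longrightarrow> \<psi> e = g (pr H e) *v \<phi> e"
        by blast
      have "(\<lambda>z. (g z *v \<phi> (s z)) $ i) holomorphic_on W \<inter> V"
        unfolding matrix_vector_mult_2 using r W
        by (intro holomorphic_intros holomorphic_on_subset[OF g(1)])
          (auto intro: holomorphic_on_subset)
      then show ?thesis
        by (rule holomorphic_transform) (use r W g(2) in auto)
    qed
    then show ?l
      using r by (auto simp: hol_section_def)
  qed
qed

context bundle_chart
begin

lemma Tot_fadd: "e \<in> Tot H \<Longrightarrow> f \<in> Tot H \<Longrightarrow> pr H e = pr H f \<Longrightarrow> fadd H e f \<in> Tot H"
  and pr_fadd: "e \<in> Tot H \<Longrightarrow> f \<in> Tot H \<Longrightarrow> pr H e = pr H f \<Longrightarrow> pr H (fadd H e f) = pr H e"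
  and Tot_fscale: "e \<in> Tot H \<Longrightarrow> fscale H c e \<in> Tot H"
  and pr_fscale: "e \<in> Tot H \<Longrightarrow> pr H (fscale H c e) = pr H e"
  using hol_bundle unfolding holomorphic_bundle_def by metis+

lemma chart_inj: "e \<in> Tot H \<Longrightarrow> f \<in> Tot H \<Longrightarrow> pr H e = z \<Longrightarrow> pr H f = z \<Longrightarrow> z \<in> U \<Longrightarrow> \<phi> e = \<phi> f \<Longrightarrow> e = f"
  by (rule inj_onD[OF bij_betw_imp_inj_on[OF bij]]) auto

definition pt :: "complex \<Rightarrow> complex^2 \<Rightarrow> 'e" where
  "pt z c = inv_into {e\<in>Tot H. pr H e \<in> U} (\<lambda>e. (pr H e, \<phi> e)) (z, c)"

lemma
  assumes "z \<in> U"
  shows Tot_pt: "pt z c \<in> Tot H" and pr_pt: "pr H (pt z c) = z" and chart_pt: "\<phi> (pt z c) = c"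
proof -
  have "(z, c) \<in> (\<lambda>e. (pr H e, \<phi> e)) ` {e\<in>Tot H. pr H e \<in> U}"
    using bij assms unfolding bij_betw_def by auto
  from inv_into_into[OF this] f_inv_into_f[OF this]
  show "pt z c \<in> Tot H" "pr H (pt z c) = z" "\<phi> (pt z c) = c"
    unfolding pt_def by auto
qed

lemma
  assumes "z \<in> U" "\<And>i. e i \<in> Tot H" "\<And>i. pr H (e i) = z"
  shows Tot_lincomb: "lincomb H c e \<in> Tot H" and pr_lincomb: "pr H (lincomb H c e) = z"
    and chart_lincomb: "\<phi> (lincomb H c e) = frame_matrix \<phi> e *v c"
proof -
  show "lincomb H c e \<in> Tot H" "pr H (lincomb H c e) = z"
    using assms by (auto simp: lincomb_def intro!: Tot_fadd Tot_fscale simp: pr_fadd pr_fscale Tot_fscale)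
  show "\<phi> (lincomb H c e) = frame_matrix \<phi> e *v c"
    using assms by (simp add: lincomb_def chart_fadd chart_fscale Tot_fscale pr_fscale vec2_eq_iff
        matrix_vector_mult_2 frame_matrix_def mult.commute)
qed

lemma fibre_basis_iff:
  assumes z: "z \<in> U"
  shows "fibre_basis H z e \<longleftrightarrow> (\<forall>i. e i \<in> Tot H \<and> pr H (e i) = z) \<and> invertible (frame_matrix \<phi> e)"
proof (cases "\<forall>i. e i \<in> Tot H \<and> pr H (e i) = z")
  case True
  then have e: "e i \<in> Tot H" "pr H (e i) = z" for i by auto
  note lc = Tot_lincomb[OF z e] pr_lincomb[OF z e] chart_lincomb[OF z e]
  have *: "h = lincomb H c e \<longleftrightarrow> \<phi> h = frame_matrix \<phi> e *v c" if "h \<in> Tot H" "pr H h = z" for h c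
  proof
    assume "\<phi> h = frame_matrix \<phi> e *v c"
    then show "h = lincomb H c e"
      by (intro chart_inj[OF that(1) lc(1) that(2) lc(2) z]) (simp add: lc(3))
  qed (simp add: lc(3))
  then have "fibre_basis H z e \<longleftrightarrow> (\<forall>h\<in>Tot H. pr H h = z \<longrightarrow> (\<exists>!c. \<phi> h = frame_matrix \<phi> e *v c))"
    using True unfolding fibre_basis_def by (simp cong: ball_cong)
  also have "\<dots> \<longleftrightarrow> (\<forall>y. \<exists>!c. y = frame_matrix \<phi> e *v c)"
  proof (intro iffI allI ballI impI)
    fix y assume "\<forall>h\<in>Tot H. pr H h = z \<longrightarrow> (\<exists>!c. \<phi> h = frame_matrix \<phi> e *v c)"
    from bspec[OF this Tot_pt[OF z]] show "\<exists>!c. y = frame_matrix \<phi> e *v c"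
      using pr_pt[OF z] chart_pt[OF z] by simp
  qed blast
  also have "\<dots> \<longleftrightarrow> invertible (frame_matrix \<phi> e)"
  proof
    assume "\<forall>y. \<exists>!c. y = frame_matrix \<phi> e *v c"
    then have "surj ((*v) (frame_matrix \<phi> e))"
      by (metis surjI)
    then show "invertible (frame_matrix \<phi> e)"
      by (simp add: matrix_right_invertible_surjective invertible_right_inverse)
  next
    assume inv: "invertible (frame_matrix \<phi> e)"
    show "\<forall>y. \<exists>!c. y = frame_matrix \<phi> e *v c"
    proof
      fix y show "\<exists>!c. y = frame_matrix \<phi> e *v c"
      proof (rule ex1I[of _ "matrix_inv (frame_matrix \<phi> e) *v y"])
        show "y = frame_matrix \<phi> e *v (matrix_inv (frame_matrix \<phi> e) *v y)"
          by (simp add: matrix_vector_mul_assoc invertible_matrix_inv[OF inv])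
        fix c assume "y = frame_matrix \<phi> e *v c"
        then show "c = matrix_inv (frame_matrix \<phi> e) *v y"
          by (simp add: matrix_vector_mul_assoc invertible_matrix_inv[OF inv])
      qed
    qed
  qed
  finally show ?thesis using True by simp
qed (auto simp: fibre_basis_def)

lemma hol_section_pt:
  assumes "open W" "W \<subseteq> U" "\<And>i. (\<lambda>z. f z $ i) holomorphic_on W"
  shows "hol_section H W (\<lambda>z. pt z (f z))"
  unfolding hol_section_iff[OF assms(2)]
proof (intro conjI ballI allI assms(1))
  show "pt z (f z) \<in> Tot H" "pr H (pt z (f z)) = z" if "z \<in> W" for z
    using that assms(2) Tot_pt pr_pt by auto
  show "(\<lambda>z. \<phi> (pt z (f z)) $ i) holomorphic_on W" for i
    by (rule holomorphic_transform[OF assms(3)[of i]]) (use assms(2) chart_pt in auto)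
qed

lemma bundle_chart_linear_change:
  assumes Q: "invertible Q"
  shows "bundle_chart H U (\<lambda>e. Q *v \<phi> e)"
proof
  have Qinj: "Q *v x = Q *v y \<longleftrightarrow> x = y" for x y
    by (metis invertible_matrix_inv(2)[OF Q] matrix_vector_mul_assoc matrix_vector_mul_lid)
  show "bij_betw (\<lambda>e. (pr H e, Q *v \<phi> e)) {e\<in>Tot H. pr H e \<in> U} (U \<times> UNIV)"
  proof (rule bij_betw_imageI)
    show "inj_on (\<lambda>e. (pr H e, Q *v \<phi> e)) {e\<in>Tot H. pr H e \<in> U}"
      using bij Qinj unfolding bij_betw_def inj_on_def by simp
    show "(\<lambda>e. (pr H e, Q *v \<phi> e)) ` {e\<in>Tot H. pr H e \<in> U} = U \<times> UNIV"
    proof (intro equalityI subsetI)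
      fix p :: "complex \<times> (complex^2)" assume "p \<in> U \<times> UNIV"
      then have "fst p \<in> U" by auto
      then have "p = (\<lambda>e. (pr H e, Q *v \<phi> e)) (pt (fst p) (matrix_inv Q *v snd p))"
        by (simp add: pr_pt chart_pt matrix_vector_mul_assoc invertible_matrix_inv[OF Q])
      then show "p \<in> (\<lambda>e. (pr H e, Q *v \<phi> e)) ` {e\<in>Tot H. pr H e \<in> U}"
        by (rule image_eqI) (use \<open>fst p \<in> U\<close> in \<open>simp add: pr_pt Tot_pt\<close>)
    qed auto
  qed
  show "Q *v \<phi> (fadd H e f) = Q *v \<phi> e + Q *v \<phi> f"
    if "e \<in> Tot H" "f \<in> Tot H" "pr H e \<in> U" "pr H e = pr H f" for e f
    using that by (simp add: chart_fadd matrix_vector_right_distrib)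
  show "Q *v \<phi> (fscale H c e) = c *s (Q *v \<phi> e)" if "e \<in> Tot H" "pr H e \<in> U" for c e
    using that by (simp add: chart_fscale vector_scalar_commute)
  fix W s assume W: "W \<subseteq> U"
  have "(\<forall>i. (\<lambda>z. (Q *v \<phi> (s z)) $ i) holomorphic_on W) \<longleftrightarrow> (\<forall>i. (\<lambda>z. \<phi> (s z) $ i) holomorphic_on W)"
  proof
    assume "\<forall>i. (\<lambda>z. \<phi> (s z) $ i) holomorphic_on W"
    then show "\<forall>i. (\<lambda>z. (Q *v \<phi> (s z)) $ i) holomorphic_on W"
      unfolding matrix_vector_mult_2 by (intro allI holomorphic_intros) auto
  next
    assume *: "\<forall>i. (\<lambda>z. (Q *v \<phi> (s z)) $ i) holomorphic_on W"
    have "(\<lambda>z. (matrix_inv Q *v (Q *v \<phi> (s z))) $ i) holomorphic_on W" for i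
      using * unfolding matrix_vector_mult_2[of "matrix_inv Q"] by (intro holomorphic_intros) auto
    then show "\<forall>i. (\<lambda>z. \<phi> (s z) $ i) holomorphic_on W"
      by (simp add: matrix_vector_mul_assoc invertible_matrix_inv[OF Q])
  qed
  then show "hol_section H W s \<longleftrightarrow> open W \<and> (\<forall>z\<in>W. s z \<in> Tot H \<and> pr H (s z) = z) \<and>
      (\<forall>i. (\<lambda>z. (Q *v \<phi> (s z)) $ i) holomorphic_on W)"
    unfolding hol_section_iff[OF W] by simp
qed (use hol_bundle open_U in auto)

end

lemma hol_section_props:
  assumes "hol_section H W s"
  shows hol_section_open: "open W"
    and hol_section_Tot: "z \<in> W \<Longrightarrow> s z \<in> Tot H"
    and hol_section_pr: "z \<in> W \<Longrightarrow> pr H (s z) = z"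
    and hol_section_hol: "(V, \<phi>) \<in> charts H \<Longrightarrow> (\<lambda>z. \<phi> (s z) $ i) holomorphic_on W \<inter> V"
  using assms unfolding hol_section_def by blast+

lemma hol_section_subset:
  assumes "hol_section H W s" "open V" "V \<subseteq> W"
  shows "hol_section H V s"
  unfolding hol_section_def
proof safe
  fix X \<psi> i assume "(X, \<psi>) \<in> charts H"
  from hol_section_hol[OF assms(1) this] show "(\<lambda>z. \<psi> (s z) $ i) holomorphic_on V \<inter> X"
    by (rule holomorphic_on_subset) (use assms(3) in blast)
qed (use assms hol_section_Tot[OF assms(1)] hol_section_pr[OF assms(1)] in blast)+

lemma
  assumes C: "connection_off_0 H" and s: "hol_section H W s" and W: "0 \<notin> W"
  shows hol_section_conn: "hol_section H W (conn H s)"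
    and conn_cong: "hol_section H W t \<Longrightarrow> (\<And>z. z \<in> W \<Longrightarrow> s z = t z) \<Longrightarrow> z \<in> W \<Longrightarrow> conn H s z = conn H t z"
    and conn_fadd: "hol_section H W t \<Longrightarrow> z \<in> W \<Longrightarrow>
      conn H (\<lambda>w. fadd H (s w) (t w)) z = fadd H (conn H s z) (conn H t z)"
    and conn_fscale: "f holomorphic_on W \<Longrightarrow> z \<in> W \<Longrightarrow> conn H (\<lambda>w. fscale H (f w) (s w)) z =
      fadd H (fscale H (deriv f z) (s z)) (fscale H (f z) (conn H s z))"
proof -
  note D = C[unfolded connection_off_0_def]
  show "hol_section H W (conn H s)"
    using D[THEN conjunct1, rule_format, of W s] s W by simp
  show "conn H s z = conn H t z" if "hol_section H W t" "\<And>z. z \<in> W \<Longrightarrow> s z = t z" "z \<in> W"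
    using D[THEN conjunct2, THEN conjunct1, rule_format, of W s t z] s W that by simp
  show "conn H (\<lambda>w. fadd H (s w) (t w)) z = fadd H (conn H s z) (conn H t z)"
    if "hol_section H W t" "z \<in> W"
    using D[THEN conjunct2, THEN conjunct2, THEN conjunct1, rule_format, of W s t z] s W that by simp
  show "conn H (\<lambda>w. fscale H (f w) (s w)) z =
      fadd H (fscale H (deriv f z) (s z)) (fscale H (f z) (conn H s z))"
    if "f holomorphic_on W" "z \<in> W"
    using D[THEN conjunct2, THEN conjunct2, THEN conjunct2, rule_format, of W s f z] s W that by simp
qed

text \<open>
  In a chart the connection is \<open>d/dz + A(z)\<close> away from 0. The connection acts on germs, so a section
  may be defined on a set \<open>W\<close> that leaves the chart.
\<close>

locale conn_chart = bundle_chart +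
  fixes A :: "complex \<Rightarrow> complex^2^2"
  assumes A_hol: "\<And>i j. (\<lambda>z. A z $ i $ j) holomorphic_on U - {0}"
    and conn_section: "\<And>W s z. hol_section H W s \<Longrightarrow> z \<in> W \<Longrightarrow> z \<in> U \<Longrightarrow> z \<noteq> 0 \<Longrightarrow>
      conn H s z \<in> Tot H \<and> pr H (conn H s z) = z \<and>
      \<phi> (conn H s z) = vec_deriv (\<lambda>w. \<phi> (s w)) z + A z *v \<phi> (s z)"

lemma vec_deriv_cong: "\<forall>\<^sub>F w in nhds z. f w = g w \<Longrightarrow> vec_deriv f z = vec_deriv g z"
  unfolding vec_deriv_def by (intro vec_eq_iff[THEN iffD2] allI)
    (auto intro!: deriv_cong_ev elim: eventually_mono)

text \<open>
  The columns of \<open>A\<close> are the coordinates of the derivatives of the two coordinate sections of the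
  chart; by locality, additivity and the Leibniz rule they determine the connection.
\<close>

lemma (in bundle_chart) conn_chart_exists:
  assumes C: "connection_off_0 H"
  shows "\<exists>A. conn_chart H U \<phi> A"
proof -
  define e where "e j z = pt z (axis j 1)" for j :: 2 and z
  let ?U = "U - {0}"
  have oU: "open ?U" using open_U by auto
  have e_sec: "hol_section H ?U (e j)" for j
    unfolding e_def by (rule hol_section_pt[OF oU]) auto
  have c_sec: "hol_section H ?U (conn H (e j))" for j
    by (rule hol_section_conn[OF C e_sec]) simp
  define A where "A z = frame_matrix \<phi> (\<lambda>j. conn H (e j) z)" for z
  have "conn_chart H U \<phi> A"
  proof
    show "(\<lambda>z. A z $ i $ j) holomorphic_on U - {0}" for i j
      using c_sec[of j] unfolding hol_section_iff[OF Diff_subset] by (simp add: A_def frame_matrix_def)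
    fix W s z assume s: "hol_section H W s" and z: "z \<in> W" "z \<in> U" "z \<noteq> 0"
    define V where "V = W \<inter> ?U"
    have V: "open V" "V \<subseteq> U" "V \<subseteq> ?U" "z \<in> V" "0 \<notin> V"
      using hol_section_open[OF s] oU z by (auto simp: V_def)
    have sV: "hol_section H V s"
      using s V(1) by (rule hol_section_subset) (auto simp: V_def)
    have eV: "hol_section H V (e j)" and cV: "hol_section H V (conn H (e j))" for j
      using e_sec c_sec V by (auto intro: hol_section_subset)
    let ?f = "\<lambda>i z. \<phi> (s z) $ i"
    have f: "?f i holomorphic_on V" for i
      using sV unfolding hol_section_iff[OF V(2)] by auto
    have eTot: "e j w \<in> Tot H" "pr H (e j w) = w" "\<phi> (e j w) = axis j 1" if "w \<in> V" for j w
      using that V(2) Tot_pt pr_pt chart_pt by (auto simp: e_def)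
    have scV: "hol_section H V (\<lambda>z. fscale H (?f i z) (e i z))" for i
      unfolding hol_section_iff[OF V(2)]
    proof (intro conjI ballI allI V(1))
      fix j
      have "(\<lambda>z. ?f i z * \<phi> (e i z) $ j) holomorphic_on V"
        using eV[of i] f unfolding hol_section_iff[OF V(2)] by (auto intro!: holomorphic_intros)
      then show "(\<lambda>z. \<phi> (fscale H (?f i z) (e i z)) $ j) holomorphic_on V"
        by (rule holomorphic_transform) (use eTot V(2) in \<open>auto simp: chart_fscale\<close>)
    qed (simp_all add: eTot Tot_fscale pr_fscale)
    let ?s = "\<lambda>z. fadd H (fscale H (?f 1 z) (e 1 z)) (fscale H (?f 2 z) (e 2 z))"
    have s_eq: "s w = ?s w" if "w \<in> V" for w
    proof (rule chart_inj)
      show "s w \<in> Tot H" "pr H (s w) = w"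
        using sV that unfolding hol_section_iff[OF V(2)] by auto
      show "w \<in> U" using that V by auto
      show "?s w \<in> Tot H" "pr H (?s w) = w"
        using eTot[OF that] by (simp_all add: Tot_fadd pr_fadd Tot_fscale pr_fscale)
      show "\<phi> (s w) = \<phi> (?s w)"
        using eTot[OF that] \<open>w \<in> U\<close>
        by (simp add: chart_fadd chart_fscale Tot_fscale pr_fscale vec2_eq_iff axis_def)
    qed
    have ssV: "hol_section H V ?s"
      unfolding hol_section_iff[OF V(2)]
    proof (intro conjI ballI allI V(1))
      show "?s w \<in> Tot H" "pr H (?s w) = w" if "w \<in> V" for w
        using sV that unfolding hol_section_iff[OF V(2)] by (simp_all only: s_eq[OF that, symmetric])
      show "(\<lambda>w. \<phi> (?s w) $ i) holomorphic_on V" for i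
        by (rule holomorphic_transform[OF f[of i]]) (simp only: s_eq[symmetric])
    qed
    have "conn H s z = conn H ?s z"
      by (rule conn_cong[OF C sV V(5) ssV s_eq V(4)])
    also have "\<dots> = fadd H (conn H (\<lambda>z. fscale H (?f 1 z) (e 1 z)) z) (conn H (\<lambda>z. fscale H (?f 2 z) (e 2 z)) z)"
      by (rule conn_fadd[OF C scV V(5) scV V(4)])
    finally have eq: "conn H s z = fadd H
        (fadd H (fscale H (deriv (?f 1) z) (e 1 z)) (fscale H (?f 1 z) (conn H (e 1) z)))
        (fadd H (fscale H (deriv (?f 2) z) (e 2 z)) (fscale H (?f 2 z) (conn H (e 2) z)))"
      by (simp only: conn_fscale[OF C eV V(5) f V(4)])
    have cT: "conn H (e j) z \<in> Tot H" "pr H (conn H (e j) z) = z" for j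
      using cV[of j] V(4) unfolding hol_section_iff[OF V(2)] by auto
    show "conn H s z \<in> Tot H \<and> pr H (conn H s z) = z \<and>
      \<phi> (conn H s z) = vec_deriv (\<lambda>w. \<phi> (s w)) z + A z *v \<phi> (s z)"
      unfolding eq using eTot[OF V(4)] cT z(2)
      by (simp add: Tot_fadd pr_fadd Tot_fscale pr_fscale chart_fadd chart_fscale vec2_eq_iff
          vec_deriv_def A_def frame_matrix_def matrix_vector_mult_2 axis_def algebra_simps)
  qed
  then show ?thesis by (intro exI[of _ A])
qed

text \<open>
  The four axioms of a connection are local, and in a chart they hold for \<open>d/dz + A(z)\<close>.
\<close>

lemma connection_off_0I:
  assumes H: "holomorphic_bundle H"
    and A: "\<And>U \<phi>. (U, \<phi>) \<in> charts H \<Longrightarrow> \<exists>A. conn_chart H U \<phi> A"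
  shows "connection_off_0 H"
proof -
  have chart: "\<exists>U \<phi> A. conn_chart H U \<phi> A \<and> z \<in> U" for z
  proof -
    have "(\<Union>(U, \<phi>)\<in>charts H. U) = UNIV"
      using H unfolding holomorphic_bundle_def by (elim conjE)
    then have "z \<in> (\<Union>(U, \<phi>)\<in>charts H. U)"
      by (simp only: UNIV_I)
    then obtain p where p: "p \<in> charts H" "z \<in> (case p of (U, \<phi>) \<Rightarrow> U)"
      by (rule UN_E) (rule that)
    obtain U \<phi> where "p = (U, \<phi>)" by (cases p)
    with p A[of U \<phi>] show ?thesis by auto
  qed
  have 1: "hol_section H W (conn H s)" if s: "hol_section H W s" "0 \<notin> W" for W s
    unfolding hol_section_def
  proof safe
    show "open W" by (rule hol_section_open[OF s(1)])
    fix z assume z: "z \<in> W"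
    obtain U \<phi> A where "conn_chart H U \<phi> A" "z \<in> U" using chart by blast
    then interpret conn_chart H U \<phi> A by simp
    show "conn H s z \<in> Tot H" "pr H (conn H s z) = z"
      using conn_section[OF s(1) z \<open>z \<in> U\<close>] z s(2) by auto
  next
    fix V \<psi> i assume V: "(V, \<psi>) \<in> charts H"
    then obtain A where "conn_chart H V \<psi> A" using A by blast
    then interpret conn_chart H V \<psi> A .
    have sub: "W \<inter> V \<subseteq> V" "W \<inter> V \<subseteq> V - {0}" using s by auto
    have "hol_section H (W \<inter> V) s"
      by (rule hol_section_subset[OF s(1)]) (use hol_section_open[OF s(1)] open_U in auto)
    then have h: "(\<lambda>z. \<psi> (s z) $ i) holomorphic_on W \<inter> V" "open (W \<inter> V)" for i
      unfolding hol_section_iff[OF sub(1)] by auto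
    have "(\<lambda>z. deriv (\<lambda>w. \<psi> (s w) $ i) z + (A z $ i $ 1 * \<psi> (s z) $ 1 + A z $ i $ 2 * \<psi> (s z) $ 2))
        holomorphic_on W \<inter> V"
      by (intro holomorphic_on_add holomorphic_on_mult holomorphic_deriv h
          holomorphic_on_subset[OF A_hol sub(2)])
    then show "(\<lambda>z. \<psi> (conn H s z) $ i) holomorphic_on W \<inter> V"
    proof (rule holomorphic_transform)
      fix z assume z: "z \<in> W \<inter> V"
      then have "z \<noteq> 0" using s(2) by auto
      then show "deriv (\<lambda>w. \<psi> (s w) $ i) z + (A z $ i $ 1 * \<psi> (s z) $ 1 + A z $ i $ 2 * \<psi> (s z) $ 2) =
          \<psi> (conn H s z) $ i"
        using conn_section[OF s(1), of z] z by (simp add: vec_deriv_def matrix_vector_mult_2)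
    qed
  qed
  have cong: "conn H s z = conn H t z"
    if s: "hol_section H W s" "hol_section H W t" "0 \<notin> W" "\<forall>z\<in>W. s z = t z" "z \<in> W" for W s t z
  proof -
    obtain U \<phi> A where "conn_chart H U \<phi> A" "z \<in> U" using chart by blast
    then interpret conn_chart H U \<phi> A by simp
    have z0: "z \<noteq> 0" using s by auto
    have "\<forall>\<^sub>F w in nhds z. w \<in> W"
      using s(5) hol_section_open[OF s(1)] by (intro eventually_nhds_in_open)
    then have "vec_deriv (\<lambda>w. \<phi> (s w)) z = vec_deriv (\<lambda>w. \<phi> (t w)) z"
      by (intro vec_deriv_cong) (auto elim!: eventually_mono simp: s(4))
    then show ?thesis
      using conn_section[OF s(1,5) \<open>z \<in> U\<close> z0] conn_section[OF s(2,5) \<open>z \<in> U\<close> z0] s(4,5)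
      by (intro chart_inj[of _ _ z]) (use \<open>z \<in> U\<close> in auto)
  qed
  have hol2: "hol_section H W (\<lambda>w. fadd H (s w) (t w))"
    if s: "hol_section H W s" "hol_section H W t" for W s t
    unfolding hol_section_def
  proof safe
    show "open W" by (rule hol_section_open[OF s(1)])
    fix z assume z: "z \<in> W"
    obtain U \<phi> A where "conn_chart H U \<phi> A" using chart[of z] by blast
    then interpret conn_chart H U \<phi> A by simp
    show "fadd H (s z) (t z) \<in> Tot H" "pr H (fadd H (s z) (t z)) = z"
      using hol_section_Tot[OF s(1) z] hol_section_Tot[OF s(2) z] hol_section_pr[OF s(1) z] hol_section_pr[OF s(2) z]
      by (simp_all add: Tot_fadd pr_fadd)
  next
    fix V \<psi> i assume V: "(V, \<psi>) \<in> charts H"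
    interpret bundle_chart H V \<psi> by (rule bundle_chart_of_charts[OF H V])
    have "(\<lambda>z. \<psi> (s z) $ i + \<psi> (t z) $ i) holomorphic_on W \<inter> V"
      by (intro holomorphic_intros hol_section_hol[OF s(1) V] hol_section_hol[OF s(2) V])
    then show "(\<lambda>z. \<psi> (fadd H (s z) (t z)) $ i) holomorphic_on W \<inter> V"
      by (rule holomorphic_transform) (use s(1,2)[THEN hol_section_Tot] s(1,2)[THEN hol_section_pr] in \<open>simp add: chart_fadd\<close>)
  qed
  have hol3: "hol_section H W (\<lambda>w. fscale H (f w) (s w))"
    if s: "hol_section H W s" "f holomorphic_on W" for W s f
    unfolding hol_section_def
  proof safe
    show "open W" by (rule hol_section_open[OF s(1)])
    fix z assume z: "z \<in> W"
    obtain U \<phi> A where "conn_chart H U \<phi> A" using chart[of z] by blast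
    then interpret conn_chart H U \<phi> A by simp
    show "fscale H (f z) (s z) \<in> Tot H" "pr H (fscale H (f z) (s z)) = z"
      using hol_section_Tot[OF s(1) z] hol_section_pr[OF s(1) z]
      by (simp_all add: Tot_fscale pr_fscale)
  next
    fix V \<psi> i assume V: "(V, \<psi>) \<in> charts H"
    interpret bundle_chart H V \<psi> by (rule bundle_chart_of_charts[OF H V])
    have "(\<lambda>z. f z * \<psi> (s z) $ i) holomorphic_on W \<inter> V"
      by (intro holomorphic_intros hol_section_hol[OF s(1) V] holomorphic_on_subset[OF s(2)]) auto
    then show "(\<lambda>z. \<psi> (fscale H (f z) (s z)) $ i) holomorphic_on W \<inter> V"
      by (rule holomorphic_transform) (use s(1)[THEN hol_section_Tot] s(1)[THEN hol_section_pr] in \<open>simp add: chart_fscale\<close>)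
  qed
  have add: "conn H (\<lambda>w. fadd H (s w) (t w)) z = fadd H (conn H s z) (conn H t z)"
    if s: "hol_section H W s" "hol_section H W t" "0 \<notin> W" "z \<in> W" for W s t z
  proof -
    obtain U \<phi> A where "conn_chart H U \<phi> A" "z \<in> U" using chart by blast
    then interpret conn_chart H U \<phi> A by simp
    have z0: "z \<noteq> 0" using s by auto
    let ?V = "W \<inter> U"
    have oW: "open W" by (rule hol_section_open[OF s(1)])
    have V: "\<forall>\<^sub>F w in nhds z. w \<in> ?V"
      using oW open_U s(4) \<open>z \<in> U\<close> by (intro eventually_nhds_in_open) auto
    have sW: "hol_section H ?V s" "hol_section H ?V t"
      by (auto intro!: hol_section_subset[OF s(1)] hol_section_subset[OF s(2)] simp: oW open_U)
    have d: "(\<lambda>w. \<phi> (s w) $ i) field_differentiable at z" "(\<lambda>w. \<phi> (t w) $ i) field_differentiable at z" for i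
      using sW s(4) \<open>z \<in> U\<close> unfolding hol_section_iff[OF Int_lower2]
      by (auto intro!: holomorphic_on_imp_differentiable_at)
    have "vec_deriv (\<lambda>w. \<phi> (fadd H (s w) (t w))) z = vec_deriv (\<lambda>w. \<phi> (s w) + \<phi> (t w)) z"
      by (rule vec_deriv_cong, rule eventually_mono[OF V])
        (use s(1,2)[THEN hol_section_Tot] s(1,2)[THEN hol_section_pr] in \<open>simp add: chart_fadd\<close>)
    also have "\<dots> = vec_deriv (\<lambda>w. \<phi> (s w)) z + vec_deriv (\<lambda>w. \<phi> (t w)) z"
      using d by (simp add: vec_deriv_def vec_eq_iff)
    finally have vd: "vec_deriv (\<lambda>w. \<phi> (fadd H (s w) (t w))) z =
        vec_deriv (\<lambda>w. \<phi> (s w)) z + vec_deriv (\<lambda>w. \<phi> (t w)) z" .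
    note c = conn_section[OF s(1,4) \<open>z \<in> U\<close> z0] conn_section[OF s(2,4) \<open>z \<in> U\<close> z0]
      conn_section[OF hol2[OF s(1,2)] s(4) \<open>z \<in> U\<close> z0]
    show ?thesis
      using c hol_section_Tot[OF s(1,4)] hol_section_Tot[OF s(2,4)] hol_section_pr[OF s(1,4)] hol_section_pr[OF s(2,4)] \<open>z \<in> U\<close>
      by (intro chart_inj[of _ _ z])
        (simp_all add: Tot_fadd pr_fadd chart_fadd vd matrix_vector_right_distrib)
  qed
  have leib: "conn H (\<lambda>w. fscale H (f w) (s w)) z =
      fadd H (fscale H (deriv f z) (s z)) (fscale H (f z) (conn H s z))"
    if s: "hol_section H W s" "f holomorphic_on W" "0 \<notin> W" "z \<in> W" for W s f z
  proof -
    obtain U \<phi> A where "conn_chart H U \<phi> A" "z \<in> U" using chart by blast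
    then interpret conn_chart H U \<phi> A by simp
    have z0: "z \<noteq> 0" using s by auto
    let ?V = "W \<inter> U"
    have oW: "open W" by (rule hol_section_open[OF s(1)])
    have V: "\<forall>\<^sub>F w in nhds z. w \<in> ?V"
      using oW open_U s(4) \<open>z \<in> U\<close> by (intro eventually_nhds_in_open) auto
    have sW: "hol_section H ?V s"
      by (auto intro!: hol_section_subset[OF s(1)] simp: oW open_U)
    have d: "(\<lambda>w. \<phi> (s w) $ i) field_differentiable at z" "f field_differentiable at z" for i
      using sW s(2,4) \<open>z \<in> U\<close> oW unfolding hol_section_iff[OF Int_lower2]
      by (auto intro!: holomorphic_on_imp_differentiable_at)
    have "vec_deriv (\<lambda>w. \<phi> (fscale H (f w) (s w))) z = vec_deriv (\<lambda>w. f w *s \<phi> (s w)) z"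
      by (rule vec_deriv_cong, rule eventually_mono[OF V])
        (use s(1)[THEN hol_section_Tot] s(1)[THEN hol_section_pr] in \<open>simp add: chart_fscale\<close>)
    also have "\<dots> = deriv f z *s \<phi> (s z) + f z *s vec_deriv (\<lambda>w. \<phi> (s w)) z"
      using d by (simp add: vec_deriv_def vec_eq_iff)
    finally have vd: "vec_deriv (\<lambda>w. \<phi> (fscale H (f w) (s w))) z =
        deriv f z *s \<phi> (s z) + f z *s vec_deriv (\<lambda>w. \<phi> (s w)) z" .
    note c = conn_section[OF s(1,4) \<open>z \<in> U\<close> z0]
      conn_section[OF hol3[OF s(1,2)] s(4) \<open>z \<in> U\<close> z0]
    have sz: "s z \<in> Tot H" "pr H (s z) = z"
      by (rule hol_section_Tot[OF s(1,4)], rule hol_section_pr[OF s(1,4)])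
    show ?thesis
    proof (rule chart_inj[of _ _ z])
      show "\<phi> (conn H (\<lambda>w. fscale H (f w) (s w)) z) =
          \<phi> (fadd H (fscale H (deriv f z) (s z)) (fscale H (f z) (conn H s z)))"
        using c sz \<open>z \<in> U\<close>
        by (simp add: Tot_fscale pr_fscale chart_fadd chart_fscale vd vec2_eq_iff matrix_vector_mult_2
            algebra_simps)
    qed (use c sz \<open>z \<in> U\<close> in \<open>auto simp: Tot_fadd pr_fadd Tot_fscale pr_fscale\<close>)
  qed
  show ?thesis
    unfolding connection_off_0_def by (intro conjI allI impI ballI; elim conjE) (rule 1 cong add leib; assumption)+
qed



section \<open>The pullback of a bundle with connection\<close>

lemma pullback4_simps [simp]:
  "p \<in> Tot (pullback4 H) \<longleftrightarrow> snd p \<in> Tot H \<and> pr H (snd p) = fst p ^ 4"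
  "pr (pullback4 H) p = fst p"
  "fadd (pullback4 H) p q = (fst p, fadd H (snd p) (snd q))"
  "fscale (pullback4 H) c p = (fst p, fscale H c (snd p))"
  by (auto simp: pullback4_def case_prod_beta)

lemma charts_pullback4:
  "(V, \<psi>) \<in> charts (pullback4 H) \<longleftrightarrow>
    (\<exists>U \<phi>. (U, \<phi>) \<in> charts H \<and> V = (\<lambda>x. x ^ 4) -` U \<and> \<psi> = (\<lambda>p. \<phi> (snd p)))"
  by (force simp: pullback4_def case_prod_beta')

lemma open_vimage_power: "open U \<Longrightarrow> open ((\<lambda>x::complex. x ^ n) -` U)"
  by (intro open_vimage continuous_intros)

lemma holomorphic_on_power_arg:
  assumes "f holomorphic_on U" "\<And>x. x \<in> W \<Longrightarrow> x ^ n \<in> U"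
  shows "(\<lambda>x. f (x ^ n)) holomorphic_on W"
proof -
  have "f \<circ> (\<lambda>x. x ^ n) holomorphic_on W"
    by (rule holomorphic_on_compose_gen[OF _ assms(1)]) (use assms(2) in \<open>auto intro!: holomorphic_intros\<close>)
  then show ?thesis by (simp add: o_def)
qed

lemma holomorphic_bundle_pullback4:
  assumes H: "holomorphic_bundle H"
  shows "holomorphic_bundle (pullback4 H)"
  unfolding holomorphic_bundle_def
proof (intro conjI)
  let ?K = "pullback4 H"
  have cover: "(\<Union>(U, \<phi>)\<in>charts H. U) = UNIV"
    using H unfolding holomorphic_bundle_def by (elim conjE)
  have ex: "\<exists>U \<phi>. (U, \<phi>) \<in> charts H \<and> z \<in> U" for z
  proof -
    have "z \<in> (\<Union>(U, \<phi>)\<in>charts H. U)"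
      by (simp only: cover UNIV_I)
    then obtain p where "p \<in> charts H" "z \<in> (case p of (U, \<phi>) \<Rightarrow> U)"
      by (rule UN_E) (rule that)
    then show ?thesis
      by (cases p) auto
  qed
  obtain U0 \<phi>0 where "(U0, \<phi>0) \<in> charts H" using ex by blast
  then interpret H: bundle_chart H U0 \<phi>0 by (rule bundle_chart_of_charts[OF H])
  show "\<forall>e\<in>Tot ?K. \<forall>f\<in>Tot ?K. pr ?K e = pr ?K f \<longrightarrow>
      fadd ?K e f \<in> Tot ?K \<and> pr ?K (fadd ?K e f) = pr ?K e"
    by (simp add: H.Tot_fadd H.pr_fadd)
  show "\<forall>c. \<forall>e\<in>Tot ?K. fscale ?K c e \<in> Tot ?K \<and>
      pr ?K (fscale ?K c e) = pr ?K e"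
    by (simp add: H.Tot_fscale H.pr_fscale)
  show "(\<Union>(U, \<phi>)\<in>charts ?K. U) = UNIV"
  proof -
    have "x \<in> (\<Union>(U, \<phi>)\<in>charts ?K. U)" for x
    proof -
      obtain U \<phi> where U: "(U, \<phi>) \<in> charts H" "x ^ 4 \<in> U" using ex by blast
      then have "((\<lambda>x. x ^ 4) -` U, \<lambda>p. \<phi> (snd p)) \<in> charts ?K"
        by (auto simp: charts_pullback4)
      then show ?thesis
        using U(2) by (intro UN_I) auto
    qed
    then show ?thesis by blast
  qed
  show "\<forall>(V, \<psi>)\<in>charts ?K. open V \<and>
      bij_betw (\<lambda>e. (pr ?K e, \<psi> e)) {e\<in>Tot ?K. pr ?K e \<in> V} (V \<times> UNIV) \<and>
      (\<forall>e\<in>Tot ?K. \<forall>f\<in>Tot ?K. pr ?K e \<in> V \<and> pr ?K e = pr ?K f \<longrightarrow>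
        \<psi> (fadd ?K e f) = \<psi> e + \<psi> f) \<and>
      (\<forall>c. \<forall>e\<in>Tot ?K. pr ?K e \<in> V \<longrightarrow> \<psi> (fscale ?K c e) = c *s \<psi> e)"
  proof (intro ballI, clarify)
    fix V \<psi> assume "(V, \<psi>) \<in> charts ?K"
    then obtain U \<phi> where U: "(U, \<phi>) \<in> charts H" "V = (\<lambda>x. x ^ 4) -` U" "\<psi> = (\<lambda>p. \<phi> (snd p))"
      unfolding charts_pullback4 by blast
    interpret bundle_chart H U \<phi> by (rule bundle_chart_of_charts[OF H U(1)])
    have "open V" unfolding U by (rule open_vimage_power[OF open_U])
    moreover have "bij_betw (\<lambda>e. (pr ?K e, \<psi> e)) {e\<in>Tot ?K. pr ?K e \<in> V} (V \<times> UNIV)"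
    proof (rule bij_betwI[where g = "\<lambda>(x, c). (x, pt (x ^ 4) c)"])
      show "(\<lambda>e. (pr ?K e, \<psi> e)) \<in> {e \<in> Tot ?K. pr ?K e \<in> V} \<rightarrow> V \<times> UNIV"
        by auto
      show "(\<lambda>(x, c). (x, pt (x ^ 4) c)) \<in> V \<times> UNIV \<rightarrow> {e \<in> Tot ?K. pr ?K e \<in> V}"
        by (auto simp: U Tot_pt pr_pt)
      show "(case (pr ?K e, \<psi> e) of (x, c) \<Rightarrow> (x, pt (x ^ 4) c)) = e"
        if "e \<in> {e \<in> Tot ?K. pr ?K e \<in> V}" for e
        using that chart_inj[of "pt (fst e ^ 4) (\<phi> (snd e))" "snd e" "fst e ^ 4"]
        by (auto simp: U Tot_pt pr_pt chart_pt prod_eq_iff)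
      show "(pr ?K (case y of (x, c) \<Rightarrow> (x, pt (x ^ 4) c)), \<psi> (case y of (x, c) \<Rightarrow> (x, pt (x ^ 4) c))) = y"
        if "y \<in> V \<times> UNIV" for y
        using that by (auto simp: U chart_pt)
    qed
    ultimately show "open V \<and>
      bij_betw (\<lambda>e. (pr ?K e, \<psi> e)) {e\<in>Tot ?K. pr ?K e \<in> V} (V \<times> UNIV) \<and>
      (\<forall>e\<in>Tot ?K. \<forall>f\<in>Tot ?K. pr ?K e \<in> V \<and> pr ?K e = pr ?K f \<longrightarrow>
        \<psi> (fadd ?K e f) = \<psi> e + \<psi> f) \<and>
      (\<forall>c. \<forall>e\<in>Tot ?K. pr ?K e \<in> V \<longrightarrow> \<psi> (fscale ?K c e) = c *s \<psi> e)"
      by (auto simp: U chart_fadd chart_fscale)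
  qed
  show "\<forall>(V, \<psi>)\<in>charts ?K. \<forall>(V', \<psi>')\<in>charts ?K. \<exists>g :: complex \<Rightarrow> complex^2^2.
      (\<forall>i j. (\<lambda>z. g z $ i $ j) holomorphic_on V \<inter> V') \<and>
      (\<forall>e\<in>Tot ?K. pr ?K e \<in> V \<inter> V' \<longrightarrow> \<psi>' e = g (pr ?K e) *v \<psi> e)"
  proof (intro ballI, clarify)
    fix V \<psi> V' \<psi>' assume "(V, \<psi>) \<in> charts ?K" "(V', \<psi>') \<in> charts ?K"
    then obtain U \<phi> U' \<phi>' where U: "(U, \<phi>) \<in> charts H" "V = (\<lambda>x. x ^ 4) -` U" "\<psi> = (\<lambda>p. \<phi> (snd p))"
      and U': "(U', \<phi>') \<in> charts H" "V' = (\<lambda>x. x ^ 4) -` U'" "\<psi>' = (\<lambda>p. \<phi>' (snd p))"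
      unfolding charts_pullback4 by blast
    have "\<forall>(U, \<phi>)\<in>charts H. \<forall>(V, \<psi>)\<in>charts H. \<exists>g :: complex \<Rightarrow> complex^2^2.
        (\<forall>i j. (\<lambda>z. g z $ i $ j) holomorphic_on U \<inter> V) \<and>
        (\<forall>e\<in>Tot H. pr H e \<in> U \<inter> V \<longrightarrow> \<psi> e = g (pr H e) *v \<phi> e)"
      using H unfolding holomorphic_bundle_def by (elim conjE)
    from bspec[OF bspec[OF this U(1), unfolded prod.case] U'(1), unfolded prod.case]
    obtain g :: "complex \<Rightarrow> complex^2^2" where g: "\<And>i j. (\<lambda>z. g z $ i $ j) holomorphic_on U \<inter> U'"
      "\<And>e. e \<in> Tot H \<Longrightarrow> pr H e \<in> U \<inter> U' \<Longrightarrow> \<phi>' e = g (pr H e) *v \<phi> e"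
      by blast
    have "(\<lambda>x. g (x ^ 4) $ i $ j) holomorphic_on V \<inter> V'" for i j
      by (rule holomorphic_on_power_arg[OF g(1)]) (simp add: U U')
    then show "\<exists>g :: complex \<Rightarrow> complex^2^2.
        (\<forall>i j. (\<lambda>z. g z $ i $ j) holomorphic_on V \<inter> V') \<and>
        (\<forall>e\<in>Tot ?K. pr ?K e \<in> V \<inter> V' \<longrightarrow> \<psi>' e = g (pr ?K e) *v \<psi> e)"
      using g(2) by (intro exI[of _ "\<lambda>x. g (x ^ 4)"]) (simp add: U U')
  qed
qed

text \<open>
  The branch \<open>\<beta>\<close> of the fourth root along which the connection of the pullback is defined: it
  inverts the fourth power near \<open>x\<close>, so that its derivative cancels the factor \<open>4 x\<^sup>3\<close>.
\<close>

lemma fourth_root_branch: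
  fixes x :: complex
  assumes x: "x \<noteq> 0"
    and \<beta>_def: "\<beta> = (\<lambda>z. x * (z / x ^ 4) powr (1 / 4))"
    and D_def: "D = {z. z / x ^ 4 \<notin> \<real>\<^sub>\<le>\<^sub>0}"
  shows "open D" "x ^ 4 \<in> D" "0 \<notin> D" "\<beta> holomorphic_on D" "\<And>z. z \<in> D \<Longrightarrow> \<beta> z ^ 4 = z" "\<beta> (x ^ 4) = x"
    "(\<beta> has_field_derivative 1 / (4 * x ^ 3)) (at (x ^ 4))"
proof -
  have "D = (\<lambda>z. z / x ^ 4) -` (- \<real>\<^sub>\<le>\<^sub>0)"
    by (auto simp: D_def)
  then show D: "open D"
    using x by (auto intro!: open_vimage continuous_intros)
  show xD: "x ^ 4 \<in> D" "0 \<notin> D"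
    using x by (auto simp: D_def)
  show hol: "\<beta> holomorphic_on D"
    unfolding \<beta>_def using x by (auto intro!: holomorphic_intros simp: D_def)
  show pow: "\<beta> z ^ 4 = z" if "z \<in> D" for z
  proof -
    have "z / x ^ 4 \<noteq> 0" using that by (auto simp: D_def)
    then have "((z / x ^ 4) powr (1 / 4)) ^ 4 = z / x ^ 4"
      by (simp add: powr_def exp_of_nat_mult[symmetric])
    then show ?thesis
      using x by (simp add: \<beta>_def power_mult_distrib)
  qed
  show \<beta>x: "\<beta> (x ^ 4) = x"
    using x by (simp add: \<beta>_def)
  obtain d where d: "(\<beta> has_field_derivative d) (at (x ^ 4))"
    using hol D xD(1) by (auto simp: holomorphic_on_open)
  have "((\<lambda>z. \<beta> z ^ 4) has_field_derivative 4 * x ^ 3 * d) (at (x ^ 4))"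
    by (rule derivative_eq_intros d refl)+ (simp add: \<beta>x)
  moreover have "((\<lambda>z. \<beta> z ^ 4) has_field_derivative 1) (at (x ^ 4))"
    by (rule has_field_derivative_transform_within_open[OF DERIV_ident D xD(1)]) (simp add: pow)
  ultimately have "4 * x ^ 3 * d = 1"
    by (rule DERIV_unique)
  then have "d = 1 / (4 * x ^ 3)"
    using x by (simp add: field_simps)
  with d show "(\<beta> has_field_derivative 1 / (4 * x ^ 3)) (at (x ^ 4))"
    by simp
qed

text \<open>
  The chain rule: \<open>4 x\<^sup>3\<close> times the derivative along \<open>\<beta>\<close> is \<open>d/dx\<close>, and \<open>A\<close> becomes
  \<open>4 x\<^sup>3 A(x\<^sup>4)\<close>. The pulled back chart is required to be a chart, since \<open>\<phi>\<close> need not belong to the atlas.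
\<close>

lemma conn_chart_pullback4:
  assumes "conn_chart H U \<phi> A"
    and K: "bundle_chart (pullback4 H) ((\<lambda>x. x ^ 4) -` U) (\<lambda>p. \<phi> (snd p))"
  shows "conn_chart (pullback4 H) ((\<lambda>x. x ^ 4) -` U) (\<lambda>p. \<phi> (snd p))
    (\<lambda>x. \<chi> i j. 4 * x ^ 3 * A (x ^ 4) $ i $ j)"
proof -
  interpret conn_chart H U \<phi> A by fact
  interpret K: bundle_chart "pullback4 H" "(\<lambda>x. x ^ 4) -` U" "\<lambda>p. \<phi> (snd p)" by fact
  let ?K = "pullback4 H"
  show ?thesis
  proof
    have "(\<lambda>x. A (x ^ 4) $ i $ j) holomorphic_on (\<lambda>x. x ^ 4) -` U - {0}" for i j
      by (rule holomorphic_on_power_arg[OF A_hol]) simp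
    then show "(\<lambda>x. (\<chi> i j. 4 * x ^ 3 * A (x ^ 4) $ i $ j) $ i $ j) holomorphic_on (\<lambda>x. x ^ 4) -` U - {0}" for i j
      by (auto intro!: holomorphic_intros)
    fix W s x assume s: "hol_section ?K W s" and x: "x \<in> W" "x \<in> (\<lambda>x. x ^ 4) -` U" "x \<noteq> 0"
    define \<beta> where "\<beta> = (\<lambda>z. x * (z / x ^ 4) powr (1 / 4))"
    define D where "D = {z. z / x ^ 4 \<notin> \<real>\<^sub>\<le>\<^sub>0}"
    note \<beta> = fourth_root_branch[OF x(3) \<beta>_def D_def]
    define W' where "W' = W \<inter> (\<lambda>x. x ^ 4) -` U"
    have W': "open W'" "W' \<subseteq> (\<lambda>x. x ^ 4) -` U" "x \<in> W'"
      using hol_section_open[OF s] K.open_U x by (auto simp: W'_def)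
    have sW': "hol_section ?K W' s"
      by (rule hol_section_subset[OF s W'(1)]) (auto simp: W'_def)
    have sT: "snd (s y) \<in> Tot H" "pr H (snd (s y)) = y ^ 4" "fst (s y) = y" if "y \<in> W'" for y
      using hol_section_Tot[OF sW' that] hol_section_pr[OF sW' that] by auto
    define f where "f = (\<lambda>i y. \<phi> (snd (s y)) $ i)"
    have f_hol: "f i holomorphic_on W'" for i
      using sW' unfolding K.hol_section_iff[OF W'(2)] by (auto simp: f_def)
    define V where "V = D \<inter> \<beta> -` W'"
    have "open V"
      unfolding V_def using \<beta>(4) by (intro continuous_open_preimage holomorphic_on_imp_continuous_on \<beta>(1) W'(1))
    have xV: "x ^ 4 \<in> V"
      using \<beta>(2,6) W'(3) by (auto simp: V_def)
    have VU: "V \<subseteq> U"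
    proof
      fix z assume "z \<in> V"
      then have "\<beta> z \<in> W'" "\<beta> z ^ 4 = z" using \<beta>(5) by (auto simp: V_def)
      then show "z \<in> U" using W'(2) by auto
    qed
    define \<sigma> where "\<sigma> = (\<lambda>z. snd (s (\<beta> z)))"
    have \<sigma>: "hol_section H V \<sigma>"
      unfolding hol_section_iff[OF VU]
    proof (intro conjI ballI allI \<open>open V\<close>)
      show "\<sigma> z \<in> Tot H" "pr H (\<sigma> z) = z" if "z \<in> V" for z
        using that sT[of "\<beta> z"] \<beta>(5) by (auto simp: \<sigma>_def V_def)
      have "f i \<circ> \<beta> holomorphic_on V" for i
        by (rule holomorphic_on_compose_gen[OF holomorphic_on_subset[OF \<beta>(4)] f_hol]) (auto simp: V_def)
      then show "(\<lambda>z. \<phi> (\<sigma> z) $ i) holomorphic_on V" for i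
        by (simp add: o_def f_def \<sigma>_def)
    qed
    have x4: "x ^ 4 \<in> U" "x ^ 4 \<noteq> 0" using x by auto
    note c = conn_section[OF \<sigma> xV x4]
    have \<sigma>x: "\<sigma> (x ^ 4) = snd (s x)" by (simp add: \<sigma>_def \<beta>(6))
    have conn_eq: "conn ?K s x = (x, fscale H (4 * x ^ 3) (conn H \<sigma> (x ^ 4)))"
      by (simp add: pullback4_def \<sigma>_def \<beta>_def)
    have "(f i has_field_derivative deriv (f i) x) (at x)" for i
      using f_hol W'(1,3) holomorphic_derivI by blast
    then have "((\<lambda>z. f i (\<beta> z)) has_field_derivative deriv (f i) x * (1 / (4 * x ^ 3))) (at (x ^ 4))" for i
      by (intro DERIV_chain2[OF _ \<beta>(7)]) (simp add: \<beta>(6))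
    from DERIV_imp_deriv[OF this] have "vec_deriv (\<lambda>z. \<phi> (\<sigma> z)) (x ^ 4) $ i = deriv (f i) x / (4 * x ^ 3)" for i
      by (simp add: vec_deriv_def \<sigma>_def f_def)
    then show "conn ?K s x \<in> Tot ?K \<and> pr ?K (conn ?K s x) = x \<and>
        \<phi> (snd (conn ?K s x)) = vec_deriv (\<lambda>w. \<phi> (snd (s w))) x +
          (\<chi> i j. 4 * x ^ 3 * A (x ^ 4) $ i $ j) *v \<phi> (snd (s x))"
      using c x4 x(3) unfolding conn_eq
      by (simp add: Tot_fscale pr_fscale chart_fscale vec2_eq_iff matrix_vector_mult_2 \<sigma>x vec_deriv_def f_def
          distrib_left mult.assoc)
  qed
qed

lemma bundle_chart_pullback4:
  assumes H: "holomorphic_bundle H" and U: "(U, \<phi>) \<in> charts H"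
  shows "bundle_chart (pullback4 H) ((\<lambda>x. x ^ 4) -` U) (\<lambda>p. \<phi> (snd p))"
  by (rule bundle_chart_of_charts[OF holomorphic_bundle_pullback4[OF H]]) (use U in \<open>auto simp: charts_pullback4\<close>)

lemma connection_off_0_pullback4:
  assumes H: "holomorphic_bundle H" and C: "connection_off_0 H"
  shows "connection_off_0 (pullback4 H)"
proof (rule connection_off_0I[OF holomorphic_bundle_pullback4[OF H]])
  fix V \<psi> assume "(V, \<psi>) \<in> charts (pullback4 H)"
  then obtain U \<phi> where U: "(U, \<phi>) \<in> charts H" "V = (\<lambda>x. x ^ 4) -` U" "\<psi> = (\<lambda>p. \<phi> (snd p))"
    unfolding charts_pullback4 by blast
  obtain A where "conn_chart H U \<phi> A"
    using bundle_chart.conn_chart_exists[OF bundle_chart_of_charts[OF H U(1)] C] by blast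
  from conn_chart_pullback4[OF this bundle_chart_pullback4[OF H U(1)]]
  show "\<exists>A. conn_chart (pullback4 H) V \<psi> A"
    unfolding U(2,3) by blast
qed



section \<open>Germs of sections at the origin and the pole part\<close>

locale pointed_chart = bundle_chart +
  assumes zero_in_U: "0 \<in> U"
begin

lemma germ_section_iff:
  "germ_section H s \<longleftrightarrow> (\<forall>\<^sub>F z in nhds 0. s z \<in> Tot H \<and> pr H (s z) = z) \<and>
     (\<forall>i. (\<lambda>z. \<phi> (s z) $ i) analytic_on {0})"
proof
  assume "germ_section H s"
  then obtain W where W: "0 \<in> W" "hol_section H W s"
    unfolding germ_section_def by blast
  have "hol_section H (W \<inter> U) s"
    by (rule hol_section_subset[OF W(2)]) (use hol_section_open[OF W(2)] open_U in auto)
  then have h: "open (W \<inter> U)" "(\<lambda>z. \<phi> (s z) $ i) holomorphic_on W \<inter> U" for i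
    unfolding hol_section_iff[OF Int_lower2] by auto
  have "\<forall>\<^sub>F z in nhds 0. z \<in> W"
    using hol_section_open[OF W(2)] W(1) by (rule eventually_nhds_in_open)
  then have "\<forall>\<^sub>F z in nhds 0. s z \<in> Tot H \<and> pr H (s z) = z"
    by (rule eventually_mono) (use hol_section_Tot[OF W(2)] hol_section_pr[OF W(2)] in auto)
  moreover have "(\<lambda>z. \<phi> (s z) $ i) analytic_on {0}" for i
    unfolding analytic_at using h W(1) zero_in_U by (intro exI[of _ "W \<inter> U"]) auto
  ultimately show "(\<forall>\<^sub>F z in nhds 0. s z \<in> Tot H \<and> pr H (s z) = z) \<and>
     (\<forall>i. (\<lambda>z. \<phi> (s z) $ i) analytic_on {0})"
    by blast
next
  assume *: "(\<forall>\<^sub>F z in nhds 0. s z \<in> Tot H \<and> pr H (s z) = z) \<and>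
     (\<forall>i. (\<lambda>z. \<phi> (s z) $ i) analytic_on {0})"
  obtain S where S: "open S" "0 \<in> S" "\<And>z. z \<in> S \<Longrightarrow> s z \<in> Tot H \<and> pr H (s z) = z"
    using * unfolding eventually_nhds by blast
  have "\<exists>T. open T \<and> 0 \<in> T \<and> (\<lambda>z. \<phi> (s z) $ i) holomorphic_on T" for i
    using * unfolding analytic_at by blast
  then obtain T where T: "\<And>i. open (T i)" "\<And>i. 0 \<in> T i" "\<And>i. (\<lambda>z. \<phi> (s z) $ i) holomorphic_on T i"
    by metis
  define W where "W = S \<inter> (T 1 \<inter> T 2) \<inter> U"
  have WU: "W \<subseteq> U" by (auto simp: W_def)
  have WT: "W \<subseteq> T i" for i
    using exhaust_2[of i] by (auto simp: W_def)
  have "hol_section H W s"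
    unfolding hol_section_iff[OF WU]
  proof (intro conjI ballI allI)
    show "open W" unfolding W_def by (intro open_Int S T open_U)
    show "s z \<in> Tot H" "pr H (s z) = z" if "z \<in> W" for z
      using S(3) that by (auto simp: W_def)
    show "(\<lambda>z. \<phi> (s z) $ i) holomorphic_on W" for i
      by (rule holomorphic_on_subset[OF T(3) WT])
  qed
  moreover have "0 \<in> W"
    using S(2) T(2) zero_in_U by (simp add: W_def)
  ultimately show "germ_section H s"
    unfolding germ_section_def by blast
qed

lemma germ_section_pt:
  assumes "\<And>i. (\<lambda>z. f z $ i) analytic_on {0}"
  shows "germ_section H (\<lambda>z. pt z (f z))"
  unfolding germ_section_iff
proof (intro conjI allI)
  have U: "\<forall>\<^sub>F z in nhds 0. z \<in> U"
    using open_U zero_in_U by (rule eventually_nhds_in_open)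
  then show "\<forall>\<^sub>F z in nhds 0. pt z (f z) \<in> Tot H \<and> pr H (pt z (f z)) = z"
    by (rule eventually_mono) (simp add: Tot_pt pr_pt)
  have "\<forall>\<^sub>F z in nhds 0. f z $ i = \<phi> (pt z (f z)) $ i" for i
    by (rule eventually_mono[OF U]) (simp add: chart_pt)
  then show "(\<lambda>z. \<phi> (pt z (f z)) $ i) analytic_on {0}" for i
    using assms analytic_at_cong[of "\<lambda>z. f z $ i" "\<lambda>z. \<phi> (pt z (f z)) $ i" 0] by simp
qed

text \<open>
  The coordinate sections of the chart are combinations of the basis, so the matrix of the basis
  has a holomorphic right inverse.
\<close>

lemma germ_basis_coords:
  assumes v: "germ_basis H v"
  obtains F :: "complex \<Rightarrow> complex^2^2"
  where "\<And>i j. (\<lambda>z. frame_matrix \<phi> (\<lambda>j. v j z) $ i $ j) analytic_on {0}"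
    "\<And>i j. (\<lambda>z. F z $ i $ j) analytic_on {0}"
    "\<forall>\<^sub>F z in nhds 0. frame_matrix \<phi> (\<lambda>j. v j z) ** F z = mat 1"
proof -
  have gv: "germ_section H (v j)" for j
    using v unfolding germ_basis_def by blast
  have "\<exists>f :: complex \<Rightarrow> complex^2. (\<forall>i. (\<lambda>z. f z $ i) analytic_on {0}) \<and>
      (\<forall>\<^sub>F z in nhds 0. pt z (axis k 1) = lincomb H (f z) (\<lambda>i. v i z))" for k
    using v germ_section_pt[of "\<lambda>z. axis k 1"] unfolding germ_basis_def by auto
  then have ex: "\<forall>k. \<exists>f :: complex \<Rightarrow> complex^2. (\<forall>i. (\<lambda>z. f z $ i) analytic_on {0}) \<and>
      (\<forall>\<^sub>F z in nhds 0. pt z (axis k 1) = lincomb H (f z) (\<lambda>i. v i z))"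
    by (rule allI)
  obtain f :: "2 \<Rightarrow> complex \<Rightarrow> complex^2" where "\<forall>k. (\<forall>i. (\<lambda>z. f k z $ i) analytic_on {0}) \<and>
      (\<forall>\<^sub>F z in nhds 0. pt z (axis k 1) = lincomb H (f k z) (\<lambda>i. v i z))"
    by (rule exE[OF choice[OF ex]]) (rule that)
  then have f: "(\<lambda>z. f k z $ i) analytic_on {0}"
    "\<forall>\<^sub>F z in nhds 0. pt z (axis k 1) = lincomb H (f k z) (\<lambda>i. v i z)" for k i
    by simp_all
  define F :: "complex \<Rightarrow> complex^2^2" where "F z = (\<chi> i k. f k z $ i)" for z
  have U: "\<forall>\<^sub>F z in nhds 0. z \<in> U"
    using open_U zero_in_U by (rule eventually_nhds_in_open)
  have vT: "\<forall>\<^sub>F z in nhds 0. \<forall>j. v j z \<in> Tot H \<and> pr H (v j z) = z"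
    using gv unfolding germ_section_iff by (intro eventually_all_finite) blast
  have fA: "\<forall>\<^sub>F z in nhds 0. \<forall>k. pt z (axis k 1) = lincomb H (f k z) (\<lambda>i. v i z)"
    by (intro eventually_all_finite f)
  have "\<forall>\<^sub>F z in nhds 0. frame_matrix \<phi> (\<lambda>j. v j z) ** F z = mat 1"
    using U vT fA
  proof eventually_elim
    case (elim z)
    have "axis k 1 = frame_matrix \<phi> (\<lambda>j. v j z) *v f k z" for k
    proof -
      have "axis k 1 = \<phi> (lincomb H (f k z) (\<lambda>i. v i z))"
        using chart_pt[OF elim(1), of "axis k 1"] elim(3) by simp
      also have "\<dots> = frame_matrix \<phi> (\<lambda>j. v j z) *v f k z"
        by (rule chart_lincomb[OF elim(1)]) (use elim(2) in auto)
      finally show ?thesis .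
    qed
    then have "(frame_matrix \<phi> (\<lambda>j. v j z) ** F z) $ i $ k = axis k 1 $ i" for i k
      by (simp add: F_def matrix_mult_2 matrix_vector_mult_2)
    then show ?case
      by (simp add: vec_eq_iff mat_def axis_def)
  qed
  moreover have "(\<lambda>z. frame_matrix \<phi> (\<lambda>j. v j z) $ i $ j) analytic_on {0}" for i j
    using gv[of j] unfolding germ_section_iff by (simp add: frame_matrix_def)
  moreover have "(\<lambda>z. F z $ i $ j) analytic_on {0}" for i j
    using f(1) by (simp add: F_def)
  ultimately show ?thesis
    using that by blast
qed

lemma lincomb_pt:
  assumes z: "z \<in> U"
  shows "\<phi> (lincomb H c (\<lambda>j. pt z (axis j 1))) = c" "lincomb H c (\<lambda>j. pt z (axis j 1)) \<in> Tot H"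
    "pr H (lincomb H c (\<lambda>j. pt z (axis j 1))) = z"
  using chart_lincomb[OF z Tot_pt[OF z] pr_pt[OF z], of c "\<lambda>j. axis j 1"]
    Tot_lincomb[OF z Tot_pt[OF z] pr_pt[OF z], of c "\<lambda>j. axis j 1"]
    pr_lincomb[OF z Tot_pt[OF z] pr_pt[OF z], of c "\<lambda>j. axis j 1"]
  by (simp_all add: frame_matrix_def chart_pt[OF z] vec2_eq_iff matrix_vector_mult_2 axis_def)

lemma germ_basis_pt: "germ_basis H (\<lambda>j z. pt z (axis j 1))"
proof -
  have U: "\<forall>\<^sub>F z in nhds 0. z \<in> U"
    using open_U zero_in_U by (rule eventually_nhds_in_open)
  show ?thesis
    unfolding germ_basis_def
  proof (intro conjI allI impI)
    show "germ_section H (\<lambda>z. pt z (axis j 1))" for j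
      by (rule germ_section_pt) simp
    fix s assume s: "germ_section H s"
    have s': "\<forall>\<^sub>F z in nhds 0. s z \<in> Tot H \<and> pr H (s z) = z"
      using s unfolding germ_section_iff by blast
    have "\<forall>\<^sub>F z in nhds 0. s z = lincomb H (\<phi> (s z)) (\<lambda>j. pt z (axis j 1))"
      using U s'
    proof eventually_elim
      case (elim z)
      show ?case
        by (rule chart_inj[of _ _ z]) (use elim lincomb_pt[OF elim(1)] in auto)
    qed
    then show "\<exists>f. (\<forall>i. (\<lambda>z. f z $ i) analytic_on {0}) \<and>
        (\<forall>\<^sub>F z in nhds 0. s z = lincomb H (f z) (\<lambda>j. pt z (axis j 1)))"
      using s unfolding germ_section_iff by (intro exI[of _ "\<lambda>z. \<phi> (s z)"]) auto
  next
    fix f g :: "complex \<Rightarrow> complex^2"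
    assume "(\<forall>i. (\<lambda>z. f z $ i) analytic_on {0}) \<and> (\<forall>i. (\<lambda>z. g z $ i) analytic_on {0}) \<and>
      (\<forall>\<^sub>F z in nhds 0. lincomb H (f z) (\<lambda>j. pt z (axis j 1)) = lincomb H (g z) (\<lambda>j. pt z (axis j 1)))"
    then have "\<forall>\<^sub>F z in nhds 0. lincomb H (f z) (\<lambda>j. pt z (axis j 1)) = lincomb H (g z) (\<lambda>j. pt z (axis j 1))"
      by blast
    with U show "\<forall>\<^sub>F z in nhds 0. f z = g z"
      by eventually_elim (metis lincomb_pt(1))
  qed
qed

end

text \<open>
  The matrix \<open>M\<close> of \<open>z\<^sup>2 \<nabla>\<close>, so that \<open>A = M / z\<^sup>2\<close>.
\<close>

locale te_chart = pointed_chart +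
  fixes M :: "complex \<Rightarrow> complex^2^2"
  assumes M_hol: "\<And>i j. (\<lambda>z. M z $ i $ j) holomorphic_on U"
    and conn_chart: "conn_chart H U \<phi> (\<lambda>z. \<chi> i j. M z $ i $ j / z\<^sup>2)"
begin

lemma M_analytic: "(\<lambda>z. M z $ i $ j) analytic_on {0}"
  using M_hol open_U zero_in_U by (auto simp: analytic_at)

lemma pole_conn:
  assumes "hol_section H W s" "z \<in> W" "z \<in> U" "z \<noteq> 0"
  shows "conn H s z \<in> Tot H" "pr H (conn H s z) = z"
    "\<phi> (fscale H (z\<^sup>2) (conn H s z)) = z\<^sup>2 *s vec_deriv (\<lambda>w. \<phi> (s w)) z + M z *v \<phi> (s z)"
proof -
  interpret c: conn_chart H U \<phi> "\<lambda>z. \<chi> i j. M z $ i $ j / z\<^sup>2" by (rule conn_chart)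
  note * = c.conn_section[OF assms]
  show "conn H s z \<in> Tot H" "pr H (conn H s z) = z"
    using * by auto
  show "\<phi> (fscale H (z\<^sup>2) (conn H s z)) = z\<^sup>2 *s vec_deriv (\<lambda>w. \<phi> (s w)) z + M z *v \<phi> (s z)"
    using * assms(3,4) by (simp add: chart_fscale vec2_eq_iff matrix_vector_mult_2 field_simps)
qed

lemma pole_conn_germ:
  assumes "germ_section H s"
  shows "\<forall>\<^sub>F z in at 0. conn H s z \<in> Tot H \<and> pr H (conn H s z) = z \<and>
    \<phi> (fscale H (z\<^sup>2) (conn H s z)) = z\<^sup>2 *s vec_deriv (\<lambda>w. \<phi> (s w)) z + M z *v \<phi> (s z)"
proof -
  obtain W where W: "0 \<in> W" "hol_section H W s"
    using assms unfolding germ_section_def by blast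
  have "\<forall>\<^sub>F z in at 0. z \<in> (W \<inter> U) - {0}"
    using W(1) hol_section_open[OF W(2)] open_U zero_in_U by (intro eventually_at_in_open) auto
  then show ?thesis
    by (rule eventually_mono) (use pole_conn[OF W(2)] in auto)
qed

text \<open>
  The matrix \<open>V\<close> of the basis \<open>v\<close> in the chart satisfies \<open>z\<^sup>2 V' + M V = V B\<close>. So \<open>B\<close> is related
  to \<open>M\<close> by a base change, and everything that is invariant under base change can be read off
  from \<open>M\<close>.
\<close>

lemma conn_matrix_gauge:
  assumes B: "conn_matrix H v B"
  obtains V :: "complex fps^2^2"
  where "invertible V"
    "(\<chi> i j. fps_X\<^sup>2 * fps_deriv (V $ i $ j)) + fps_matrix M ** V = V ** fps_matrix B"
proof -
  have v: "germ_basis H v" and B_an: "\<And>i j. (\<lambda>z. B z $ i $ j) analytic_on {0}"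
    and B_eq: "\<And>j. \<forall>\<^sub>F z in at 0. fscale H (z\<^sup>2) (conn H (v j) z) = lincomb H (column j (B z)) (\<lambda>i. v i z)"
    using B unfolding conn_matrix_def by auto
  have gv: "germ_section H (v j)" for j
    using v unfolding germ_basis_def by blast
  let ?V = "\<lambda>z. frame_matrix \<phi> (\<lambda>j. v j z)"
  obtain F :: "complex \<Rightarrow> complex^2^2" where V_an: "\<And>i j. (\<lambda>z. ?V z $ i $ j) analytic_on {0}"
    and F_an: "\<And>i j. (\<lambda>z. F z $ i $ j) analytic_on {0}" and F: "\<forall>\<^sub>F z in nhds 0. ?V z ** F z = mat 1"
    using germ_basis_coords[OF v] by blast
  define dV where "dV z = (\<chi> i j. z\<^sup>2 * mat_deriv ?V z $ i $ j)" for z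
  have dV_an: "(\<lambda>z. dV z $ i $ j) analytic_on {0}" for i j
    unfolding dV_def mat_deriv_def vec_lambda_beta
    by (intro analytic_intros V_an)
  have vT: "\<forall>\<^sub>F z in nhds 0. \<forall>j. v j z \<in> Tot H \<and> pr H (v j z) = z"
    using gv unfolding germ_section_iff by (intro eventually_all_finite) blast
  have U: "\<forall>\<^sub>F z in at 0. z \<in> U"
    using open_U zero_in_U by (intro eventually_at_in_open')
  have vT': "\<forall>\<^sub>F z in at 0. \<forall>j. v j z \<in> Tot H \<and> pr H (v j z) = z"
    using vT by (auto simp: eventually_nhds_conv_at)
  have C: "\<forall>\<^sub>F z in at 0. \<forall>j. conn H (v j) z \<in> Tot H \<and> pr H (conn H (v j) z) = z \<and>
      \<phi> (fscale H (z\<^sup>2) (conn H (v j) z)) = z\<^sup>2 *s vec_deriv (\<lambda>w. \<phi> (v j w)) z + M z *v \<phi> (v j z)"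
    by (intro eventually_all_finite pole_conn_germ gv)
  have B': "\<forall>\<^sub>F z in at 0. \<forall>j. fscale H (z\<^sup>2) (conn H (v j) z) = lincomb H (column j (B z)) (\<lambda>i. v i z)"
    by (intro eventually_all_finite B_eq)
  have rel_at: "\<forall>\<^sub>F z in at 0. (dV z + M z ** ?V z) $ i $ j = (?V z ** B z) $ i $ j" for i j
    using U vT' C B'
  proof eventually_elim
    case (elim z)
    have "z\<^sup>2 *s vec_deriv (\<lambda>w. \<phi> (v j w)) z + M z *v \<phi> (v j z) = ?V z *v column j (B z)"
      using chart_lincomb[OF elim(1), of "\<lambda>i. v i z" "column j (B z)"] elim by metis
    then have "(z\<^sup>2 *s vec_deriv (\<lambda>w. \<phi> (v j w)) z + M z *v \<phi> (v j z)) $ i = (?V z *v column j (B z)) $ i"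
      by (rule arg_cong)
    then show ?case
      by (simp add: dV_def mat_deriv_def vec_deriv_def frame_matrix_def matrix_mult_2 matrix_vector_mult_2 column_def)
  qed
  have "\<forall>\<^sub>F z in nhds 0. (dV z + M z ** ?V z) $ i $ j = (?V z ** B z) $ i $ j" for i j
    using rel_at[of i j]
    by (intro analytic_eventually_eq) (auto simp: matrix_mult_2 intro!: analytic_intros dV_an V_an M_analytic B_an)
  then have "\<forall>\<^sub>F z in nhds 0. \<forall>i j. (dV z + M z ** ?V z) $ i $ j = (?V z ** B z) $ i $ j"
    by (intro eventually_all_finite)
  then have "\<forall>\<^sub>F z in nhds 0. dV z + M z ** ?V z = ?V z ** B z"
    by (rule eventually_mono) (simp add: vec_eq_iff)
  from fps_matrix_cong[OF this]
  have rel: "fps_matrix dV + fps_matrix M ** fps_matrix ?V = fps_matrix ?V ** fps_matrix B"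
    by (simp add: fps_matrix_add fps_matrix_mult dV_an V_an M_analytic B_an matrix_mult_2 analytic_intros)
  have dV_fps: "fps_matrix dV = (\<chi> i j. fps_X\<^sup>2 * fps_deriv (fps_matrix ?V $ i $ j))"
    unfolding dV_def by (rule fps_matrix_deriv[OF V_an])
  have "fps_matrix ?V ** fps_matrix F = mat 1"
    using fps_matrix_cong[OF F] by (simp add: fps_matrix_mult V_an F_an fps_matrix_mat_1)
  moreover have "\<forall>\<^sub>F z in nhds 0. F z ** ?V z = mat 1"
    by (rule eventually_mono[OF F]) (simp add: matrix_left_right_inverse)
  from fps_matrix_cong[OF this] have "fps_matrix F ** fps_matrix ?V = mat 1"
    by (simp add: fps_matrix_mult V_an F_an fps_matrix_mat_1)
  ultimately have "invertible (fps_matrix ?V)"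
    unfolding invertible_def by blast
  then show ?thesis
    by (rule that) (use rel dV_fps in simp)
qed

text \<open>
  The coordinate frame of the chart is a basis with connection matrix \<open>M\<close>; it witnesses that the
  definite descriptions in \<open>rho\<close> and \<open>delta\<close> are satisfied.
\<close>

lemma conn_matrix_pt: "conn_matrix H (\<lambda>j z. pt z (axis j 1)) M"
  unfolding conn_matrix_def
proof (intro conjI allI germ_basis_pt M_analytic)
  fix j :: 2
  let ?v = "\<lambda>j z. pt z (axis j 1)"
  have U: "\<forall>\<^sub>F z in at 0. z \<in> U"
    using open_U zero_in_U by (intro eventually_at_in_open')
  have "germ_section H (?v j)"
    by (rule germ_section_pt) simp
  from pole_conn_germ[OF this] U
  show "\<forall>\<^sub>F z in at 0. fscale H (z\<^sup>2) (conn H (?v j) z) = lincomb H (column j (M z)) (\<lambda>i. ?v i z)"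
  proof eventually_elim
    case (elim z)
    have "vec_deriv (\<lambda>w. \<phi> (?v j w)) z = vec_deriv (\<lambda>w. axis j 1) z"
      using eventually_nhds_in_open[OF open_U elim(2)]
      by (intro vec_deriv_cong) (auto elim!: eventually_mono simp: chart_pt)
    also have "\<dots> = 0" by (simp add: vec_deriv_def vec_eq_iff)
    finally have vd: "vec_deriv (\<lambda>w. \<phi> (?v j w)) z = 0" .
    show ?case
    proof (rule chart_inj[of _ _ z])
      show "\<phi> (fscale H (z\<^sup>2) (conn H (?v j) z)) = \<phi> (lincomb H (column j (M z)) (\<lambda>i. ?v i z))"
        unfolding conjunct2[OF conjunct2[OF elim(1)], unfolded vd chart_pt[OF elim(2)]] lincomb_pt(1)[OF elim(2)]
        using exhaust_2[of j] by (auto simp: vec2_eq_iff matrix_vector_mult_2 column_def axis_def)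
    qed (use elim in \<open>auto simp: Tot_fscale pr_fscale intro!: Tot_lincomb pr_lincomb Tot_pt pr_pt\<close>)
  qed
qed

lemma conn_matrix_invariants:
  assumes "conn_matrix H v B"
  shows "k \<le> 1 \<Longrightarrow> fps_nth (trace (fps_matrix B)) k = fps_nth (trace (fps_matrix M)) k"
    and "k \<le> 1 \<Longrightarrow> fps_nth (det (fps_matrix B)) k = fps_nth (det (fps_matrix M)) k"
    and "B 0 = 0 \<longleftrightarrow> M 0 = 0"
proof -
  obtain V :: "complex fps^2^2" where V: "invertible V"
    "(\<chi> i j. fps_X\<^sup>2 * fps_deriv (V $ i $ j)) + fps_matrix M ** V = V ** fps_matrix B"
    using conn_matrix_gauge[OF assms] by blast
  note g = gauge_invariants[OF V]
  show "k \<le> 1 \<Longrightarrow> fps_nth (trace (fps_matrix B)) k = fps_nth (trace (fps_matrix M)) k"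
    "k \<le> 1 \<Longrightarrow> fps_nth (det (fps_matrix B)) k = fps_nth (det (fps_matrix M)) k"
    by (fact g(1), fact g(2))
  have "(\<lambda>z. B z $ i $ j) analytic_on {0}" for i j
    using assms unfolding conn_matrix_def by blast
  then show "B 0 = 0 \<longleftrightarrow> M 0 = 0"
    using g(3) by (simp add: fps_nth_fps_matrix_0 M_analytic vec_eq_iff)
qed

lemma rho_eq:
  assumes k: "k \<le> 1"
  shows "rho H k = fps_nth (trace (fps_matrix M)) k / 2"
  unfolding rho_def
proof (rule the_equality)
  show "\<exists>v B. conn_matrix H v B \<and> fps_nth (trace (fps_matrix M)) k / 2 = fps_nth (trace (fps_matrix B)) k / 2"
    by (intro exI[of _ "\<lambda>j z. pt z (axis j 1)"] exI[of _ M] conjI conn_matrix_pt refl)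
  fix c assume "\<exists>v B. conn_matrix H v B \<and> c = fps_nth (trace (fps_matrix B)) k / 2"
  then obtain v B where "conn_matrix H v B" "c = fps_nth (trace (fps_matrix B)) k / 2"
    by blast
  then show "c = fps_nth (trace (fps_matrix M)) k / 2"
    using conn_matrix_invariants(1)[OF _ k] by simp
qed

lemma delta_eq:
  assumes k: "k \<le> 1"
  shows "delta H k = fps_nth (det (fps_matrix M)) k"
  unfolding delta_def
proof (rule the_equality)
  show "\<exists>v B. conn_matrix H v B \<and> fps_nth (det (fps_matrix M)) k = fps_nth (det (fps_matrix B)) k"
    by (intro exI[of _ "\<lambda>j z. pt z (axis j 1)"] exI[of _ M] conjI conn_matrix_pt refl)
  fix c assume "\<exists>v B. conn_matrix H v B \<and> c = fps_nth (det (fps_matrix B)) k"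
  then obtain v B where "conn_matrix H v B" "c = fps_nth (det (fps_matrix B)) k"
    by blast
  then show "c = fps_nth (det (fps_matrix M)) k"
    using conn_matrix_invariants(2)[OF _ k] by simp
qed

text \<open>
  If \<open>t = z\<^sup>2 \<nabla> s\<close> off 0, then the coordinates of \<open>t\<close> are those of \<open>z\<^sup>2 s' + M s\<close> also at 0, by
  continuity. So \<open>t(0)\<close> depends on \<open>s(0)\<close> alone, and the section \<open>s\<close> with constant coordinates
  shows existence.
\<close>

lemma pole_part_eq:
  assumes e: "e \<in> Tot H" "pr H e = 0"
  shows "pole_part H e = pt 0 (M 0 *v \<phi> e)"
  unfolding pole_part_def
proof (rule the_equality)
  define s where "s z = pt z (\<phi> e)" for z
  define t where "t z = pt z (M z *v \<phi> e)" for z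
  have U: "\<forall>\<^sub>F z in at 0. z \<in> U"
    using open_U zero_in_U by (intro eventually_at_in_open')
  have gs: "germ_section H s"
    unfolding s_def by (rule germ_section_pt) simp
  have gt: "germ_section H t"
    unfolding t_def by (rule germ_section_pt) (auto simp: matrix_vector_mult_2 intro!: analytic_intros M_analytic)
  have "\<forall>\<^sub>F z in at 0. t z = fscale H (z\<^sup>2) (conn H s z)"
    using pole_conn_germ[OF gs] U
  proof eventually_elim
    case (elim z)
    have "vec_deriv (\<lambda>w. \<phi> (s w)) z = vec_deriv (\<lambda>w. \<phi> e) z"
      using eventually_nhds_in_open[OF open_U elim(2)]
      by (intro vec_deriv_cong) (auto elim!: eventually_mono simp: chart_pt s_def)
    also have "\<dots> = 0" by (simp add: vec_deriv_def vec_eq_iff)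
    finally have vd: "vec_deriv (\<lambda>w. \<phi> (s w)) z = 0" .
    show ?case
      by (rule chart_inj[of _ _ z])
        (use elim vd in \<open>auto simp: Tot_fscale pr_fscale t_def s_def Tot_pt pr_pt chart_pt\<close>)
  qed
  moreover have "s 0 = e"
    unfolding s_def by (rule chart_inj[of _ _ 0]) (use e zero_in_U in \<open>auto simp: Tot_pt pr_pt chart_pt\<close>)
  moreover have "t 0 = pt 0 (M 0 *v \<phi> e)" by (simp add: t_def)
  ultimately show "\<exists>s t. germ_section H s \<and> germ_section H t \<and> s 0 = e \<and> t 0 = pt 0 (M 0 *v \<phi> e) \<and>
      (\<forall>\<^sub>F z in at 0. t z = fscale H (z\<^sup>2) (conn H s z))"
    using gs gt by blast
next
  fix h assume "\<exists>s t. germ_section H s \<and> germ_section H t \<and> s 0 = e \<and> t 0 = h \<and>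
      (\<forall>\<^sub>F z in at 0. t z = fscale H (z\<^sup>2) (conn H s z))"
  then obtain s t where st: "germ_section H s" "germ_section H t" "s 0 = e" "t 0 = h"
    "\<forall>\<^sub>F z in at 0. t z = fscale H (z\<^sup>2) (conn H s z)"
    by blast
  have s_an: "(\<lambda>z. \<phi> (s z) $ i) analytic_on {0}" and t_an: "(\<lambda>z. \<phi> (t z) $ i) analytic_on {0}" for i
    using st(1,2) unfolding germ_section_iff by auto
  have "\<phi> (t 0) $ i = (0\<^sup>2 *s vec_deriv (\<lambda>w. \<phi> (s w)) 0 + M 0 *v \<phi> (s 0)) $ i" for i
  proof -
    have "\<forall>\<^sub>F z in at 0. \<phi> (t z) $ i = z\<^sup>2 * deriv (\<lambda>w. \<phi> (s w) $ i) z + (M z *v \<phi> (s z)) $ i"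
      using pole_conn_germ[OF st(1)] st(5) by eventually_elim (simp add: vec_deriv_def)
    then have "\<forall>\<^sub>F z in nhds 0. \<phi> (t z) $ i = z\<^sup>2 * deriv (\<lambda>w. \<phi> (s w) $ i) z + (M z *v \<phi> (s z)) $ i"
      by (intro analytic_eventually_eq t_an)
        (auto simp: matrix_vector_mult_2 intro!: analytic_intros s_an M_analytic)
    from eventually_nhds_x_imp_x[OF this] show ?thesis by simp
  qed
  then have "\<phi> h = M 0 *v \<phi> e"
    using st(3,4) by (simp add: vec_eq_iff)
  moreover have "h \<in> Tot H" "pr H h = 0"
    using st(2,4) unfolding germ_section_iff by (auto dest: eventually_nhds_x_imp_x)
  ultimately show "h = pt 0 (M 0 *v \<phi> e)"
    by (intro chart_inj[of _ _ 0]) (use zero_in_U in \<open>auto simp: Tot_pt pr_pt chart_pt\<close>)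
qed

lemma pole_part_matrixD:
  assumes "pole_part_matrix H e N"
  shows "invertible (frame_matrix \<phi> e)" "M 0 ** frame_matrix \<phi> e = frame_matrix \<phi> e ** N"
proof -
  have e: "e j \<in> Tot H" "pr H (e j) = 0" for j
    using assms unfolding pole_part_matrix_def fibre_basis_def by auto
  show "invertible (frame_matrix \<phi> e)"
    using assms unfolding pole_part_matrix_def fibre_basis_iff[OF zero_in_U] by blast
  have "M 0 *v \<phi> (e j) = frame_matrix \<phi> e *v column j N" for j
  proof -
    have "pole_part H (e j) = lincomb H (column j N) e"
      using assms unfolding pole_part_matrix_def by blast
    then have "\<phi> (pt 0 (M 0 *v \<phi> (e j))) = \<phi> (lincomb H (column j N) e)"
      by (simp add: pole_part_eq[OF e])
    then show ?thesis
      by (simp add: chart_pt[OF zero_in_U] chart_lincomb[OF zero_in_U e])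
  qed
  then have "(M 0 *v \<phi> (e j)) $ i = (frame_matrix \<phi> e *v column j N) $ i" for i j
    by simp
  then show "M 0 ** frame_matrix \<phi> e = frame_matrix \<phi> e ** N"
    by (simp add: vec_eq_iff matrix_mult_2 matrix_vector_mult_2 frame_matrix_def column_def)
qed

text \<open>
  The trace of a single Jordan block with eigenvalue \<open>l\<close> is \<open>2 l\<close>, hence \<open>l = 0\<close>.
\<close>

lemma nilpotent_pole:
  assumes "trace_free H" "single_jordan_block H"
  shows "M 0 \<noteq> 0" "trace (M 0) = 0" "det (M 0) = 0"
proof -
  obtain e N where "pole_part_matrix H e N" "trace N = 0"
    using assms(1) unfolding trace_free_def by blast
  then show tr: "trace (M 0) = 0"
    using similar_matrix_invariants(1)[OF pole_part_matrixD] by metis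
  obtain e' l where J: "pole_part_matrix H e' (vector [vector [l, 1], vector [0, l]])"
    using assms(2) unfolding single_jordan_block_def by blast
  let ?J = "vector [vector [l, 1], vector [0, l]] :: complex^2^2"
  have "trace ?J = 0"
    using similar_matrix_invariants(1)[OF pole_part_matrixD[OF J]] tr by simp
  then have "l = 0" by (simp add: trace_2)
  then have "det ?J = 0" by (simp add: det_2)
  moreover have "?J \<noteq> 0"
  proof
    assume "?J = 0"
    from arg_cong[OF this, of "\<lambda>P. P $ 1 $ 2"] show False by simp
  qed
  ultimately show "det (M 0) = 0" "M 0 \<noteq> 0"
    using similar_matrix_invariants(2,3)[OF pole_part_matrixD[OF J]] by auto
qed

end



section \<open>Normalised charts\<close>

lemma vec_deriv_mult:
  fixes Q :: "complex^2^2"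
  assumes "\<And>i. (\<lambda>w. f w $ i) field_differentiable at z"
  shows "vec_deriv (\<lambda>w. Q *v f w) z = Q *v vec_deriv f z"
  using assms by (simp add: vec_deriv_def vec_eq_iff matrix_vector_mult_2
      field_differentiable_mult field_differentiable_const)

text \<open>
  The coordinate sections of a chart around 0 are holomorphic at 0, so \<open>z\<^sup>2\<close> times their
  derivatives extend over 0; these extensions are the columns of \<open>M\<close>.
\<close>

lemma TE_structure_chart:
  assumes TE: "TE_structure H"
  obtains U \<phi> M where "(U, \<phi>) \<in> charts H" "te_chart H U \<phi> M"
proof -
  have H: "holomorphic_bundle H" and C: "connection_off_0 H"
    and ext: "\<And>U s. hol_section H U s \<Longrightarrow>
      \<exists>t. hol_section H U t \<and> (\<forall>z\<in>U - {0}. t z = fscale H (z\<^sup>2) (conn H s z))"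
    using TE unfolding TE_structure_def by auto
  have "(\<Union>(U, \<phi>)\<in>charts H. U) = UNIV"
    using H unfolding holomorphic_bundle_def by (elim conjE)
  then have "0 \<in> (\<Union>(U, \<phi>)\<in>charts H. U)"
    by (simp only: UNIV_I)
  then obtain p where p: "p \<in> charts H" "0 \<in> (case p of (U, \<phi>) \<Rightarrow> U)"
    by (rule UN_E) (rule that)
  obtain U \<phi> where p': "p = (U, \<phi>)" by (cases p)
  have U: "(U, \<phi>) \<in> charts H" "0 \<in> U" using p p' by auto
  interpret bundle_chart H U \<phi> by (rule bundle_chart_of_charts[OF H U(1)])
  interpret pointed_chart H U \<phi> by unfold_locales (rule U(2))
  obtain A where A: "conn_chart H U \<phi> A" using conn_chart_exists[OF C] by blast
  interpret c: conn_chart H U \<phi> A by (rule A)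
  define e where "e j z = pt z (axis j 1)" for j :: 2 and z
  have e_sec: "hol_section H U (e j)" for j
    unfolding e_def by (rule hol_section_pt[OF open_U]) auto
  have "\<exists>t. hol_section H U t \<and> (\<forall>z\<in>U - {0}. t z = fscale H (z\<^sup>2) (conn H (e j) z))" for j
    by (rule ext[OF e_sec])
  then obtain t where t: "\<And>j. hol_section H U (t j)"
    "\<And>j z. z \<in> U - {0} \<Longrightarrow> t j z = fscale H (z\<^sup>2) (conn H (e j) z)"
    by metis
  define M where "M z = frame_matrix \<phi> (\<lambda>j. t j z)" for z
  have M_eq: "M z $ i $ j = z\<^sup>2 * A z $ i $ j" if z: "z \<in> U" "z \<noteq> 0" for z i j
  proof -
    have "vec_deriv (\<lambda>w. \<phi> (e j w)) z = vec_deriv (\<lambda>w. axis j 1) z"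
      using eventually_nhds_in_open[OF open_U z(1)]
      by (intro vec_deriv_cong) (auto elim!: eventually_mono simp: chart_pt e_def)
    also have "\<dots> = 0" by (simp add: vec_deriv_def vec_eq_iff)
    finally have vd: "vec_deriv (\<lambda>w. \<phi> (e j w)) z = 0" .
    have ee: "\<phi> (e j z) = axis j 1" using z by (simp add: e_def chart_pt)
    note c = c.conn_section[OF e_sec z(1,1,2), of j, unfolded vd ee]
    have "\<phi> (t j z) = z\<^sup>2 *s (A z *v axis j 1)"
      using c z t(2)[of z j] by (simp add: chart_fscale)
    then show ?thesis
      using exhaust_2[of j] by (auto simp: M_def frame_matrix_def matrix_vector_mult_2 axis_def)
  qed
  have "te_chart H U \<phi> M"
  proof (intro te_chart.intro te_chart_axioms.intro)
    show "pointed_chart H U \<phi>" by unfold_locales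
    show "(\<lambda>z. M z $ i $ j) holomorphic_on U" for i j
      using t(1)[of j] unfolding hol_section_iff[OF subset_refl] by (simp add: M_def frame_matrix_def)
    then have M_hol: "(\<lambda>z. M z $ i $ j / z\<^sup>2) holomorphic_on U - {0}" for i j
      by (auto intro!: holomorphic_intros intro: holomorphic_on_subset)
    show "conn_chart H U \<phi> (\<lambda>z. \<chi> i j. M z $ i $ j / z\<^sup>2)"
    proof
      show "(\<lambda>z. (\<chi> i j. M z $ i $ j / z\<^sup>2) $ i $ j) holomorphic_on U - {0}" for i j
        using M_hol[of i j] by simp
      fix W s z assume *: "hol_section H W s" "z \<in> W" "z \<in> U" "z \<noteq> 0"
      have "(\<chi> i j. M z $ i $ j / z\<^sup>2) = A z"
        using *(3,4) by (simp add: vec_eq_iff M_eq)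
      then show "conn H s z \<in> Tot H \<and> pr H (conn H s z) = z \<and>
          \<phi> (conn H s z) = vec_deriv (\<lambda>w. \<phi> (s w)) z + (\<chi> i j. M z $ i $ j / z\<^sup>2) *v \<phi> (s z)"
        using c.conn_section[OF *] by simp
    qed
  qed
  then show ?thesis
    using that U(1) by blast
qed

lemma (in te_chart) te_chart_linear_change:
  assumes E: "invertible E"
  shows "te_chart H U (\<lambda>e. matrix_inv E *v \<phi> e) (\<lambda>z. matrix_inv E ** M z ** E)"
proof -
  let ?Q = "matrix_inv E" and ?\<psi> = "\<lambda>e. matrix_inv E *v \<phi> e"
  have QE: "?Q ** E = mat 1" "E ** ?Q = mat 1"
    using invertible_matrix_inv[OF E] by auto
  then have "invertible ?Q" unfolding invertible_def by blast
  then interpret \<psi>: bundle_chart H U ?\<psi> by (rule bundle_chart_linear_change)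
  interpret c: conn_chart H U \<phi> "\<lambda>z. \<chi> i j. M z $ i $ j / z\<^sup>2" by (rule conn_chart)
  show ?thesis
  proof (intro te_chart.intro te_chart_axioms.intro)
    show "pointed_chart H U ?\<psi>" by unfold_locales (rule zero_in_U)
    show hol: "(\<lambda>z. (?Q ** M z ** E) $ i $ j) holomorphic_on U" for i j
      unfolding matrix_mult_2 by (intro holomorphic_intros M_hol)
    show "conn_chart H U ?\<psi> (\<lambda>z. \<chi> i j. (?Q ** M z ** E) $ i $ j / z\<^sup>2)"
    proof
      show "(\<lambda>z. (\<chi> i j. (?Q ** M z ** E) $ i $ j / z\<^sup>2) $ i $ j) holomorphic_on U - {0}" for i j
        using hol[of i j] by (auto intro!: holomorphic_intros intro: holomorphic_on_subset)
      fix W s z assume *: "hol_section H W s" "z \<in> W" "z \<in> U" "z \<noteq> 0"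
      have "hol_section H (W \<inter> U) s"
        by (rule hol_section_subset[OF *(1)]) (use hol_section_open[OF *(1)] open_U in auto)
      then have "(\<lambda>w. \<phi> (s w) $ i) field_differentiable at z" for i
        unfolding hol_section_iff[OF Int_lower2] using *(2,3)
        by (auto intro!: holomorphic_on_imp_differentiable_at[of _ "W \<inter> U"])
      then have vd: "vec_deriv (\<lambda>w. ?\<psi> (s w)) z = ?Q *v vec_deriv (\<lambda>w. \<phi> (s w)) z"
        by (rule vec_deriv_mult)
      have "?\<psi> (conn H s z) = ?Q *v (vec_deriv (\<lambda>w. \<phi> (s w)) z + (\<chi> i j. M z $ i $ j / z\<^sup>2) *v \<phi> (s z))"
        using c.conn_section[OF *] by simp
      also have "\<dots> = vec_deriv (\<lambda>w. ?\<psi> (s w)) z + ?Q *v ((\<chi> i j. M z $ i $ j / z\<^sup>2) *v \<phi> (s z))"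
        by (simp only: vd matrix_vector_right_distrib)
      also have "(\<chi> i j. M z $ i $ j / z\<^sup>2) *v \<phi> (s z) = (1 / z\<^sup>2) *s (M z *v \<phi> (s z))"
        by (simp add: vec2_eq_iff matrix_vector_mult_2 add_divide_distrib)
      also have "?Q *v ((1 / z\<^sup>2) *s (M z *v \<phi> (s z))) = (1 / z\<^sup>2) *s (?Q *v (M z *v \<phi> (s z)))"
        by (rule vector_scalar_commute)
      also have "?Q *v (M z *v \<phi> (s z)) = (?Q ** M z ** E) *v ?\<psi> (s z)"
        by (simp add: matrix_vector_mul_assoc matrix_mul_assoc[symmetric] QE)
      also have "(1 / z\<^sup>2) *s ((?Q ** M z ** E) *v ?\<psi> (s z)) =
          (\<chi> i j. (?Q ** M z ** E) $ i $ j / z\<^sup>2) *v ?\<psi> (s z)"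
        unfolding vec2_eq_iff vector_smult_component matrix_vector_mult_2[of "?Q ** M z ** E"]
          matrix_vector_mult_2[of "\<chi> i j. (?Q ** M z ** E) $ i $ j / z\<^sup>2"] vec_lambda_beta
        by (simp only: times_divide_eq_left mult_1 add_divide_distrib)
      finally show "conn H s z \<in> Tot H \<and> pr H (conn H s z) = z \<and>
          ?\<psi> (conn H s z) = vec_deriv (\<lambda>w. ?\<psi> (s w)) z +
            (\<chi> i j. (?Q ** M z ** E) $ i $ j / z\<^sup>2) *v ?\<psi> (s z)"
        using c.conn_section[OF *] by simp
    qed
  qed
qed

text \<open>
  The normalisation leaves the atlas, so the pulled back trivialisation is not among the charts that
  define the pullback; its compatibility with them is therefore recorded.
\<close>

locale normalised_te_chart = te_chart +
  assumes M_0: "M 0 = vector [vector [0, 1], vector [0, 0]]"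
    and pullback_chart: "bundle_chart (pullback4 H) ((\<lambda>x. x ^ 4) -` U) (\<lambda>p. \<phi> (snd p))"

lemma normalised_te_chart_exists:
  assumes TE: "TE_structure H"
    and nilp: "\<And>U \<phi> M. te_chart H U \<phi> M \<Longrightarrow> M 0 \<noteq> 0 \<and> trace (M 0) = 0 \<and> det (M 0) = 0"
  obtains U \<phi> M where "normalised_te_chart H U \<phi> M"
proof -
  obtain U \<phi> M where U: "(U, \<phi>) \<in> charts H" and te: "te_chart H U \<phi> M"
    using TE_structure_chart[OF TE] .
  interpret te_chart H U \<phi> M by (rule te)
  obtain E :: "complex^2^2" where E: "invertible E" "M 0 ** E = E ** vector [vector [0, 1], vector [0, 0]]"
    using nilpotent_normal_form nilp[OF te] by metis
  have "invertible (matrix_inv E)"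
    unfolding invertible_def using invertible_matrix_inv[OF E(1)] by blast
  then have K: "bundle_chart (pullback4 H) ((\<lambda>x. x ^ 4) -` U) (\<lambda>p. matrix_inv E *v \<phi> (snd p))"
    by (rule bundle_chart.bundle_chart_linear_change[OF bundle_chart_pullback4[OF hol_bundle U]])
  have "matrix_inv E ** M 0 ** E = vector [vector [0, 1], vector [0, 0]]"
    by (simp only: matrix_mul_assoc[symmetric] E(2)) (simp add: matrix_mul_assoc invertible_matrix_inv[OF E(1)])
  then have "normalised_te_chart H U (\<lambda>e. matrix_inv E *v \<phi> e) (\<lambda>z. matrix_inv E ** M z ** E)"
    using te_chart_linear_change[OF E(1)] K
    unfolding normalised_te_chart_def normalised_te_chart_axioms_def by simp
  then show ?thesis by (rule that)
qed

context normalised_te_chart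
begin

lemma M_0_entries: "M 0 $ 1 $ 1 = 0" "M 0 $ 1 $ 2 = 1" "M 0 $ 2 $ 1 = 0" "M 0 $ 2 $ 2 = 0"
  by (simp_all add: M_0)

text \<open>
  All entries of \<open>M(0)\<close> except the upper right one vanish, so in first order the determinant is
  minus the lower left entry.
\<close>

lemma delta_1: "delta H 1 = - deriv (\<lambda>z. M z $ 2 $ 1) 0"
proof -
  have 0: "fps_nth (fps_matrix M $ i $ j) 0 = M 0 $ i $ j" for i j
    by (rule fps_nth_fps_matrix_0[OF M_analytic])
  have "fps_nth (fps_matrix M $ 2 $ 1) 1 = deriv (\<lambda>z. M z $ 2 $ 1) 0"
    by (simp add: fps_matrix_def fps_expansion_def)
  then show ?thesis
    by (simp add: delta_eq det_2 fps_mult_nth_1 0 M_0_entries)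
qed

lemma rho_0: "rho H 0 = 0"
  using fps_nth_fps_matrix_0[OF M_analytic] by (simp add: rho_eq trace_2 M_0_entries)

end



section \<open>Regular singularity\<close>

text \<open>
  Slit discs are the images of strips under the exponential function.
\<close>

lemma rcis_exp: "m > 0 \<Longrightarrow> rcis m t = exp (Complex (ln m) t)"
  by (simp add: rcis_def exp_eq_polar cis_conv_exp[symmetric])

lemma exp_in_slit_disc:
  assumes "Re \<zeta> < ln r" "\<bar>Im \<zeta> - a\<bar> < pi" "r > 0"
  shows "exp \<zeta> \<in> slit_disc r a"
proof -
  have "exp \<zeta> = rcis (exp (Re \<zeta>)) (Im \<zeta>)"
    by (simp add: rcis_def exp_eq_polar)
  moreover have "exp (Re \<zeta>) < r"
    using assms(1,3) by (metis exp_less_cancel_iff exp_ln)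
  ultimately show ?thesis
    unfolding slit_disc_def using assms(2) by fastforce
qed

lemma slit_disc_exp:
  assumes "z \<in> slit_disc r a"
  obtains \<zeta> where "z = exp \<zeta>" "Re \<zeta> = ln (norm z)" "norm z < r" "\<bar>Im \<zeta> - a\<bar> < pi" "z \<noteq> 0"
proof -
  obtain m t where m: "z = rcis m t" "0 < m" "m < r" "\<bar>t - a\<bar> < pi"
    using assms unfolding slit_disc_def by blast
  show ?thesis
    by (rule that[of "Complex (ln m) t"]) (use m in \<open>auto simp: rcis_exp\<close>)
qed

lemma slit_disc_0_Ln:
  assumes "z \<in> slit_disc r 0"
  shows "Ln z \<in> half_strip (ln r) pi" "z \<notin> \<real>\<^sub>\<le>\<^sub>0" "exp (Ln z) = z" "norm z < r"
proof -
  obtain \<zeta> where \<zeta>: "z = exp \<zeta>" "Re \<zeta> = ln (norm z)" "norm z < r" "\<bar>Im \<zeta> - 0\<bar> < pi" "z \<noteq> 0"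
    using slit_disc_exp[OF assms] .
  have Ln: "Ln z = \<zeta>"
    using \<zeta>(1,4) by (simp add: Ln_exp)
  have "0 < norm z" using \<zeta>(5) by simp
  moreover from this have "0 < r" using \<zeta>(3) by linarith
  ultimately have "ln (norm z) < ln r" using \<zeta>(3) by (rule ln_less_cancel_iff[THEN iffD2])
  then show "Ln z \<in> half_strip (ln r) pi"
    using \<zeta>(2,4) by (simp add: Ln half_strip_def)
  show "z \<notin> \<real>\<^sub>\<le>\<^sub>0"
  proof
    assume "z \<in> \<real>\<^sub>\<le>\<^sub>0"
    then have "Re z < 0" "Im z = 0"
      using \<zeta>(5) by (auto simp: complex_nonpos_Reals_iff complex_eq_iff)
    then have "Im (Ln z) = pi" using \<zeta>(5) by (simp add: Im_Ln_eq_pi)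
    then show False using \<zeta>(4) by (simp add: Ln)
  qed
  show "exp (Ln z) = z" using \<zeta>(5) by simp
  show "norm z < r" by (rule \<zeta>(3))
qed



text \<open>
  The holomorphic function \<open>f(z) / z\<close>, with the removable singularity filled in, for \<open>f\<close> with \<open>f(0) = 0\<close>.
\<close>

definition zero_quotient :: "(complex \<Rightarrow> complex) \<Rightarrow> complex \<Rightarrow> complex" where
  "zero_quotient f z = (if z = 0 then deriv f 0 else f z / z)"

lemma zero_quotient:
  assumes f: "f holomorphic_on U" "open U" "0 \<in> U" and f0: "f 0 = 0"
  shows "zero_quotient f holomorphic_on U" "z * zero_quotient f z = f z"
proof -
  have "zero_quotient f = (\<lambda>z. if z = 0 then deriv f 0 else (f z - f 0) / (z - 0))"
    by (auto simp: zero_quotient_def f0)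
  moreover have "(\<lambda>z. if z = 0 then deriv f 0 else (f z - f 0) / (z - 0)) holomorphic_on U"
    by (rule pole_lemma[OF f(1)]) (use f(2,3) in \<open>simp add: interior_open\<close>)
  ultimately show "zero_quotient f holomorphic_on U" by simp
  show "z * zero_quotient f z = f z"
    by (simp add: zero_quotient_def f0)
qed

lemma isCont_eventually_bounded:
  fixes f :: "complex \<Rightarrow> complex"
  assumes "isCont f 0"
  shows "\<forall>\<^sub>F z in nhds 0. norm (f z) \<le> norm (f 0) + 1"
proof -
  have "((\<lambda>z. norm (f z)) \<longlongrightarrow> norm (f 0)) (nhds 0)"
    using assms by (intro tendsto_norm) (simp add: isCont_def tendsto_at_iff_tendsto_nhds)
  from order_tendstoD(2)[OF this, of "norm (f 0) + 1"]
  show ?thesis by (auto elim: eventually_mono)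
qed

lemma norm_vec2_le: "norm (x :: complex^2) \<le> norm (x $ 1) + norm (x $ 2)"
  using L2_set_le_sum[of UNIV "\<lambda>i. norm (x $ i)"] by (simp add: norm_vec_def sum_2)

context normalised_te_chart
begin

text \<open>
  The entries of \<open>M\<close> divided by \<open>z\<close>, except for the upper right one, which does not vanish at 0.
\<close>

definition "b11 = zero_quotient (\<lambda>z. M z $ 1 $ 1)"
definition "b21 = zero_quotient (\<lambda>z. M z $ 2 $ 1)"
definition "b22 = zero_quotient (\<lambda>z. M z $ 2 $ 2)"
definition "b12 z = M z $ 1 $ 2"

lemma b_hol: "b11 holomorphic_on U" "b12 holomorphic_on U" "b21 holomorphic_on U" "b22 holomorphic_on U"
  unfolding b11_def b12_def b21_def b22_def using M_hol
  by (auto intro!: zero_quotient(1)[OF M_hol open_U zero_in_U] simp: M_0_entries)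

lemma M_entries: "M z $ 1 $ 1 = z * b11 z" "M z $ 1 $ 2 = b12 z" "M z $ 2 $ 1 = z * b21 z" "M z $ 2 $ 2 = z * b22 z"
  unfolding b11_def b12_def b21_def b22_def
  by (simp_all add: zero_quotient(2)[OF M_hol open_U zero_in_U] M_0_entries)

lemma b12_0: "b12 0 = 1"
  by (simp add: b12_def M_0_entries)

lemma b21_0: "b21 0 = - delta H 1"
  unfolding delta_1 by (simp add: b21_def zero_quotient_def)

lemma bounded_near_0:
  assumes "f holomorphic_on U"
  shows "\<exists>k. \<forall>\<^sub>F z in nhds 0. norm (f z) \<le> k"
proof -
  have "isCont f 0"
    using holomorphic_on_imp_continuous_on[OF assms] open_U zero_in_U
    by (simp add: continuous_on_eq_continuous_at)
  then show ?thesis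
    using isCont_eventually_bounded by blast
qed

lemma nonzero_near_0:
  assumes "f holomorphic_on U" "f 0 \<noteq> 0"
  shows "\<exists>k. \<forall>\<^sub>F z in nhds 0. f z \<noteq> 0 \<and> norm (inverse (f z)) \<le> k"
proof -
  have c: "isCont f 0"
    using holomorphic_on_imp_continuous_on[OF assms(1)] open_U zero_in_U
    by (simp add: continuous_on_eq_continuous_at)
  then have "isCont (\<lambda>z. inverse (f z)) 0"
    by (intro continuous_intros assms(2))
  from isCont_eventually_bounded[OF this]
  have "\<forall>\<^sub>F z in nhds 0. norm (inverse (f z)) \<le> norm (inverse (f 0)) + 1" .
  moreover have "\<forall>\<^sub>F z in nhds 0. f z \<noteq> 0"
    using c assms(2) by (intro tendsto_imp_eventually_ne[of _ "f 0"]) (simp_all add: isCont_def tendsto_at_iff_tendsto_nhds)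
  ultimately show ?thesis
    by (auto intro: eventually_conj)
qed

lemma vec_deriv_eqI:
  "(\<And>i. ((\<lambda>w. f w $ i) has_field_derivative d $ i) (at z)) \<Longrightarrow> vec_deriv f z = d"
  by (simp add: vec_deriv_def vec_eq_iff DERIV_imp_deriv)

lemma flat_iff:
  assumes "hol_section H W s" "z \<in> W" "z \<in> U" "z \<noteq> 0"
  shows "conn H s z = fscale H 0 (s z) \<longleftrightarrow> z\<^sup>2 *s vec_deriv (\<lambda>w. \<phi> (s w)) z = - (M z *v \<phi> (s z))"
proof -
  note c = pole_conn[OF assms]
  have s: "s z \<in> Tot H" "pr H (s z) = z"
    using hol_section_Tot[OF assms(1,2)] hol_section_pr[OF assms(1,2)] by auto
  have "conn H s z = fscale H 0 (s z) \<longleftrightarrow> \<phi> (conn H s z) = 0"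
    using chart_inj[OF c(1) Tot_fscale[OF s(1)] c(2) _ assms(3), of 0] s assms(3)
    by (auto simp: pr_fscale chart_fscale)
  also have "\<dots> \<longleftrightarrow> \<phi> (fscale H (z\<^sup>2) (conn H s z)) = 0"
    using c(1,2) assms(3,4) by (simp add: chart_fscale)
  also have "\<dots> \<longleftrightarrow> z\<^sup>2 *s vec_deriv (\<lambda>w. \<phi> (s w)) z = - (M z *v \<phi> (s z))"
    unfolding c(3) by (simp add: add_eq_0_iff2)
  finally show ?thesis .
qed

text \<open>
  A flat frame on a slit disc is obtained from a solution of the system on a half strip. Moderate
  growth of the two coordinate sections means moderate growth of the inverse of its matrix; as the
  determinant also has moderate growth, so does the matrix itself, by Cramer's rule. This
  contradicts the decay of the determinant of a moderate frame.
\<close>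

lemma type_Bra_not_regular:
  assumes \<delta>: "delta H 1 \<noteq> 0" and reg: "regular_singular H"
  shows False
proof -
  obtain k1 k2 k3 k4 where k:
    "\<forall>\<^sub>F z in nhds 0. norm (b11 z) \<le> k1" "\<forall>\<^sub>F z in nhds 0. norm (b22 z) \<le> k2"
    "\<forall>\<^sub>F z in nhds 0. b12 z \<noteq> 0 \<and> norm (inverse (b12 z)) \<le> k3"
    "\<forall>\<^sub>F z in nhds 0. b21 z \<noteq> 0 \<and> norm (inverse (b21 z)) \<le> k4"
    using bounded_near_0[OF b_hol(1)] bounded_near_0[OF b_hol(4)]
      nonzero_near_0[OF b_hol(2)] nonzero_near_0[OF b_hol(3)] \<delta> b12_0 b21_0 by auto
  define k where "k = max (max k1 k2) (max k3 k4)"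
  have "\<forall>\<^sub>F z in nhds 0. z \<in> U \<and> norm (b11 z) \<le> k \<and> norm (b22 z) \<le> k \<and>
      norm (inverse (b12 z)) \<le> k \<and> norm (inverse (b21 z)) \<le> k \<and> b12 z \<noteq> 0 \<and> b21 z \<noteq> 0"
    using k eventually_nhds_in_open[OF open_U zero_in_U] by eventually_elim (auto simp: k_def)
  then obtain r where r: "r > 0" and ball: "\<And>z. norm z < r \<Longrightarrow> z \<in> U \<and> norm (b11 z) \<le> k \<and> norm (b22 z) \<le> k \<and>
      norm (inverse (b12 z)) \<le> k \<and> norm (inverse (b21 z)) \<le> k \<and> b12 z \<noteq> 0 \<and> b21 z \<noteq> 0"
    unfolding eventually_nhds_metric by auto
  define S where "S = half_strip (ln r) pi"
  have S: "open S" "convex S" by (simp_all add: S_def open_half_strip convex_half_strip)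
  have expS: "norm (exp \<zeta>) < r" if "\<zeta> \<in> S" for \<zeta>
    using that r by (auto simp: S_def half_strip_def) (metis exp_less_cancel_iff exp_ln)
  define \<zeta>0 where "\<zeta>0 = complex_of_real (ln r - 1)"
  have \<zeta>0: "\<zeta>0 \<in> S" by (simp add: \<zeta>0_def S_def half_strip_def)
  \<comment> \<open>\<open>f' = - M f / z\<^sup>2\<close> in the coordinate \<open>\<zeta>\<close>, where \<open>d/d\<zeta> = z d/dz\<close>\<close>
  define a :: "complex \<Rightarrow> complex^2^2" where
    "a \<zeta> = (\<chi> i j. if i = 1 then (if j = 1 then - b11 (exp \<zeta>) else - (exp (- \<zeta>) * b12 (exp \<zeta>)))
                    else (if j = 1 then - b21 (exp \<zeta>) else - b22 (exp \<zeta>)))" for \<zeta>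
  have comp: "(\<lambda>\<zeta>. f (exp \<zeta>)) holomorphic_on S" if "f holomorphic_on U" for f
  proof -
    have "exp ` S \<subseteq> U" using ball[OF expS] by blast
    from holomorphic_on_compose_gen[OF holomorphic_on_exp that this] show ?thesis by (simp add: o_def)
  qed
  have a_hol: "(\<lambda>\<zeta>. a \<zeta> $ i $ j) holomorphic_on S" for i j
    using exhaust_2[of i] exhaust_2[of j] by (auto simp: a_def intro!: holomorphic_intros comp b_hol)
  have "\<exists>f :: complex \<Rightarrow> complex^2. f \<zeta>0 = axis j 1 \<and>
      (\<forall>\<zeta>\<in>S. \<forall>i. ((\<lambda>w. f w $ i) has_field_derivative (a \<zeta> *v f \<zeta>) $ i) (at \<zeta>))" for j :: 2
  proof -
    obtain f :: "complex \<Rightarrow> complex^2" where "f \<zeta>0 = axis j 1"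
      "\<And>z i. z \<in> S \<Longrightarrow> ((\<lambda>w. f w $ i) has_field_derivative (a z *v f z) $ i) (at z)"
      using linear_ode_solution[OF S \<zeta>0 a_hol, of "axis j 1"] by blast
    then show ?thesis by blast
  qed
  then obtain F :: "2 \<Rightarrow> complex \<Rightarrow> complex^2" where F0: "\<And>j. F j \<zeta>0 = axis j 1"
    and FD: "\<And>j \<zeta> i. \<zeta> \<in> S \<Longrightarrow> ((\<lambda>w. F j w $ i) has_field_derivative (a \<zeta> *v F j \<zeta>) $ i) (at \<zeta>)"
    by metis
  let ?D = "\<lambda>\<zeta>. F 1 \<zeta> $ 1 * F 2 \<zeta> $ 2 - F 2 \<zeta> $ 1 * F 1 \<zeta> $ 2"
  have D0: "?D \<zeta>0 = 1" by (simp add: F0 axis_def)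
  have FD1: "((\<lambda>w. F j w $ 1) has_field_derivative - b11 (exp \<zeta>) * F j \<zeta> $ 1 + - (exp (- \<zeta>) * b12 (exp \<zeta>)) * F j \<zeta> $ 2) (at \<zeta>)"
    and FD2: "((\<lambda>w. F j w $ 2) has_field_derivative - b21 (exp \<zeta>) * F j \<zeta> $ 1 + - b22 (exp \<zeta>) * F j \<zeta> $ 2) (at \<zeta>)"
    if "\<zeta> \<in> S" for j \<zeta>
    using FD[OF that, of j 1] FD[OF that, of j 2] by (simp_all add: matrix_vector_mult_2 a_def)
  have tr: "norm (- b11 (exp \<zeta>) + - b22 (exp \<zeta>)) \<le> 2 * k" if "\<zeta> \<in> S" for \<zeta>
    using norm_triangle_ineq[of "- b11 (exp \<zeta>)" "- b22 (exp \<zeta>)"] ball[OF expS[OF that]] by simp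
  have D_upper: "norm (?D \<zeta>) \<le> exp (2 * k * norm (\<zeta> - \<zeta>0))" if "\<zeta> \<in> S" for \<zeta>
    using determinant_growth_bound[OF S(2) \<zeta>0 that FD1 FD2 FD1 FD2 tr, of 1 2] by (simp add: D0)
  have D_lower: "?D \<zeta> \<noteq> 0" if "\<zeta> \<in> S" for \<zeta>
    using determinant_growth_bound[OF S(2) that \<zeta>0 FD1 FD2 FD1 FD2 tr, of 1 2]
    by (auto simp: D0)
  define A where "A j z = pt z (F j (Ln z))" for j z
  let ?T = "slit_disc r 0"
  have T: "Ln z \<in> S" "z \<notin> \<real>\<^sub>\<le>\<^sub>0" "exp (Ln z) = z" "z \<in> U" "z \<noteq> 0" if "z \<in> ?T" for z :: complex
    using slit_disc_0_Ln[OF that] ball[of z] by (auto simp: S_def)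
  have "slit_disc r 0 = ball (0::complex) r - \<real>\<^sub>\<le>\<^sub>0"
  proof (intro equalityI subsetI)
    fix z :: complex assume z: "z \<in> ball 0 r - \<real>\<^sub>\<le>\<^sub>0"
    then have "z \<noteq> 0" by auto
    then have "z = exp (Ln z)" by simp
    moreover have "\<bar>Im (Ln z) - 0\<bar> < pi"
      using z Im_Ln_less_pi[of z] mpi_less_Im_Ln[OF \<open>z \<noteq> 0\<close>] by auto
    moreover have "Re (Ln z) < ln r"
      using z \<open>z \<noteq> 0\<close> r by simp
    ultimately show "z \<in> ?T"
      using exp_in_slit_disc[of "Ln z" r 0] r by simp
  qed (use slit_disc_0_Ln in auto)
  then have T_open: "open ?T"
    by (simp add: open_Diff)
  have FL: "((\<lambda>z::complex. F j (Ln z) $ i) has_field_derivative (a (Ln z) *v F j (Ln z)) $ i * inverse z) (at z)"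
    if "z \<in> ?T" for j i z
    by (rule DERIV_chain2[OF FD[OF T(1)[OF that]] has_field_derivative_Ln[OF T(2)[OF that]]])
  have A_sec: "hol_section H ?T (A j)" for j
    unfolding A_def using FL T T_open
    by (intro hol_section_pt) (auto simp: holomorphic_on_open)
  have \<phi>A: "\<phi> (A j z) = F j (Ln z)" if "z \<in> ?T" for j z
    using T(4)[OF that] by (simp add: A_def chart_pt)
  have flat: "conn H (A j) z = fscale H 0 (A j z)" if z: "z \<in> ?T" for j z
    unfolding flat_iff[OF A_sec z T(4,5)[OF z]]
  proof -
    have "vec_deriv (\<lambda>w. \<phi> (A j w)) z = vec_deriv (\<lambda>w. F j (Ln w)) z"
      using eventually_nhds_in_open[OF T_open z] by (intro vec_deriv_cong) (auto elim!: eventually_mono simp: \<phi>A)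
    also have "\<dots> = inverse z *s (a (Ln z) *v F j (Ln z))"
      using FL[OF z] by (intro vec_deriv_eqI) (simp add: mult.commute)
    finally have d: "vec_deriv (\<lambda>w. \<phi> (A j w)) z = inverse z *s (a (Ln z) *v F j (Ln z))" .
    show "z\<^sup>2 *s vec_deriv (\<lambda>w. \<phi> (A j w)) z = - (M z *v \<phi> (A j z))"
      unfolding d \<phi>A[OF z] using T(3,5)[OF z]
      by (simp add: vec2_eq_iff matrix_vector_mult_2 a_def M_entries exp_minus power2_eq_square field_simps)
  qed
  have A_basis: "fibre_basis H z (\<lambda>i. A i z)" if z: "z \<in> ?T" for z
  proof -
    have "det (frame_matrix \<phi> (\<lambda>i. A i z)) \<noteq> 0"
      using D_lower[OF T(1)[OF z]] by (simp add: det_2 frame_matrix_def \<phi>A[OF z] mult_ac)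
    then show ?thesis
      unfolding fibre_basis_iff[OF T(4)[OF z]] using T(4)[OF z]
      by (auto simp: invertible_det_nz A_def Tot_pt pr_pt)
  qed
  have frame: "flat_frame H ?T A"
    unfolding flat_frame_def using A_sec flat A_basis by blast
  have "moderate_growth H (\<lambda>z. pt z (axis j 1))" for j
    using reg germ_section_pt[of "\<lambda>_. axis j 1"] unfolding regular_singular_def by simp
  then have "\<exists>C N \<epsilon>. 0 < \<epsilon> \<and> (\<forall>z\<in>?T. norm z < \<epsilon> \<longrightarrow>
      (\<forall>c. pt z (axis j 1) = lincomb H c (\<lambda>i. A i z) \<longrightarrow> norm c \<le> C * inverse (norm z ^ N)))" for j
    unfolding moderate_growth_def using r frame by meson
  then obtain C N \<epsilon> where \<epsilon>: "\<And>j. 0 < \<epsilon> j" and growth: "\<And>j z c. z \<in> ?T \<Longrightarrow> norm z < \<epsilon> j \<Longrightarrow>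
      pt z (axis j 1) = lincomb H c (\<lambda>i. A i z) \<Longrightarrow> norm c \<le> C j * inverse (norm z ^ N j)"
    by metis
  have coeff: "norm c \<le> C j * inverse (norm (exp \<zeta>) ^ N j)"
    if \<zeta>: "\<zeta> \<in> S" "norm (exp \<zeta>) < \<epsilon> j" and c: "axis j 1 = c $ 1 *s F 1 \<zeta> + c $ 2 *s F 2 \<zeta>"
    for \<zeta> j and c :: "complex^2"
  proof -
    have z: "exp \<zeta> \<in> ?T"
      using \<zeta>(1) r by (intro exp_in_slit_disc) (auto simp: S_def half_strip_def)
    have "Ln (exp \<zeta>) = \<zeta>"
      using \<zeta>(1) by (intro Ln_exp) (auto simp: S_def half_strip_def)
    then have "\<phi> (lincomb H c (\<lambda>i. A i (exp \<zeta>))) = axis j 1"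
      using chart_lincomb[OF T(4)[OF z], of "\<lambda>i. A i (exp \<zeta>)" c] T(4)[OF z]
      unfolding c by (simp add: A_def Tot_pt pr_pt chart_pt frame_matrix_def vec2_eq_iff matrix_vector_mult_2 mult.commute)
    then have "pt (exp \<zeta>) (axis j 1) = lincomb H c (\<lambda>i. A i (exp \<zeta>))"
      using T(4)[OF z] by (intro chart_inj[of _ _ "exp \<zeta>"] Tot_lincomb pr_lincomb)
        (auto simp: A_def Tot_pt pr_pt chart_pt)
    then show ?thesis
      by (rule growth[OF z \<zeta>(2)])
  qed
  define x where "x = min (min 0 (ln r)) (min (ln (\<epsilon> 1)) (ln (\<epsilon> 2)))"
  have sub: "half_strip x pi \<subseteq> S"
    unfolding S_def by (rule half_strip_mono) (auto simp: x_def)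
  have small: "norm (exp \<zeta>) < \<epsilon> j" if "\<zeta> \<in> half_strip x pi" for \<zeta> j
  proof -
    have "Re \<zeta> < ln (\<epsilon> j)"
      using that exhaust_2[of j] by (auto simp: half_strip_def x_def)
    then show ?thesis using \<epsilon>[of j] by (simp, metis exp_less_cancel_iff exp_ln)
  qed
  have D_bdd: "exp_bounded_on (half_strip x pi) (- (2 * k)) ?D"
  proof -
    have k0: "0 \<le> k" using ball[of 0] r norm_ge_zero order_trans by (metis norm_zero)
    have "norm (?D \<zeta>) \<le> exp (2 * k * (\<bar>ln r - 1\<bar> + pi + \<bar>ln r\<bar> + \<bar>ln r\<bar>)) * exp (- (2 * k) * Re \<zeta>)" if "\<zeta> \<in> half_strip x pi" for \<zeta>
    proof -
      have \<zeta>: "\<zeta> \<in> S" using that sub by blast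
      have "norm (\<zeta> - \<zeta>0) \<le> \<bar>Re (\<zeta> - \<zeta>0)\<bar> + \<bar>Im (\<zeta> - \<zeta>0)\<bar>"
        by (rule cmod_le)
      also have "\<dots> \<le> (\<bar>ln r - 1\<bar> + pi + \<bar>ln r\<bar> + \<bar>ln r\<bar>) - Re \<zeta>"
        using \<zeta> by (auto simp: \<zeta>0_def S_def half_strip_def)
      finally have "2 * k * norm (\<zeta> - \<zeta>0) \<le> 2 * k * ((\<bar>ln r - 1\<bar> + pi + \<bar>ln r\<bar> + \<bar>ln r\<bar>) - Re \<zeta>)"
        using k0 by (intro mult_left_mono) auto
      then have "exp (2 * k * norm (\<zeta> - \<zeta>0)) \<le>
          exp (2 * k * (\<bar>ln r - 1\<bar> + pi + \<bar>ln r\<bar> + \<bar>ln r\<bar>)) * exp (- (2 * k) * Re \<zeta>)"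
        by (simp add: mult_exp_exp algebra_simps)
      with D_upper[OF \<zeta>] show ?thesis by linarith
    qed
    then show ?thesis unfolding exp_bounded_on_def by blast
  qed
  have F_bdd: "\<exists>N. exp_bounded_on (half_strip x pi) N (\<lambda>\<zeta>. F l \<zeta> $ i)" for l i
  proof -
    \<comment> \<open>the entries of the frame are, up to sign, the determinant times the entries of the inverse, and
      the columns \<open>c1\<close>, \<open>c2\<close> of the inverse are coefficients as in \<open>coeff\<close>\<close>
    have inv_bdd: "exp_bounded_on (half_strip x pi) (- real (N j)) (\<lambda>\<zeta>. c \<zeta> $ m)"
      if c: "\<And>\<zeta>. \<zeta> \<in> S \<Longrightarrow> axis j 1 = c \<zeta> $ 1 *s F 1 \<zeta> + c \<zeta> $ 2 *s F 2 \<zeta>" for c :: "complex \<Rightarrow> complex^2" and j m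
    proof -
      have "norm (c \<zeta> $ m) \<le> C j * exp (- real (N j) * Re \<zeta>)" if \<zeta>: "\<zeta> \<in> half_strip x pi" for \<zeta>
      proof -
        have "inverse (norm (exp \<zeta>) ^ N j) = exp (- real (N j) * Re \<zeta>)"
          by (simp add: exp_minus exp_of_nat_mult)
        then show ?thesis
          using coeff[OF _ small[OF \<zeta>] c] \<zeta> sub Finite_Cartesian_Product.norm_nth_le[of "c \<zeta>" m]
          by (metis order_trans subsetD)
      qed
      then show ?thesis unfolding exp_bounded_on_def by blast
    qed
    define c1 :: "complex \<Rightarrow> complex^2" where "c1 \<zeta> = vector [F 2 \<zeta> $ 2 / ?D \<zeta>, - F 1 \<zeta> $ 2 / ?D \<zeta>]" for \<zeta>
    define c2 :: "complex \<Rightarrow> complex^2" where "c2 \<zeta> = vector [- F 2 \<zeta> $ 1 / ?D \<zeta>, F 1 \<zeta> $ 1 / ?D \<zeta>]" for \<zeta>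
    have c1: "axis 1 1 = c1 \<zeta> $ 1 *s F 1 \<zeta> + c1 \<zeta> $ 2 *s F 2 \<zeta>" if "\<zeta> \<in> S" for \<zeta>
      using D_lower[OF that] by (simp add: c1_def vec2_eq_iff axis_def diff_divide_distrib[symmetric] mult_ac)
    have c2: "axis 2 1 = c2 \<zeta> $ 1 *s F 1 \<zeta> + c2 \<zeta> $ 2 *s F 2 \<zeta>" if "\<zeta> \<in> S" for \<zeta>
      using D_lower[OF that] by (simp add: c2_def vec2_eq_iff axis_def diff_divide_distrib[symmetric] mult_ac)
    have prod: "\<exists>N. exp_bounded_on (half_strip x pi) N G"
      if "exp_bounded_on (half_strip x pi) N' g" "\<And>\<zeta>. \<zeta> \<in> S \<Longrightarrow> ?D \<zeta> * g \<zeta> = G \<zeta> \<or> ?D \<zeta> * g \<zeta> = - G \<zeta>" for g G N'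
    proof -
      have "exp_bounded_on (half_strip x pi) (- (2 * k) + N') (\<lambda>\<zeta>. ?D \<zeta> * g \<zeta>)"
        by (rule exp_bounded_on_mult[OF D_bdd that(1)])
      moreover have "norm (?D \<zeta> * g \<zeta>) = norm (G \<zeta>)" if "\<zeta> \<in> S" for \<zeta>
        using \<open>\<And>\<zeta>. \<zeta> \<in> S \<Longrightarrow> ?D \<zeta> * g \<zeta> = G \<zeta> \<or> ?D \<zeta> * g \<zeta> = - G \<zeta>\<close>[OF that] by (metis norm_minus_cancel)
      ultimately show ?thesis
        unfolding exp_bounded_on_def using sub by (metis subsetD)
    qed
    have "\<exists>N. exp_bounded_on (half_strip x pi) N (\<lambda>\<zeta>. F 2 \<zeta> $ 2)"
      by (rule prod[OF inv_bdd[OF c1, of 1]]) (use D_lower in \<open>simp_all add: c1_def\<close>)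
    moreover have "\<exists>N. exp_bounded_on (half_strip x pi) N (\<lambda>\<zeta>. F 1 \<zeta> $ 2)"
      by (rule prod[OF inv_bdd[OF c1, of 2]]) (use D_lower in \<open>simp_all add: c1_def\<close>)
    moreover have "\<exists>N. exp_bounded_on (half_strip x pi) N (\<lambda>\<zeta>. F 2 \<zeta> $ 1)"
      by (rule prod[OF inv_bdd[OF c2, of 1]]) (use D_lower in \<open>simp_all add: c2_def\<close>)
    moreover have "\<exists>N. exp_bounded_on (half_strip x pi) N (\<lambda>\<zeta>. F 1 \<zeta> $ 1)"
      by (rule prod[OF inv_bdd[OF c2, of 2]]) (use D_lower in \<open>simp_all add: c2_def\<close>)
    ultimately show ?thesis
      using exhaust_2[of l] exhaust_2[of i] by auto
  qed
  then obtain N' where N': "\<And>l i. exp_bounded_on (half_strip x pi) (N' l i) (\<lambda>\<zeta>. F l \<zeta> $ i)"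
    by metis
  define L where "L = min (min (N' 1 1) (N' 1 2)) (min (N' 2 1) (N' 2 2))"
  have L: "exp_bounded_on (half_strip x pi) L (\<lambda>\<zeta>. F l \<zeta> $ i)" for l i
    by (rule exp_bounded_on_weaken[OF N'[of l i]])
      (use exhaust_2[of l] exhaust_2[of i] in \<open>auto simp: L_def half_strip_def x_def\<close>)
  have b: "norm (b11 (exp \<zeta>)) \<le> k" "norm (b22 (exp \<zeta>)) \<le> k" "norm (inverse (b12 (exp \<zeta>))) \<le> k"
    "norm (inverse (b21 (exp \<zeta>))) \<le> k" "b12 (exp \<zeta>) \<noteq> 0 \<and> b21 (exp \<zeta>) \<noteq> 0" if "\<zeta> \<in> half_strip x pi" for \<zeta>
    using ball[OF expS, of \<zeta>] that sub by auto
  define \<zeta>1 where "\<zeta>1 = complex_of_real (x - 1)"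
  have \<zeta>1: "\<zeta>1 \<in> half_strip x pi"
    by (simp add: \<zeta>1_def half_strip_def)
  show False
  proof (rule no_moderate_frame_at_irregular_point[of x pi "\<lambda>\<zeta>. F 1 \<zeta> $ 1" "\<lambda>\<zeta>. b11 (exp \<zeta>)" "\<lambda>\<zeta>. b12 (exp \<zeta>)"
        "\<lambda>\<zeta>. F 1 \<zeta> $ 2" "\<lambda>\<zeta>. b21 (exp \<zeta>)" "\<lambda>\<zeta>. b22 (exp \<zeta>)" "\<lambda>\<zeta>. F 2 \<zeta> $ 1" "\<lambda>\<zeta>. F 2 \<zeta> $ 2" k L \<zeta>1])
    fix \<zeta> assume "\<zeta> \<in> half_strip x pi"
    then have \<zeta>: "\<zeta> \<in> S" using sub by blast
    show "((\<lambda>\<zeta>. F 1 \<zeta> $ 1) has_field_derivative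
        - (b11 (exp \<zeta>) * F 1 \<zeta> $ 1 + exp (- \<zeta>) * b12 (exp \<zeta>) * F 1 \<zeta> $ 2)) (at \<zeta>)"
      "((\<lambda>\<zeta>. F 2 \<zeta> $ 1) has_field_derivative
        - (b11 (exp \<zeta>) * F 2 \<zeta> $ 1 + exp (- \<zeta>) * b12 (exp \<zeta>) * F 2 \<zeta> $ 2)) (at \<zeta>)"
      using FD1[OF \<zeta>, of 1] FD1[OF \<zeta>, of 2] by simp_all
    show "((\<lambda>\<zeta>. F 1 \<zeta> $ 2) has_field_derivative
        - (b21 (exp \<zeta>) * F 1 \<zeta> $ 1 + b22 (exp \<zeta>) * F 1 \<zeta> $ 2)) (at \<zeta>)"
      "((\<lambda>\<zeta>. F 2 \<zeta> $ 2) has_field_derivative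
        - (b21 (exp \<zeta>) * F 2 \<zeta> $ 1 + b22 (exp \<zeta>) * F 2 \<zeta> $ 2)) (at \<zeta>)"
      using FD2[OF \<zeta>, of 1] FD2[OF \<zeta>, of 2] by simp_all
  qed (use b L \<zeta>1 D_lower[of \<zeta>1] sub in auto)
qed

end



lemma norm_lincomb2_le:
  fixes b1 b2 u v :: complex
  assumes "norm b1 \<le> k" "norm b2 \<le> k"
  shows "norm (b1 * u + b2 * v) \<le> 2 * k * norm (u, v)"
proof -
  have "norm (b1 * u + b2 * v) \<le> norm b1 * norm u + norm b2 * norm v"
    using norm_triangle_ineq[of "b1 * u" "b2 * v"] by (simp add: norm_mult)
  also have "\<dots> \<le> k * norm (u, v) + k * norm (u, v)"
    using assms norm_fst_le[of u v] norm_snd_le[of v u]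
    by (intro add_mono mult_mono) (auto intro: order_trans[OF norm_ge_zero])
  finally show ?thesis by simp
qed

context normalised_te_chart
begin

text \<open>
  Since \<open>b21 = z c21\<close>, conjugation with \<open>diag (1, z)\<close> makes the pole logarithmic. In the coordinate
  \<open>\<zeta> = log z\<close>, on the strip that corresponds to the slit disc, the flat frame then solves a system
  with bounded coefficients, and the distance of \<open>\<zeta>\<close> from a fixed point \<open>\<zeta>0\<close> is at
  most \<open>|log |z||\<close> plus a constant. So \<open>exp (Q |\<zeta> - \<zeta>0|)\<close> is at most a power of \<open>1 / |z|\<close> up to a constant factor.
\<close>

lemma type_Reg_regular:
  assumes \<delta>: "delta H 1 = 0"
  shows "regular_singular H"
  unfolding regular_singular_def moderate_growth_def
proof (intro allI impI)
  fix s and r0 a :: real and A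
  assume s: "germ_section H s" and r0: "r0 > 0" and frame: "flat_frame H (slit_disc r0 a) A"
  define c21 where "c21 = zero_quotient b21"
  have c21: "c21 holomorphic_on U" "z * c21 z = b21 z" for z
    using zero_quotient[OF b_hol(3) open_U zero_in_U b21_0[unfolded \<delta> minus_zero]] by (auto simp: c21_def)
  have s_an: "(\<lambda>z. \<phi> (s z) $ i) analytic_on {0}" for i
    using s unfolding germ_section_iff by blast
  have s_bdd: "\<forall>\<^sub>F z in nhds 0. norm (\<phi> (s z) $ i) \<le> norm (\<phi> (s 0) $ i) + 1" for i
    by (rule isCont_eventually_bounded) (rule analytic_at_imp_isCont[OF s_an])
  obtain k1 k2 k3 k4 where k:
    "\<forall>\<^sub>F z in nhds 0. norm (b11 z) \<le> k1" "\<forall>\<^sub>F z in nhds 0. norm (b22 z) \<le> k2"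
    "\<forall>\<^sub>F z in nhds 0. norm (b12 z) \<le> k3" "\<forall>\<^sub>F z in nhds 0. norm (c21 z) \<le> k4"
    using bounded_near_0[OF b_hol(1)] bounded_near_0[OF b_hol(4)] bounded_near_0[OF b_hol(2)]
      bounded_near_0[OF c21(1)] by auto
  define k where "k = max (max k1 k2) (max k3 k4)"
  define \<sigma> where "\<sigma> = max (norm (\<phi> (s 0) $ 1) + 1) (norm (\<phi> (s 0) $ 2) + 1)"
  have "\<forall>\<^sub>F z in nhds 0. s z \<in> Tot H \<and> pr H (s z) = z"
    using s unfolding germ_section_iff by blast
  then have "\<forall>\<^sub>F z in nhds 0. z \<in> U \<and> norm (b11 z) \<le> k \<and> norm (b22 z) \<le> k \<and>
      norm (b12 z) \<le> k \<and> norm (c21 z) \<le> k \<and> s z \<in> Tot H \<and> pr H (s z) = z \<and>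
      norm (\<phi> (s z) $ 1) \<le> \<sigma> \<and> norm (\<phi> (s z) $ 2) \<le> \<sigma>"
    using k eventually_nhds_in_open[OF open_U zero_in_U] s_bdd[of 1] s_bdd[of 2]
    by eventually_elim (auto simp: k_def \<sigma>_def)
  then obtain r1 where r1: "r1 > 0" and ball: "\<And>z. norm z < r1 \<Longrightarrow> z \<in> U \<and> norm (b11 z) \<le> k \<and> norm (b22 z) \<le> k \<and>
      norm (b12 z) \<le> k \<and> norm (c21 z) \<le> k \<and> s z \<in> Tot H \<and> pr H (s z) = z \<and>
      norm (\<phi> (s z) $ 1) \<le> \<sigma> \<and> norm (\<phi> (s z) $ 2) \<le> \<sigma>"
    unfolding eventually_nhds_metric by auto
  have k0: "0 \<le> k" using ball[of 0] r1 norm_ge_zero order_trans by (metis norm_zero)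
  have \<sigma>0: "0 \<le> \<sigma>" by (simp add: \<sigma>_def le_max_iff_disj)
  define r where "r = min 1 (min r0 r1)"
  have r: "0 < r" "r \<le> 1" "r \<le> r0" "r \<le> r1" using r0 r1 by (auto simp: r_def)
  let ?\<Sigma> = "slit_disc r0 a"
  define S where "S = {\<zeta>. Re \<zeta> < ln r} \<inter> {\<zeta>. Im \<zeta> < a + pi} \<inter> {\<zeta>. a - pi < Im \<zeta>}"
  have S: "convex S"
    unfolding S_def
    by (intro convex_Int convex_halfspace_Re_lt convex_halfspace_Im_lt convex_halfspace_Im_gt)
  define \<zeta>0 where "\<zeta>0 = Complex (ln r - 1) a"
  have \<zeta>0: "\<zeta>0 \<in> S" by (simp add: \<zeta>0_def S_def)
  have expr: "norm (exp \<zeta>) < r" if "\<zeta> \<in> S" for \<zeta>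
  proof -
    have "exp (Re \<zeta>) < exp (ln r)" using that by (simp add: S_def)
    then show ?thesis using r(1) by simp
  qed
  have exp\<Sigma>: "exp \<zeta> \<in> ?\<Sigma>" if "\<zeta> \<in> S" for \<zeta>
  proof (rule exp_in_slit_disc[OF _ _ r0])
    have "ln r \<le> ln r0" using r by simp
    then show "Re \<zeta> < ln r0" using that by (simp add: S_def)
    show "\<bar>Im \<zeta> - a\<bar> < pi" using that by (auto simp: S_def)
  qed
  have near: "z \<in> U" "norm (b11 z) \<le> k" "norm (b22 z) \<le> k" "norm (b12 z) \<le> k" "norm (c21 z) \<le> k"
    "s z \<in> Tot H" "pr H (s z) = z" "norm (\<phi> (s z) $ 1) \<le> \<sigma>" "norm (\<phi> (s z) $ 2) \<le> \<sigma>"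
    if "norm z < r" for z
    using ball[of z] that r by auto
  have A_sec: "hol_section H ?\<Sigma> (A j)" and A_flat: "z \<in> ?\<Sigma> \<Longrightarrow> conn H (A j) z = fscale H 0 (A j z)"
    and A_basis: "z \<in> ?\<Sigma> \<Longrightarrow> fibre_basis H z (\<lambda>i. A i z)" for j z
    using frame unfolding flat_frame_def by blast+
  define \<Sigma>' where "\<Sigma>' = ?\<Sigma> \<inter> ball 0 r"
  have \<Sigma>': "open \<Sigma>'" "\<Sigma>' \<subseteq> U" "\<Sigma>' \<subseteq> ?\<Sigma>"
    using hol_section_open[OF A_sec] near(1) by (auto simp: \<Sigma>'_def)
  have A_sec': "hol_section H \<Sigma>' (A j)" for j
    by (rule hol_section_subset[OF A_sec \<Sigma>'(1,3)])
  define f where "f = (\<lambda>j i z. \<phi> (A j z) $ i)"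
  have f_hol: "f j i holomorphic_on \<Sigma>'" for i j
    using A_sec'[of j] unfolding hol_section_iff[OF \<Sigma>'(2)] by (simp add: f_def)
  have exp\<Sigma>': "exp \<zeta> \<in> \<Sigma>'" if "\<zeta> \<in> S" for \<zeta>
    using exp\<Sigma>[OF that] expr[OF that] by (simp add: \<Sigma>'_def)
  have f_der: "(f j i has_field_derivative deriv (f j i) z) (at z)" if "z \<in> \<Sigma>'" for i j z
    using holomorphic_derivI[OF f_hol \<Sigma>'(1) that] .
  have f_ode: "z\<^sup>2 * deriv (f j i) z = - (M z $ i $ 1 * f j 1 z + M z $ i $ 2 * f j 2 z)"
    if z: "z \<in> \<Sigma>'" "z \<noteq> 0" for i j z
  proof -
    have "z\<^sup>2 *s vec_deriv (\<lambda>w. \<phi> (A j w)) z = - (M z *v \<phi> (A j z))"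
      using flat_iff[OF A_sec' z(1) _ z(2)] \<Sigma>'(2,3) z(1) A_flat by blast
    then have "(z\<^sup>2 *s vec_deriv (\<lambda>w. \<phi> (A j w)) z) $ i = (- (M z *v \<phi> (A j z))) $ i"
      by simp
    then show ?thesis
      by (simp add: vec_deriv_def f_def matrix_vector_mult_2)
  qed
  \<comment> \<open>coordinates with respect to the frame \<open>(v\<^sub>1, z v\<^sub>2)\<close>, in which the pole is logarithmic\<close>
  define G1 where "G1 = (\<lambda>j \<zeta>. f j 1 (exp \<zeta>))"
  define G2 where "G2 = (\<lambda>j \<zeta>. exp (- \<zeta>) * f j 2 (exp \<zeta>))"
  have fG: "f j 1 (exp \<zeta>) = G1 j \<zeta>" "f j 2 (exp \<zeta>) = exp \<zeta> * G2 j \<zeta>" for j \<zeta>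
    by (simp_all add: G1_def G2_def mult_exp_exp flip: mult.assoc)
  have comp: "((\<lambda>\<zeta>. f j i (exp \<zeta>)) has_field_derivative deriv (f j i) (exp \<zeta>) * exp \<zeta>) (at \<zeta>)" if "\<zeta> \<in> S" for i j \<zeta>
    by (rule DERIV_chain2[OF f_der[OF exp\<Sigma>'[OF that]] DERIV_exp])
  have ode1: "deriv (f j 1) (exp \<zeta>) * exp \<zeta> = - b11 (exp \<zeta>) * G1 j \<zeta> + - b12 (exp \<zeta>) * G2 j \<zeta>"
    and ode2: "deriv (f j 2) (exp \<zeta>) = - (exp \<zeta> * c21 (exp \<zeta>)) * G1 j \<zeta> / exp \<zeta> + - b22 (exp \<zeta>) * G2 j \<zeta>"
    if "\<zeta> \<in> S" for j \<zeta>
  proof -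
    have "exp \<zeta> * (deriv (f j 1) (exp \<zeta>) * exp \<zeta>) = exp \<zeta> * (- b11 (exp \<zeta>) * G1 j \<zeta> + - b12 (exp \<zeta>) * G2 j \<zeta>)"
      using f_ode[OF exp\<Sigma>'[OF that], of j 1] by (simp add: M_entries fG power2_eq_square algebra_simps)
    then show "deriv (f j 1) (exp \<zeta>) * exp \<zeta> = - b11 (exp \<zeta>) * G1 j \<zeta> + - b12 (exp \<zeta>) * G2 j \<zeta>"
      by simp
    have "(exp \<zeta>)\<^sup>2 * deriv (f j 2) (exp \<zeta>) = (exp \<zeta>)\<^sup>2 * (- (exp \<zeta> * c21 (exp \<zeta>)) * G1 j \<zeta> / exp \<zeta> + - b22 (exp \<zeta>) * G2 j \<zeta>)"
      using f_ode[OF exp\<Sigma>'[OF that], of j 2]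
      by (simp add: M_entries fG c21(2)[symmetric] power2_eq_square algebra_simps)
    then show "deriv (f j 2) (exp \<zeta>) = - (exp \<zeta> * c21 (exp \<zeta>)) * G1 j \<zeta> / exp \<zeta> + - b22 (exp \<zeta>) * G2 j \<zeta>"
      by simp
  qed
  have G1_der: "(G1 j has_field_derivative - b11 (exp \<zeta>) * G1 j \<zeta> + - b12 (exp \<zeta>) * G2 j \<zeta>) (at \<zeta>)" if "\<zeta> \<in> S" for j \<zeta>
    using comp[OF that, of j 1] unfolding ode1[OF that] by (simp add: G1_def)
  have G2_der: "(G2 j has_field_derivative - c21 (exp \<zeta>) * G1 j \<zeta> + (- 1 - b22 (exp \<zeta>)) * G2 j \<zeta>) (at \<zeta>)" if "\<zeta> \<in> S" for j \<zeta>
  proof -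
    have "((\<lambda>\<zeta>. exp (- \<zeta>)) has_field_derivative - exp (- \<zeta>)) (at \<zeta>)"
      by (auto intro!: derivative_eq_intros)
    from DERIV_mult[OF this comp[OF that, of j 2]]
    have "(G2 j has_field_derivative - exp (- \<zeta>) * f j 2 (exp \<zeta>) + deriv (f j 2) (exp \<zeta>) * exp \<zeta> * exp (- \<zeta>)) (at \<zeta>)"
      by (simp add: G2_def)
    also have "- exp (- \<zeta>) * f j 2 (exp \<zeta>) + deriv (f j 2) (exp \<zeta>) * exp \<zeta> * exp (- \<zeta>) =
        - c21 (exp \<zeta>) * G1 j \<zeta> + (- 1 - b22 (exp \<zeta>)) * G2 j \<zeta>"
    proof -
      have cancel: "exp \<zeta> * (inverse (exp \<zeta>) * x) = x" for x
        by (simp flip: mult.assoc)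
      show ?thesis
        by (simp add: ode2[OF that] fG exp_minus algebra_simps cancel)
    qed
    finally show ?thesis .
  qed
  have G_bound: "norm (G1 j \<zeta>, G2 j \<zeta>) \<le> norm (G1 j \<zeta>0, G2 j \<zeta>0) * exp (4 * (k + 1) * norm (\<zeta> - \<zeta>0))"
    if "\<zeta> \<in> S" for j \<zeta>
  proof (rule linear_growth_bound_convex[OF S \<zeta>0 that G1_der G2_der])
    fix \<zeta> assume \<zeta>: "\<zeta> \<in> S"
    note n = near[OF expr[OF \<zeta>]]
    have 1: "norm (- b11 (exp \<zeta>) * G1 j \<zeta> + - b12 (exp \<zeta>) * G2 j \<zeta>) \<le> 2 * (k + 1) * norm (G1 j \<zeta>, G2 j \<zeta>)"
      by (rule norm_lincomb2_le) (use n(2,4) in auto)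
    have "norm (- 1 - b22 (exp \<zeta>)) \<le> k + 1"
      using norm_triangle_ineq4[of "- 1" "b22 (exp \<zeta>)"] n(3) by simp
    then have 2: "norm (- c21 (exp \<zeta>) * G1 j \<zeta> + (- 1 - b22 (exp \<zeta>)) * G2 j \<zeta>) \<le> 2 * (k + 1) * norm (G1 j \<zeta>, G2 j \<zeta>)"
      by (intro norm_lincomb2_le) (use n(5) in auto)
    show "norm (- b11 (exp \<zeta>) * G1 j \<zeta> + - b12 (exp \<zeta>) * G2 j \<zeta>,
        - c21 (exp \<zeta>) * G1 j \<zeta> + (- 1 - b22 (exp \<zeta>)) * G2 j \<zeta>) \<le> 4 * (k + 1) * norm (G1 j \<zeta>, G2 j \<zeta>)"
      by (rule order_trans[OF norm_Pair_le]) (use 1 2 in \<open>simp add: algebra_simps\<close>)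
  qed
  let ?D = "\<lambda>\<zeta>. G1 1 \<zeta> * G2 2 \<zeta> - G1 2 \<zeta> * G2 1 \<zeta>"
  have D_lower: "norm (?D \<zeta>0) \<le> norm (?D \<zeta>) * exp ((2 * k + 1) * norm (\<zeta> - \<zeta>0))" if "\<zeta> \<in> S" for \<zeta>
  proof -
    have "norm (?D \<zeta>0) \<le> norm (?D \<zeta>) * exp ((2 * k + 1) * norm (\<zeta>0 - \<zeta>))"
    proof (rule determinant_growth_bound[OF S that \<zeta>0 G1_der G2_der G1_der G2_der])
      fix \<eta> assume \<eta>: "\<eta> \<in> S"
      show "norm (- b11 (exp \<eta>) + (- 1 - b22 (exp \<eta>))) \<le> 2 * k + 1"
        using norm_triangle_ineq[of "- b11 (exp \<eta>)" "- 1 - b22 (exp \<eta>)"] norm_triangle_ineq4[of "- 1" "b22 (exp \<eta>)"]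
          near(2,3)[OF expr[OF \<eta>]] unfolding norm_minus_cancel norm_one by linarith
    qed
    then show ?thesis by (simp add: norm_minus_commute)
  qed
  have detD: "det (frame_matrix \<phi> (\<lambda>i. A i (exp \<zeta>))) = exp \<zeta> * ?D \<zeta>" for \<zeta>
    using fG[of 1 \<zeta>] fG[of 2 \<zeta>] by (simp add: det_2 frame_matrix_def f_def algebra_simps)
  have "det (frame_matrix \<phi> (\<lambda>i. A i (exp \<zeta>0))) \<noteq> 0"
    using A_basis[OF exp\<Sigma>[OF \<zeta>0]] fibre_basis_iff[OF near(1)[OF expr[OF \<zeta>0]]] by (simp add: invertible_det_nz)
  then have D0: "norm (?D \<zeta>0) > 0"
    by (simp add: detD)
  define g where "g = max (norm (G1 1 \<zeta>0, G2 1 \<zeta>0)) (norm (G1 2 \<zeta>0, G2 2 \<zeta>0))"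
  \<comment> \<open>the exponents of the upper bound for the frame and of the lower bound for its determinant\<close>
  define Q where "Q = 4 * (k + 1) + (2 * k + 1)"
  \<comment> \<open>one more power of \<open>z\<close> comes from the determinant of \<open>diag (1, z)\<close>\<close>
  define N where "N = nat \<lceil>Q\<rceil> + 1"
  define C where "C = 4 * \<sigma> * g / norm (?D \<zeta>0) * exp (Q * (\<bar>ln r - 1\<bar> + pi))"
  have Q0: "0 \<le> Q" using k0 by (simp add: Q_def)
  have "norm c \<le> C * inverse (norm z ^ N)"
    if z: "z \<in> ?\<Sigma>" "norm z < r" and c: "s z = lincomb H c (\<lambda>i. A i z)" for z c
  proof -
    obtain \<zeta> where \<zeta>': "z = exp \<zeta>" "Re \<zeta> = ln (norm z)" "norm z < r0" "\<bar>Im \<zeta> - a\<bar> < pi" "z \<noteq> 0"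
      using slit_disc_exp[OF z(1)] .
    have \<zeta>: "\<zeta> \<in> S"
    proof -
      have "0 < norm z" using \<zeta>'(5) by simp
      then have "ln (norm z) < ln r" using z(2) r(1) by (simp add: ln_less_cancel_iff)
      then show ?thesis using \<zeta>'(2,4) by (auto simp: S_def)
    qed
    note n = near[OF z(2)]
    have AT: "A i z \<in> Tot H" "pr H (A i z) = z" for i
      using A_basis[OF z(1)] unfolding fibre_basis_def by auto
    have "\<phi> (s z) = frame_matrix \<phi> (\<lambda>i. A i z) *v c"
      unfolding c by (rule chart_lincomb[OF n(1) AT])
    then have sz: "\<phi> (s z) $ 1 = G1 1 \<zeta> * c $ 1 + G1 2 \<zeta> * c $ 2"
      "\<phi> (s z) $ 2 = z * (G2 1 \<zeta> * c $ 1 + G2 2 \<zeta> * c $ 2)"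
      using fG[of 1 \<zeta>] fG[of 2 \<zeta>] unfolding \<zeta>'(1)
      by (simp_all add: matrix_vector_mult_2 frame_matrix_def f_def algebra_simps)
    have cramer: "z * ?D \<zeta> * c $ 1 = z * G2 2 \<zeta> * \<phi> (s z) $ 1 + - G1 2 \<zeta> * \<phi> (s z) $ 2"
      "z * ?D \<zeta> * c $ 2 = - (z * G2 1 \<zeta>) * \<phi> (s z) $ 1 + G1 1 \<zeta> * \<phi> (s z) $ 2"
      unfolding sz by (simp_all add: algebra_simps)
    let ?d = "norm (\<zeta> - \<zeta>0)"
    define m where "m = g * exp (4 * (k + 1) * ?d)"
    have m0: "0 \<le> m" unfolding m_def g_def by (simp add: le_max_iff_disj)
    have G: "norm (G1 j \<zeta>) \<le> m" "norm (G2 j \<zeta>) \<le> m" for j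
    proof -
      have "norm (G1 j \<zeta>0, G2 j \<zeta>0) \<le> g" using exhaust_2[of j] by (auto simp: g_def)
      then have "norm (G1 j \<zeta>, G2 j \<zeta>) \<le> m"
        unfolding m_def by (intro order_trans[OF G_bound[OF \<zeta>]] mult_right_mono) auto
      then show "norm (G1 j \<zeta>) \<le> m" "norm (G2 j \<zeta>) \<le> m"
        using norm_fst_le[of "G1 j \<zeta>" "G2 j \<zeta>"] norm_snd_le[of "G2 j \<zeta>" "G1 j \<zeta>"] by auto
    qed
    have z1: "norm z \<le> 1" using z(2) r(2) by simp
    have zG: "norm (z * G2 j \<zeta>) \<le> m" for j
      using mult_mono[OF z1 G(2)[of j]] m0 by (simp add: norm_mult)
    have prod: "norm (u * v + u' * v') \<le> 2 * (m * \<sigma>)"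
      if "norm u \<le> m" "norm v \<le> \<sigma>" "norm u' \<le> m" "norm v' \<le> \<sigma>" for u v u' v' :: complex
    proof -
      have "norm (u * v + u' * v') \<le> norm u * norm v + norm u' * norm v'"
        using norm_triangle_ineq[of "u * v" "u' * v'"] by (simp add: norm_mult)
      also have "\<dots> \<le> m * \<sigma> + m * \<sigma>"
        using that m0 by (intro add_mono mult_mono) auto
      finally show ?thesis by (simp add: mult.commute)
    qed
    have ci: "norm z * norm (?D \<zeta>) * norm (c $ i) \<le> 2 * (m * \<sigma>)" for i
    proof -
      have "norm (z * ?D \<zeta> * c $ 1) \<le> 2 * (m * \<sigma>)"
        unfolding cramer by (rule prod) (use zG G n(8,9) in auto)
      moreover have "norm (z * ?D \<zeta> * c $ 2) \<le> 2 * (m * \<sigma>)"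
        unfolding cramer by (rule prod) (use zG G n(8,9) in auto)
      ultimately show ?thesis
        using exhaust_2[of i] by (auto simp: norm_mult)
    qed
    have "norm z * norm (?D \<zeta>0) * norm c \<le> norm z * norm (?D \<zeta>0) * (norm (c $ 1) + norm (c $ 2))"
      by (intro mult_left_mono norm_vec2_le) auto
    also have "\<dots> \<le> norm z * (norm (?D \<zeta>) * exp ((2 * k + 1) * ?d)) * (norm (c $ 1) + norm (c $ 2))"
      by (intro mult_right_mono mult_left_mono D_lower[OF \<zeta>]) auto
    also have "\<dots> = (norm z * norm (?D \<zeta>) * norm (c $ 1) + norm z * norm (?D \<zeta>) * norm (c $ 2)) * exp ((2 * k + 1) * ?d)"
      by (simp add: algebra_simps)
    also have "\<dots> \<le> (2 * (m * \<sigma>) + 2 * (m * \<sigma>)) * exp ((2 * k + 1) * ?d)"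
      by (intro mult_right_mono add_mono ci) auto
    also have "\<dots> = 4 * \<sigma> * g * exp (Q * ?d)"
    proof -
      have "exp (Q * ?d) = exp (4 * (k + 1) * ?d) * exp ((2 * k + 1) * ?d)"
        unfolding Q_def distrib_right exp_add ..
      then show ?thesis by (simp add: m_def mult_ac)
    qed
    also have "\<dots> \<le> 4 * \<sigma> * g * (exp (Q * (\<bar>ln r - 1\<bar> + pi)) * (inverse (norm z ^ nat \<lceil>Q\<rceil>)))"
    proof (rule mult_left_mono)
      have ln_le: "ln (norm z) \<le> 0" using z1 \<zeta>'(5) by simp
      have "?d \<le> \<bar>Re (\<zeta> - \<zeta>0)\<bar> + \<bar>Im (\<zeta> - \<zeta>0)\<bar>"
        by (rule cmod_le)
      also have "\<dots> \<le> (\<bar>ln r - 1\<bar> + pi) - ln (norm z)"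
        using \<zeta>'(2,4) ln_le by (auto simp: \<zeta>0_def)
      finally have "Q * ?d \<le> Q * ((\<bar>ln r - 1\<bar> + pi) - ln (norm z))"
        by (rule mult_left_mono[OF _ Q0])
      also have "\<dots> \<le> Q * (\<bar>ln r - 1\<bar> + pi) + real (nat \<lceil>Q\<rceil>) * - ln (norm z)"
      proof -
        have "Q \<le> real (nat \<lceil>Q\<rceil>)" by (rule real_nat_ceiling_ge)
        moreover have "0 \<le> - ln (norm z)" using ln_le by simp
        ultimately have "Q * - ln (norm z) \<le> real (nat \<lceil>Q\<rceil>) * - ln (norm z)"
          by (rule mult_right_mono)
        then show ?thesis by (simp add: algebra_simps)
      qed
      finally have "exp (Q * ?d) \<le> exp (Q * (\<bar>ln r - 1\<bar> + pi)) * exp (real (nat \<lceil>Q\<rceil>) * - ln (norm z))"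
        by (simp add: mult_exp_exp)
      also have "exp (real (nat \<lceil>Q\<rceil>) * - ln (norm z)) = inverse (norm z ^ nat \<lceil>Q\<rceil>)"
        using \<zeta>'(5) by (simp add: exp_of_nat_mult exp_minus power_inverse)
      finally show "exp (Q * ?d) \<le> exp (Q * (\<bar>ln r - 1\<bar> + pi)) * (inverse (norm z ^ nat \<lceil>Q\<rceil>))" .
      show "0 \<le> 4 * \<sigma> * g" using \<sigma>0 by (simp add: g_def le_max_iff_disj)
    qed
    finally have "norm z * norm (?D \<zeta>0) * norm c \<le>
        4 * \<sigma> * g * (exp (Q * (\<bar>ln r - 1\<bar> + pi)) * (inverse (norm z ^ nat \<lceil>Q\<rceil>)))" .
    moreover have "0 < norm z * norm (?D \<zeta>0)" using D0 \<zeta>'(5) by simp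
    ultimately have "norm c \<le> 4 * \<sigma> * g * (exp (Q * (\<bar>ln r - 1\<bar> + pi)) * (inverse (norm z ^ nat \<lceil>Q\<rceil>))) / (norm z * norm (?D \<zeta>0))"
      by (subst pos_le_divide_eq) (simp_all only: mult.commute mult.left_commute)
    also have "\<dots> = C * inverse (norm z ^ N)"
      by (simp add: C_def N_def divide_inverse mult_ac)
    finally show ?thesis .
  qed
  then show "\<exists>C (N::nat) \<epsilon>. 0 < \<epsilon> \<and> (\<forall>z\<in>?\<Sigma>. norm z < \<epsilon> \<longrightarrow>
      (\<forall>c. s z = lincomb H c (\<lambda>i. A i z) \<longrightarrow> norm c \<le> C * inverse (norm z ^ N)))"
    using r(1) by blast
qed

end



section \<open>Meromorphic germs and poles of order 3\<close>

lemma meromorphic_at_0_clear_pole: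
  assumes "f meromorphic_on {0}"
  obtains N g where "g analytic_on {0}" "\<forall>\<^sub>F z in at 0. z ^ N * f z = g z"
proof -
  obtain F where F: "f has_laurent_expansion F"
    using assms unfolding meromorphic_on_def by auto
  define N where "N = nat (- fls_subdegree F)"
  have "- fls_subdegree F \<le> int N" by (simp add: N_def)
  then obtain F' where F': "F = fls_shift (int N) (fps_to_fls F')"
    by (rule fls_as_fps)
  have "(\<lambda>z. z ^ N * f z) has_laurent_expansion fls_X ^ N * F"
    by (intro has_laurent_expansion_mult has_laurent_expansion_power has_laurent_expansion_fps_X F)
  also have "fls_X ^ N * F = fps_to_fls F'"
    by (simp add: F' fls_X_power_times_conv_shift)
  finally have L: "(\<lambda>z. z ^ N * f z) has_laurent_expansion fps_to_fls F'" .
  define g where "g z = (if z = 0 then fps_nth F' 0 else z ^ N * f z)" for z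
  have ev: "\<forall>\<^sub>F z in at 0. z ^ N * f z = g z"
    using eventually_neq_at_within[of 0] by eventually_elim (simp add: g_def)
  then have "g has_laurent_expansion fps_to_fls F'"
    using L has_laurent_expansion_cong[OF ev refl] by simp
  then have "g has_fps_expansion F'"
    by (simp add: has_fps_expansion_to_laurent g_def)
  then have "g analytic_on {0}"
    by (rule has_fps_expansion_imp_analytic_0)
  then show ?thesis using ev by (rule that)
qed

lemma meromorphic_family_clear_poles:
  fixes f :: "'i::finite \<Rightarrow> complex \<Rightarrow> complex"
  assumes "\<And>i. f i meromorphic_on {0}"
  obtains N g where "\<And>i. g i analytic_on {0}" "\<forall>\<^sub>F z in at 0. \<forall>i. z ^ N * f i z = g i z"
proof -
  have "\<exists>N g. g analytic_on {0} \<and> (\<forall>\<^sub>F z in at 0. z ^ N * f i z = g z)" for i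
    using meromorphic_at_0_clear_pole[OF assms] by metis
  then obtain N g where g: "\<And>i. g i analytic_on {0}" "\<And>i. \<forall>\<^sub>F z in at 0. z ^ N i * f i z = g i z"
    by metis
  define n where "n = Max (range N)"
  have n: "N i \<le> n" for i by (simp add: n_def)
  have "(\<lambda>z. z ^ (n - N i) * g i z) analytic_on {0}" for i
    by (intro analytic_intros g)
  moreover have "\<forall>\<^sub>F z in at 0. \<forall>i. z ^ n * f i z = z ^ (n - N i) * g i z"
  proof (intro eventually_all_finite)
    fix i
    show "\<forall>\<^sub>F z in at 0. z ^ n * f i z = z ^ (n - N i) * g i z"
      using g(2)[of i]
    proof eventually_elim
      case (elim z)
      have "z ^ n = z ^ (n - N i) * z ^ N i"
        using n[of i] by (simp flip: power_add)
      then show ?case by (simp add: elim[symmetric])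
    qed
  qed
  ultimately show ?thesis by (rule that)
qed

lemma meromorphic_on_0_cong:
  "\<forall>\<^sub>F z in at 0. f z = g z \<Longrightarrow> f meromorphic_on {0} \<longleftrightarrow> g meromorphic_on {0}"
  by (rule meromorphic_on_cong) auto

context pointed_chart
begin

lemma eventually_in_U: "\<forall>\<^sub>F z in at 0. z \<in> U"
  using open_U zero_in_U by (intro eventually_at_in_open')

text \<open>
  The coordinates of a section have a common denominator \<open>z\<^sup>N\<close>.
\<close>

lemma mero_germ_section_iff:
  "mero_germ_section H s \<longleftrightarrow> (\<forall>\<^sub>F z in at 0. s z \<in> Tot H \<and> pr H (s z) = z) \<and>
     (\<forall>i. (\<lambda>z. \<phi> (s z) $ i) meromorphic_on {0})"
proof
  assume "mero_germ_section H s"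
  then obtain N t where t: "germ_section H t" and st: "\<forall>\<^sub>F z in at 0. s z = fscale H (inverse (z ^ N)) (t z)"
    unfolding mero_germ_section_def by blast
  have tT: "\<forall>\<^sub>F z in at 0. t z \<in> Tot H \<and> pr H (t z) = z" and t_an: "(\<lambda>z. \<phi> (t z) $ i) analytic_on {0}" for i
    using t unfolding germ_section_iff by (auto simp: eventually_nhds_conv_at)
  have "\<forall>\<^sub>F z in at 0. s z \<in> Tot H \<and> pr H (s z) = z"
    using tT st by eventually_elim (simp add: Tot_fscale pr_fscale)
  moreover have "(\<lambda>z. \<phi> (s z) $ i) meromorphic_on {0}" for i
  proof -
    have ev: "\<forall>\<^sub>F z in at 0. \<phi> (s z) $ i = inverse (z ^ N) * \<phi> (t z) $ i"
      using tT st eventually_in_U by eventually_elim (simp add: chart_fscale)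
    have "(\<lambda>z. inverse (z ^ N) * \<phi> (t z) $ i) meromorphic_on {0}"
      by (intro meromorphic_intros analytic_on_imp_meromorphic_on t_an)
    then show ?thesis
      by (simp only: meromorphic_on_0_cong[OF ev])
  qed
  ultimately show "(\<forall>\<^sub>F z in at 0. s z \<in> Tot H \<and> pr H (s z) = z) \<and>
     (\<forall>i. (\<lambda>z. \<phi> (s z) $ i) meromorphic_on {0})" by blast
next
  assume *: "(\<forall>\<^sub>F z in at 0. s z \<in> Tot H \<and> pr H (s z) = z) \<and>
     (\<forall>i. (\<lambda>z. \<phi> (s z) $ i) meromorphic_on {0})"
  then have sT: "\<forall>\<^sub>F z in at 0. s z \<in> Tot H \<and> pr H (s z) = z"
    and s_mero: "\<And>i. (\<lambda>z. \<phi> (s z) $ i) meromorphic_on {0}" by auto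
  obtain N and g :: "2 \<Rightarrow> complex \<Rightarrow> complex" where g: "\<And>i. g i analytic_on {0}" "\<forall>\<^sub>F z in at 0. \<forall>i. z ^ N * \<phi> (s z) $ i = g i z"
    using meromorphic_family_clear_poles[of "\<lambda>i z. \<phi> (s z) $ i", OF s_mero] by blast
  define t where "t z = pt z (\<chi> i. g i z)" for z
  have "germ_section H t"
    unfolding t_def by (rule germ_section_pt) (simp add: g(1))
  moreover have "\<forall>\<^sub>F z in at 0. s z = fscale H (inverse (z ^ N)) (t z)"
    using sT g(2) eventually_in_U eventually_neq_at_within[of 0]
  proof eventually_elim
    case (elim z)
    show ?case
    proof (rule chart_inj[of _ _ z])
      have "g i z = z ^ N * \<phi> (s z) $ i" for i using elim(2) by simp
      then show "\<phi> (s z) = \<phi> (fscale H (inverse (z ^ N)) (t z))"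
        using elim(3,4) by (simp add: t_def chart_fscale Tot_pt pr_pt chart_pt vec_eq_iff flip: mult.assoc)
    qed (use elim in \<open>auto simp: t_def Tot_fscale pr_fscale Tot_pt pr_pt\<close>)
  qed
  ultimately show "mero_germ_section H s"
    unfolding mero_germ_section_def by blast
qed

lemma mero_germ_section_punctured:
  assumes "mero_germ_section H s"
  obtains r where "r > 0" "ball 0 r \<subseteq> U" "hol_section H (ball 0 r - {0}) s"
proof -
  obtain N t where t: "germ_section H t" and st: "\<forall>\<^sub>F z in at 0. s z = fscale H (inverse (z ^ N)) (t z)"
    using assms unfolding mero_germ_section_def by blast
  obtain W where W: "0 \<in> W" "hol_section H W t"
    using t unfolding germ_section_def by blast
  have "\<forall>\<^sub>F z in at 0. z \<in> W \<inter> U \<and> s z = fscale H (inverse (z ^ N)) (t z)"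
    using st eventually_in_U eventually_at_in_open'[OF hol_section_open[OF W(2)] W(1)]
    by eventually_elim auto
  then obtain r where r: "r > 0" "\<And>z. z \<noteq> 0 \<Longrightarrow> norm z < r \<Longrightarrow> z \<in> W \<inter> U \<and> s z = fscale H (inverse (z ^ N)) (t z)"
    unfolding eventually_at by auto
  let ?B = "ball 0 r - {0} :: complex set"
  have B: "?B \<subseteq> U" "?B \<subseteq> W" using r(2) by fastforce+
  have oB: "open ?B" by auto
  have tB: "hol_section H ?B t"
    by (rule hol_section_subset[OF W(2) oB B(2)])
  have s_eq: "s z = fscale H (inverse (z ^ N)) (t z)" if "z \<in> ?B" for z
    using r(2)[of z] that by auto
  have "hol_section H ?B s"
    unfolding hol_section_iff[OF B(1)]
  proof (intro conjI ballI allI oB)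
    show "s z \<in> Tot H" "pr H (s z) = z" if "z \<in> ?B" for z
      using hol_section_Tot[OF tB that] hol_section_pr[OF tB that] by (simp_all add: s_eq[OF that] Tot_fscale pr_fscale)
    fix i
    have "(\<lambda>z. \<phi> (t z) $ i) holomorphic_on ?B"
      using tB unfolding hol_section_iff[OF B(1)] by blast
    then have "(\<lambda>z. inverse (z ^ N) * \<phi> (t z) $ i) holomorphic_on ?B"
      by (intro holomorphic_intros) auto
    then show "(\<lambda>z. \<phi> (s z) $ i) holomorphic_on ?B"
    proof (rule holomorphic_transform)
      fix z assume z: "z \<in> ?B"
      show "inverse (z ^ N) * \<phi> (t z) $ i = \<phi> (s z) $ i"
        using hol_section_Tot[OF tB z] hol_section_pr[OF tB z] z B(1) by (simp add: s_eq[OF z] chart_fscale subsetD)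
    qed
  qed
  moreover have "ball 0 r \<subseteq> U"
    using B(1) zero_in_U by auto
  ultimately show ?thesis
    using r(1) that by blast
qed

lemma mero_germ_basis_coords:
  assumes w: "mero_germ_basis H w"
  obtains F :: "complex \<Rightarrow> complex^2^2"
  where "\<And>i j. (\<lambda>z. F z $ i $ j) meromorphic_on {0}"
    "\<forall>\<^sub>F z in at 0. F z ** frame_matrix \<phi> (\<lambda>j. w j z) = mat 1"
proof -
  have gw: "mero_germ_section H (w j)" for j
    using w unfolding mero_germ_basis_def by blast
  have "mero_germ_section H (\<lambda>z. pt z (axis k 1))" for k
    unfolding mero_germ_section_iff
  proof (intro conjI allI)
    show "\<forall>\<^sub>F z in at 0. pt z (axis k 1) \<in> Tot H \<and> pr H (pt z (axis k 1)) = z"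
      using eventually_in_U by eventually_elim (simp add: Tot_pt pr_pt)
    fix i
    have "\<forall>\<^sub>F z in at 0. axis k 1 $ i = \<phi> (pt z (axis k 1)) $ i"
      using eventually_in_U by eventually_elim (simp add: chart_pt)
    then show "(\<lambda>z. \<phi> (pt z (axis k 1)) $ i) meromorphic_on {0}"
      by (rule meromorphic_on_0_cong[THEN iffD1]) (rule meromorphic_on_const)
  qed
  then have "\<exists>f :: complex \<Rightarrow> complex^2. (\<forall>i. (\<lambda>z. f z $ i) meromorphic_on {0}) \<and>
      (\<forall>\<^sub>F z in at 0. pt z (axis k 1) = lincomb H (f z) (\<lambda>i. w i z))" for k
    using w unfolding mero_germ_basis_def by simp
  then have ex: "\<forall>k. \<exists>f :: complex \<Rightarrow> complex^2. (\<forall>i. (\<lambda>z. f z $ i) meromorphic_on {0}) \<and>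
      (\<forall>\<^sub>F z in at 0. pt z (axis k 1) = lincomb H (f z) (\<lambda>i. w i z))"
    by (rule allI)
  obtain f :: "2 \<Rightarrow> complex \<Rightarrow> complex^2" where "\<forall>k. (\<forall>i. (\<lambda>z. f k z $ i) meromorphic_on {0}) \<and>
      (\<forall>\<^sub>F z in at 0. pt z (axis k 1) = lincomb H (f k z) (\<lambda>i. w i z))"
    by (rule exE[OF choice[OF ex]]) (rule that)
  then have f: "(\<lambda>z. f k z $ i) meromorphic_on {0}"
    "\<forall>\<^sub>F z in at 0. pt z (axis k 1) = lincomb H (f k z) (\<lambda>i. w i z)" for k i
    by simp_all
  define F :: "complex \<Rightarrow> complex^2^2" where "F z = (\<chi> i k. f k z $ i)" for z
  have wT: "\<forall>\<^sub>F z in at 0. \<forall>j. w j z \<in> Tot H \<and> pr H (w j z) = z"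
    using gw unfolding mero_germ_section_iff by (intro eventually_all_finite) blast
  have fA: "\<forall>\<^sub>F z in at 0. \<forall>k. pt z (axis k 1) = lincomb H (f k z) (\<lambda>i. w i z)"
    by (intro eventually_all_finite f)
  have "\<forall>\<^sub>F z in at 0. F z ** frame_matrix \<phi> (\<lambda>j. w j z) = mat 1"
    using eventually_in_U wT fA
  proof eventually_elim
    case (elim z)
    have "axis k 1 = frame_matrix \<phi> (\<lambda>j. w j z) *v f k z" for k
    proof -
      have "axis k 1 = \<phi> (lincomb H (f k z) (\<lambda>i. w i z))"
        using chart_pt[OF elim(1), of "axis k 1"] elim(3) by simp
      also have "\<dots> = frame_matrix \<phi> (\<lambda>j. w j z) *v f k z"
        by (rule chart_lincomb[OF elim(1)]) (use elim(2) in auto)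
      finally show ?thesis .
    qed
    then have "(frame_matrix \<phi> (\<lambda>j. w j z) ** F z) $ i $ k = axis k 1 $ i" for i k
      by (simp add: F_def matrix_mult_2 matrix_vector_mult_2)
    then have "frame_matrix \<phi> (\<lambda>j. w j z) ** F z = mat 1"
      by (simp add: vec_eq_iff mat_def axis_def)
    then show ?case
      by (simp add: matrix_left_right_inverse)
  qed
  moreover have "(\<lambda>z. F z $ i $ j) meromorphic_on {0}" for i j
    using f(1) by (simp add: F_def)
  ultimately show ?thesis
    using that by blast
qed

lemma mero_germ_basisI:
  fixes V F :: "complex \<Rightarrow> complex^2^2"
  assumes w: "\<And>j. mero_germ_section H (w j)"
    and V: "\<forall>\<^sub>F z in at 0. frame_matrix \<phi> (\<lambda>j. w j z) = V z"
    and F: "\<And>i j. (\<lambda>z. F z $ i $ j) meromorphic_on {0}" "\<forall>\<^sub>F z in at 0. F z ** V z = mat 1"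
  shows "mero_germ_basis H w"
  unfolding mero_germ_basis_def
proof (intro conjI allI impI)
  show "mero_germ_section H (w j)" for j by (rule w)
  have wT: "\<forall>\<^sub>F z in at 0. \<forall>j. w j z \<in> Tot H \<and> pr H (w j z) = z"
    using w unfolding mero_germ_section_iff by (intro eventually_all_finite) blast
  have lc: "\<forall>\<^sub>F z in at 0. \<forall>c. lincomb H c (\<lambda>i. w i z) \<in> Tot H \<and> pr H (lincomb H c (\<lambda>i. w i z)) = z \<and>
      \<phi> (lincomb H c (\<lambda>i. w i z)) = V z *v c"
    using eventually_in_U wT V
  proof eventually_elim
    case (elim z)
    show ?case
      using Tot_lincomb[OF elim(1)] pr_lincomb[OF elim(1)] chart_lincomb[OF elim(1)] elim(2,3) by simp
  qed
  fix s assume "mero_germ_section H s"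
  then have sT: "\<forall>\<^sub>F z in at 0. s z \<in> Tot H \<and> pr H (s z) = z"
    and s_mero: "\<And>i. (\<lambda>z. \<phi> (s z) $ i) meromorphic_on {0}"
    unfolding mero_germ_section_iff by auto
  have "\<forall>\<^sub>F z in at 0. s z = lincomb H (F z *v \<phi> (s z)) (\<lambda>i. w i z)"
    using eventually_in_U sT lc F(2)
  proof eventually_elim
    case (elim z)
    have "V z ** F z = mat 1" using elim(4) by (simp add: matrix_left_right_inverse)
    then show ?case
      by (intro chart_inj[of _ _ z]) (use elim(1-3) in \<open>simp_all add: matrix_vector_mul_assoc\<close>)
  qed
  moreover have "(\<lambda>z. (F z *v \<phi> (s z)) $ i) meromorphic_on {0}" for i
    unfolding matrix_vector_mult_2 by (intro meromorphic_intros F s_mero)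
  ultimately show "\<exists>f. (\<forall>i. (\<lambda>z. f z $ i) meromorphic_on {0}) \<and> (\<forall>\<^sub>F z in at 0. s z = lincomb H (f z) (\<lambda>i. w i z))"
    by (intro exI[of _ "\<lambda>z. F z *v \<phi> (s z)"]) blast
next
  fix f g :: "complex \<Rightarrow> complex^2"
  assume "(\<forall>i. (\<lambda>z. f z $ i) meromorphic_on {0}) \<and> (\<forall>i. (\<lambda>z. g z $ i) meromorphic_on {0}) \<and>
    (\<forall>\<^sub>F z in at 0. lincomb H (f z) (\<lambda>i. w i z) = lincomb H (g z) (\<lambda>i. w i z))"
  then have fg: "\<forall>\<^sub>F z in at 0. lincomb H (f z) (\<lambda>i. w i z) = lincomb H (g z) (\<lambda>i. w i z)"
    by blast
  have wT: "\<forall>\<^sub>F z in at 0. \<forall>j. w j z \<in> Tot H \<and> pr H (w j z) = z"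
    using w unfolding mero_germ_section_iff by (intro eventually_all_finite) blast
  show "\<forall>\<^sub>F z in at 0. f z = g z"
    using eventually_in_U wT V F(2) fg
  proof eventually_elim
    case (elim z)
    have "V z *v f z = V z *v g z"
      using chart_lincomb[OF elim(1), of "\<lambda>i. w i z"] elim(2,3,5) by metis
    then have "F z *v (V z *v f z) = F z *v (V z *v g z)" by simp
    then show ?case by (simp add: matrix_vector_mul_assoc elim(4))
  qed
qed

end

lemma eventually_at_nhds:
  assumes "\<forall>\<^sub>F x in at (0::complex). P x"
  shows "\<forall>\<^sub>F x in at 0. \<forall>\<^sub>F y in nhds x. P y"
proof -
  obtain S where S: "open S" "0 \<in> S" "\<And>y. y \<in> S \<Longrightarrow> y \<noteq> 0 \<Longrightarrow> P y"
    using assms unfolding eventually_at_topological by blast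
  have "\<forall>\<^sub>F x in at 0. x \<in> S - {0}"
    using S(1,2) by (intro eventually_at_in_open)
  then show ?thesis
  proof eventually_elim
    case (elim x)
    have "\<forall>\<^sub>F y in nhds x. y \<in> S - {0}"
      using S(1) elim by (intro eventually_nhds_in_open) auto
    then show ?case by eventually_elim (use S(3) in auto)
  qed
qed

text \<open>
  Compare the coefficients of order \<open>m\<close>, the lowest order that occurs in \<open>\<Gamma>\<close>: the terms with
  \<open>X\<^sup>3\<close> and \<open>X\<^sup>2\<close> contribute only from order \<open>m + 2\<close> on.
\<close>

lemma leading_coefficient_intertwines:
  fixes \<Gamma> C C' :: "complex fps^2^2"
  assumes eq: "(\<chi> i j. fps_X ^ 3 * fps_deriv (\<Gamma> $ i $ j) - of_nat N * fps_X\<^sup>2 * \<Gamma> $ i $ j) + C ** \<Gamma> = \<Gamma> ** C'"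
    and nz: "\<Gamma> \<noteq> 0"
  obtains L :: "complex^2^2"
  where "L \<noteq> 0" "(\<chi> i j. fps_nth (C $ i $ j) 0) ** L = L ** (\<chi> i j. fps_nth (C' $ i $ j) 0)"
proof -
  have ex: "\<exists>m i j. fps_nth (\<Gamma> $ i $ j) m \<noteq> 0"
    using nz by (auto simp: vec_eq_iff fps_eq_iff)
  define m where "m = (LEAST m. \<exists>i j. fps_nth (\<Gamma> $ i $ j) m \<noteq> 0)"
  have m: "\<exists>i j. fps_nth (\<Gamma> $ i $ j) m \<noteq> 0"
    unfolding m_def by (rule LeastI_ex[OF ex])
  have below: "fps_nth (\<Gamma> $ i $ j) n = 0" if "n < m" for i j n
    using not_less_Least[OF that[unfolded m_def]] by blast
  define L :: "complex^2^2" where "L = (\<chi> i j. fps_nth (\<Gamma> $ i $ j) m)"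
  have "L \<noteq> 0" using m by (auto simp: L_def vec_eq_iff)
  have lead: "fps_nth (a * \<Gamma> $ i $ j) m = fps_nth a 0 * L $ i $ j" for a i j
  proof -
    have "fps_nth (a * \<Gamma> $ i $ j) m = (\<Sum>k=0..m. fps_nth a k * fps_nth (\<Gamma> $ i $ j) (m - k))"
      by (rule fps_mult_nth)
    also have "\<dots> = (\<Sum>k\<in>{0}. fps_nth a k * fps_nth (\<Gamma> $ i $ j) (m - k))"
      by (rule sum.mono_neutral_right) (auto intro: below)
    finally show ?thesis by (simp add: L_def)
  qed
  have d: "fps_nth (fps_X ^ 3 * fps_deriv (\<Gamma> $ i $ j) - of_nat N * fps_X\<^sup>2 * \<Gamma> $ i $ j) m = 0" for i j
  proof -
    have "fps_nth (fps_X ^ 3 * fps_deriv (\<Gamma> $ i $ j)) m = 0"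
      by (auto simp: fps_X_power_mult_nth intro: below)
    moreover have "fps_nth (of_nat N * fps_X\<^sup>2 * \<Gamma> $ i $ j) m = 0"
      unfolding lead by (simp add: power2_eq_square)
    ultimately show ?thesis by simp
  qed
  have "(\<chi> i j. fps_nth (C $ i $ j) 0) ** L = L ** (\<chi> i j. fps_nth (C' $ i $ j) 0)"
  proof (simp only: vec_eq_iff, intro allI)
    fix i j
    have "fps_nth ((C ** \<Gamma>) $ i $ j) m = fps_nth ((\<Gamma> ** C') $ i $ j) m"
      using arg_cong[OF eq, of "\<lambda>A. fps_nth (A $ i $ j) m"] d[of i j] by simp
    then show "((\<chi> i j. fps_nth (C $ i $ j) 0) ** L) $ i $ j = (L ** (\<chi> i j. fps_nth (C' $ i $ j) 0)) $ i $ j"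
      unfolding matrix_mult_2 using lead[of "C' $ 1 $ j" i 1] lead[of "C' $ 2 $ j" i 2]
      by (simp add: lead mult.commute)
  qed
  with \<open>L \<noteq> 0\<close> show ?thesis by (rule that)
qed



lemma fps_matrix_0_imp:
  assumes "\<And>i j. (\<lambda>z. B z $ i $ j) analytic_on {0}" "fps_matrix B = 0"
  shows "\<forall>\<^sub>F z in nhds 0. B z = 0"
proof -
  have "\<forall>\<^sub>F z in nhds 0. B z $ i $ j = 0" for i j
  proof -
    have "(\<lambda>z. B z $ i $ j) has_fps_expansion 0"
      using has_fps_expansion_fps_matrix[OF assms(1), of i j] by (simp add: assms(2))
    then show ?thesis
      by (auto simp: has_fps_expansion_def elim: eventually_mono)
  qed
  then have "\<forall>\<^sub>F z in nhds 0. \<forall>i j. B z $ i $ j = 0"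
    by (intro eventually_all_finite)
  then show ?thesis
    by eventually_elim (simp add: vec_eq_iff)
qed

text \<open>
  Here \<open>A\<close> may be singular at 0; for the pullback of a \<open>(TE)\<close>-structure it has a pole of order at
  most 5.
\<close>

locale pointed_conn_chart = pointed_chart H U \<phi> + conn_chart H U \<phi> A for H U \<phi> A
begin

lemma mero_conn:
  assumes "mero_germ_section H s"
  shows "\<forall>\<^sub>F x in at 0. conn H s x \<in> Tot H \<and> pr H (conn H s x) = x \<and>
    \<phi> (conn H s x) = vec_deriv (\<lambda>w. \<phi> (s w)) x + A x *v \<phi> (s x) \<and>
    (\<forall>i. (\<lambda>w. \<phi> (s w) $ i) field_differentiable at x)"
proof -
  obtain r where r: "r > 0" "ball 0 r \<subseteq> U" "hol_section H (ball 0 r - {0}) s"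
    using mero_germ_section_punctured[OF assms] .
  have sub: "ball 0 r - {0} \<subseteq> U" using r(2) by auto
  have hol: "(\<lambda>w. \<phi> (s w) $ i) holomorphic_on ball 0 r - {0}" for i
    using r(3) unfolding hol_section_iff[OF sub] by blast
  have "\<forall>\<^sub>F x in at 0. x \<in> ball 0 r - {0}"
    using r(1) by (intro eventually_at_in_open) auto
  then show ?thesis
  proof eventually_elim
    case (elim x)
    have x: "x \<in> U" "x \<noteq> 0" using elim sub by auto
    have "(\<lambda>w. \<phi> (s w) $ i) field_differentiable at x" for i
      by (rule holomorphic_on_imp_differentiable_at[OF hol _ elim]) auto
    then show ?case
      using conn_section[OF r(3) elim x] by blast
  qed
qed

lemma order3_pole_part_coords:
  assumes "order3_pole_part H w P"
  obtains C :: "complex \<Rightarrow> complex^2^2"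
  where "\<And>i j. (\<lambda>x. C x $ i $ j) analytic_on {0}" "C 0 = P"
    "\<forall>\<^sub>F x in at 0. \<forall>i j. (\<lambda>y. frame_matrix \<phi> (\<lambda>j. w j y) $ i $ j) field_differentiable at x \<and>
      x ^ 3 * (mat_deriv (\<lambda>y. frame_matrix \<phi> (\<lambda>j. w j y)) x $ i $ j
        + (A x ** frame_matrix \<phi> (\<lambda>j. w j x)) $ i $ j) = (frame_matrix \<phi> (\<lambda>j. w j x) ** C x) $ i $ j"
proof -
  obtain C :: "complex \<Rightarrow> complex^2^2" where C: "\<And>i j. (\<lambda>x. C x $ i $ j) analytic_on {0}" "C 0 = P"
    "\<And>j. \<forall>\<^sub>F x in at 0. fscale H x (conn H (w j) x) = lincomb H (inverse (x\<^sup>2) *s column j (C x)) (\<lambda>i. w i x)"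
    using assms unfolding order3_pole_part_def by blast
  have w: "mero_germ_section H (w j)" for j
    using assms unfolding order3_pole_part_def mero_germ_basis_def by blast
  have wT: "\<forall>\<^sub>F z in at 0. \<forall>j. w j z \<in> Tot H \<and> pr H (w j z) = z"
    using w unfolding mero_germ_section_iff by (intro eventually_all_finite) blast
  have conn: "\<forall>\<^sub>F x in at 0. \<forall>j. conn H (w j) x \<in> Tot H \<and> pr H (conn H (w j) x) = x \<and>
    \<phi> (conn H (w j) x) = vec_deriv (\<lambda>y. \<phi> (w j y)) x + A x *v \<phi> (w j x) \<and>
    (\<forall>i. (\<lambda>y. \<phi> (w j y) $ i) field_differentiable at x)"
    by (intro eventually_all_finite mero_conn w)
  have C': "\<forall>\<^sub>F x in at 0. \<forall>j. fscale H x (conn H (w j) x) = lincomb H (inverse (x\<^sup>2) *s column j (C x)) (\<lambda>i. w i x)"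
    by (intro eventually_all_finite C(3))
  have "\<forall>\<^sub>F x in at 0. \<forall>i j. (\<lambda>y. frame_matrix \<phi> (\<lambda>j. w j y) $ i $ j) field_differentiable at x \<and>
      x ^ 3 * (mat_deriv (\<lambda>y. frame_matrix \<phi> (\<lambda>j. w j y)) x $ i $ j
        + (A x ** frame_matrix \<phi> (\<lambda>j. w j x)) $ i $ j) = (frame_matrix \<phi> (\<lambda>j. w j x) ** C x) $ i $ j"
    using eventually_in_U wT conn C' eventually_neq_at_within[of 0]
  proof eventually_elim
    case (elim x)
    show ?case
    proof (intro allI conjI)
      fix i j
      show "(\<lambda>y. frame_matrix \<phi> (\<lambda>j. w j y) $ i $ j) field_differentiable at x"
        using elim(3) by (simp add: frame_matrix_def)
      have "x *s (vec_deriv (\<lambda>y. \<phi> (w j y)) x + A x *v \<phi> (w j x)) = \<phi> (fscale H x (conn H (w j) x))"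
        using elim(1,3) by (simp add: chart_fscale)
      also have "\<dots> = frame_matrix \<phi> (\<lambda>j. w j x) *v (inverse (x\<^sup>2) *s column j (C x))"
        using elim(4) chart_lincomb[OF elim(1), of "\<lambda>i. w i x"] elim(2) by simp
      finally have scaled: "x\<^sup>2 *s (x *s (vec_deriv (\<lambda>y. \<phi> (w j y)) x + A x *v \<phi> (w j x))) =
          x\<^sup>2 *s (inverse (x\<^sup>2) *s (frame_matrix \<phi> (\<lambda>j. w j x) *v column j (C x)))"
        by (simp add: vector_scalar_commute)
      have "x ^ 3 *s (vec_deriv (\<lambda>y. \<phi> (w j y)) x + A x *v \<phi> (w j x)) =
          frame_matrix \<phi> (\<lambda>j. w j x) *v column j (C x)"
      proof -
        have "x\<^sup>2 * inverse (x\<^sup>2) = 1"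
          using elim(5) by simp
        moreover have "x\<^sup>2 * x = x ^ 3"
          by (simp add: power2_eq_square power3_eq_cube)
        ultimately show ?thesis
          using scaled by (simp only: vector_smult_assoc vector_smult_lid)
      qed
      then have "(x ^ 3 *s (vec_deriv (\<lambda>y. \<phi> (w j y)) x + A x *v \<phi> (w j x))) $ i =
          (frame_matrix \<phi> (\<lambda>j. w j x) *v column j (C x)) $ i"
        by simp
      then show "x ^ 3 * (mat_deriv (\<lambda>y. frame_matrix \<phi> (\<lambda>j. w j y)) x $ i $ j
        + (A x ** frame_matrix \<phi> (\<lambda>j. w j x)) $ i $ j) = (frame_matrix \<phi> (\<lambda>j. w j x) ** C x) $ i $ j"
        by (simp add: mat_deriv_def vec_deriv_def frame_matrix_def matrix_mult_2 matrix_vector_mult_2 column_def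
            distrib_left)
    qed
  qed
  with C(1,2) show ?thesis by (rule that)
qed

text \<open>
  The base change \<open>G\<close> from \<open>w\<close> to \<open>w'\<close> satisfies \<open>x\<^sup>3 G' + C G = G C'\<close>. It is meromorphic, and for
  \<open>\<Gamma> = x\<^sup>N G\<close> holomorphic the equation becomes \<open>x\<^sup>3 \<Gamma>' - N x\<^sup>2 \<Gamma> + C \<Gamma> = \<Gamma> C'\<close>. Its lowest
  coefficient is the assertion. The intertwiner need not be invertible, because the lowest
  coefficient of an invertible matrix of meromorphic functions may be singular.
\<close>

lemma order3_pole_parts_intertwined:
  assumes P: "order3_pole_part H w P" and P': "order3_pole_part H w' P'"
  obtains L :: "complex^2^2" where "L \<noteq> 0" "P ** L = L ** P'"
proof -
  let ?V = "\<lambda>x. frame_matrix \<phi> (\<lambda>j. w j x)" and ?V' = "\<lambda>x. frame_matrix \<phi> (\<lambda>j. w' j x)"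
  obtain C :: "complex \<Rightarrow> complex^2^2" where C: "\<And>i j. (\<lambda>x. C x $ i $ j) analytic_on {0}" "C 0 = P"
    "\<forall>\<^sub>F x in at 0. \<forall>i j. (\<lambda>y. ?V y $ i $ j) field_differentiable at x \<and>
      x ^ 3 * (mat_deriv ?V x $ i $ j + (A x ** ?V x) $ i $ j) = (?V x ** C x) $ i $ j"
    by (rule order3_pole_part_coords[OF P]) (rule that)
  obtain C' :: "complex \<Rightarrow> complex^2^2" where C': "\<And>i j. (\<lambda>x. C' x $ i $ j) analytic_on {0}" "C' 0 = P'"
    "\<forall>\<^sub>F x in at 0. \<forall>i j. (\<lambda>y. ?V' y $ i $ j) field_differentiable at x \<and>
      x ^ 3 * (mat_deriv ?V' x $ i $ j + (A x ** ?V' x) $ i $ j) = (?V' x ** C' x) $ i $ j"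
    by (rule order3_pole_part_coords[OF P']) (rule that)
  have wb: "mero_germ_basis H w" and wb': "mero_germ_basis H w'"
    using P P' unfolding order3_pole_part_def by auto
  have w: "mero_germ_section H (w j)" and w': "mero_germ_section H (w' j)" for j
    using wb wb' unfolding mero_germ_basis_def by blast+
  have wT: "\<forall>\<^sub>F z in at 0. \<forall>j. w j z \<in> Tot H \<and> pr H (w j z) = z"
    using w unfolding mero_germ_section_iff by (intro eventually_all_finite) blast
  obtain F :: "complex \<Rightarrow> complex^2^2" where F: "\<forall>\<^sub>F z in at 0. F z ** ?V z = mat 1"
    by (rule mero_germ_basis_coords[OF wb]) (rule that)
  obtain F' :: "complex \<Rightarrow> complex^2^2" where F': "\<forall>\<^sub>F z in at 0. F' z ** ?V' z = mat 1"
    by (rule mero_germ_basis_coords[OF wb']) (rule that)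
  have "\<forall>s. mero_germ_section H s \<longrightarrow> (\<exists>g :: complex \<Rightarrow> complex^2. (\<forall>i. (\<lambda>z. g z $ i) meromorphic_on {0}) \<and>
      (\<forall>\<^sub>F z in at 0. s z = lincomb H (g z) (\<lambda>i. w i z)))"
    using wb unfolding mero_germ_basis_def by (elim conjE)
  then have "\<exists>g :: complex \<Rightarrow> complex^2. (\<forall>i. (\<lambda>z. g z $ i) meromorphic_on {0}) \<and>
      (\<forall>\<^sub>F z in at 0. w' j z = lincomb H (g z) (\<lambda>i. w i z))" for j
    using w'[of j] by simp
  then obtain g :: "2 \<Rightarrow> complex \<Rightarrow> complex^2" where g: "\<And>j i. (\<lambda>z. g j z $ i) meromorphic_on {0}"
    "\<And>j. \<forall>\<^sub>F z in at 0. w' j z = lincomb H (g j z) (\<lambda>i. w i z)"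
    by metis
  obtain N \<gamma> where \<gamma>: "\<And>ij. \<gamma> ij analytic_on {0}"
    "\<forall>\<^sub>F z in at 0. \<forall>ij::2\<times>2. z ^ N * (g (snd ij) z $ fst ij) = \<gamma> ij z"
    by (rule meromorphic_family_clear_poles[of "\<lambda>ij z. g (snd ij) z $ fst ij", OF g(1)]) (rule that)
  define \<Gamma> :: "complex \<Rightarrow> complex^2^2" where "\<Gamma> z = (\<chi> i j. \<gamma> (i, j) z)" for z
  have \<Gamma>_an: "(\<lambda>z. \<Gamma> z $ i $ j) analytic_on {0}" for i j
    using \<gamma>(1) by (simp add: \<Gamma>_def)
  have gA: "\<forall>\<^sub>F z in at 0. \<forall>j. w' j z = lincomb H (g j z) (\<lambda>i. w i z)"
    by (intro eventually_all_finite g)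
  have V\<Gamma>: "\<forall>\<^sub>F z in at 0. \<forall>i j. z ^ N * ?V' z $ i $ j = (?V z ** \<Gamma> z) $ i $ j"
    using eventually_in_U wT gA \<gamma>(2)
  proof eventually_elim
    case (elim z)
    show ?case
    proof (intro allI)
      fix i j
      have "\<phi> (w' j z) = ?V z *v g j z"
        using elim(3) chart_lincomb[OF elim(1), of "\<lambda>i. w i z"] elim(2) by simp
      moreover have "\<Gamma> z $ k $ j = z ^ N * g j z $ k" for k
        using elim(4)[rule_format, of "(k, j)"] by (simp add: \<Gamma>_def)
      ultimately show "z ^ N * ?V' z $ i $ j = (?V z ** \<Gamma> z) $ i $ j"
        by (simp add: frame_matrix_def matrix_mult_2 matrix_vector_mult_2 algebra_simps)
    qed
  qed
  have \<Gamma>_diff: "\<forall>\<^sub>F x in at 0. \<forall>i j. (\<lambda>y. \<Gamma> y $ i $ j) field_differentiable at x"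
  proof (intro eventually_all_finite)
    fix i j
    have "\<forall>\<^sub>F x in nhds 0. (\<lambda>y. \<Gamma> y $ i $ j) field_differentiable at x"
    proof -
      obtain S where S: "open S" "0 \<in> S" "(\<lambda>y. \<Gamma> y $ i $ j) holomorphic_on S"
        using \<Gamma>_an[of i j] unfolding analytic_at by blast
      show ?thesis
        using eventually_nhds_in_open[OF S(1,2)]
        by eventually_elim (rule holomorphic_on_imp_differentiable_at[OF S(3,1)])
    qed
    then show "\<forall>\<^sub>F x in at 0. (\<lambda>y. \<Gamma> y $ i $ j) field_differentiable at x"
      by (auto simp: eventually_nhds_conv_at)
  qed
  define R where "R x = (\<chi> i j. x ^ 3 * mat_deriv \<Gamma> x $ i $ j - of_nat N * x\<^sup>2 * \<Gamma> x $ i $ j)" for x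
  have rel: "\<forall>\<^sub>F x in at 0. R x + C x ** \<Gamma> x = \<Gamma> x ** C' x"
    using C(3) C'(3) F \<Gamma>_diff eventually_at_nhds[OF V\<Gamma>] eventually_neq_at_within[of 0]
  proof eventually_elim
    case (elim x)
    have V\<Gamma>x: "x ^ N * ?V' x $ i $ j = (?V x ** \<Gamma> x) $ i $ j" for i j
      using eventually_nhds_x_imp_x[OF elim(5)] by blast
    have dV\<Gamma>: "of_nat N * x ^ N * ?V' x $ i $ j + x * x ^ N * mat_deriv ?V' x $ i $ j =
        x * ((mat_deriv ?V x ** \<Gamma> x) $ i $ j + (?V x ** mat_deriv \<Gamma> x) $ i $ j)" for i j
    proof -
      have dV: "((\<lambda>y. ?V y $ i $ j) has_field_derivative mat_deriv ?V x $ i $ j) (at x)" for i j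
        using elim(1) by (simp add: mat_deriv_def field_differentiable_derivI)
      have dV': "((\<lambda>y. ?V' y $ i $ j) has_field_derivative mat_deriv ?V' x $ i $ j) (at x)" for i j
        using elim(2) by (simp add: mat_deriv_def field_differentiable_derivI)
      have d\<Gamma>: "((\<lambda>y. \<Gamma> y $ i $ j) has_field_derivative mat_deriv \<Gamma> x $ i $ j) (at x)" for i j
        using elim(4) by (simp add: mat_deriv_def field_differentiable_derivI)
      have "((\<lambda>y. y ^ N * ?V' y $ i $ j) has_field_derivative
          of_nat N * x ^ (N - 1) * ?V' x $ i $ j + mat_deriv ?V' x $ i $ j * x ^ N) (at x)"
        by (rule DERIV_cong[OF DERIV_mult[OF DERIV_power[OF DERIV_ident] dV']]) simp
      moreover have "((\<lambda>y. (?V y ** \<Gamma> y) $ i $ j) has_field_derivative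
          (mat_deriv ?V x ** \<Gamma> x) $ i $ j + (?V x ** mat_deriv \<Gamma> x) $ i $ j) (at x)"
        unfolding matrix_mult_2
        by (rule DERIV_cong[OF DERIV_add[OF DERIV_mult[OF dV d\<Gamma>] DERIV_mult[OF dV d\<Gamma>]]]) (simp add: algebra_simps)
      then have "((\<lambda>y. y ^ N * ?V' y $ i $ j) has_field_derivative
          (mat_deriv ?V x ** \<Gamma> x) $ i $ j + (?V x ** mat_deriv \<Gamma> x) $ i $ j) (at x)"
        by (rule DERIV_cong_ev[THEN iffD2, rotated -1, OF _ refl _ refl]) (rule eventually_mono[OF elim(5)], simp)
      ultimately have "of_nat N * x ^ (N - 1) * ?V' x $ i $ j + mat_deriv ?V' x $ i $ j * x ^ N =
          (mat_deriv ?V x ** \<Gamma> x) $ i $ j + (?V x ** mat_deriv \<Gamma> x) $ i $ j"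
        by (rule DERIV_unique)
      moreover have "of_nat N * x ^ N * ?V' x $ i $ j + x * x ^ N * mat_deriv ?V' x $ i $ j =
          x * (of_nat N * x ^ (N - 1) * ?V' x $ i $ j + mat_deriv ?V' x $ i $ j * x ^ N)"
        by (cases N) (simp_all add: algebra_simps)
      ultimately show ?thesis by simp
    qed
    \<comment> \<open>both bases express \<open>\<nabla> w'\<close>; \<open>F\<close> then cancels the invertible matrix of \<open>w\<close>\<close>
    have "?V x ** (R x + C x ** \<Gamma> x) = ?V x ** (\<Gamma> x ** C' x)"
    proof (simp only: vec_eq_iff, intro allI)
      fix i j
      have VR: "(?V x ** R x) $ i $ j = x ^ 3 * (?V x ** mat_deriv \<Gamma> x) $ i $ j - of_nat N * x\<^sup>2 * (x ^ N * ?V' x $ i $ j)"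
        by (simp add: V\<Gamma>x R_def matrix_mult_2 algebra_simps)
      have VC\<Gamma>: "(?V x ** (C x ** \<Gamma> x)) $ i $ j =
          x ^ 3 * (mat_deriv ?V x ** \<Gamma> x) $ i $ j + x ^ 3 * (A x ** (?V x ** \<Gamma> x)) $ i $ j"
      proof -
        have "(?V x ** (C x ** \<Gamma> x)) $ i $ j = ((?V x ** C x) ** \<Gamma> x) $ i $ j"
          by (simp add: matrix_mul_assoc)
        also have "\<dots> = x ^ 3 * ((mat_deriv ?V x ** \<Gamma> x) $ i $ j + ((A x ** ?V x) ** \<Gamma> x) $ i $ j)"
          using elim(1) unfolding matrix_mult_2[of _ "\<Gamma> x"] by (simp flip: elim(1)) (simp add: algebra_simps)
        finally show ?thesis
          by (simp add: matrix_mul_assoc distrib_left)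
      qed
      have AV\<Gamma>: "(A x ** (?V x ** \<Gamma> x)) $ i $ j = x ^ N * (A x ** ?V' x) $ i $ j"
        unfolding matrix_mult_2[of "A x"] V\<Gamma>x[symmetric] by (simp add: algebra_simps)
      have "(?V x ** (\<Gamma> x ** C' x)) $ i $ j = ((?V x ** \<Gamma> x) ** C' x) $ i $ j"
        by (simp add: matrix_mul_assoc)
      also have "\<dots> = x ^ N * (?V' x ** C' x) $ i $ j"
        unfolding matrix_mult_2[of _ "C' x"] V\<Gamma>x[symmetric] by (simp add: algebra_simps)
      also have "\<dots> = x ^ N * (x ^ 3 * (mat_deriv ?V' x $ i $ j + (A x ** ?V' x) $ i $ j))"
        using elim(2) by simp
      finally have VGC: "(?V x ** (\<Gamma> x ** C' x)) $ i $ j =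
          x ^ N * (x ^ 3 * (mat_deriv ?V' x $ i $ j + (A x ** ?V' x) $ i $ j))" .
      have "x\<^sup>2 * (of_nat N * x ^ N * ?V' x $ i $ j + x * x ^ N * mat_deriv ?V' x $ i $ j) =
          x\<^sup>2 * (x * ((mat_deriv ?V x ** \<Gamma> x) $ i $ j + (?V x ** mat_deriv \<Gamma> x) $ i $ j))"
        by (simp only: dV\<Gamma>)
      then have "x ^ 3 * (?V x ** mat_deriv \<Gamma> x) $ i $ j - of_nat N * x\<^sup>2 * (x ^ N * ?V' x $ i $ j)
          + x ^ 3 * (mat_deriv ?V x ** \<Gamma> x) $ i $ j = x ^ N * (x ^ 3 * mat_deriv ?V' x $ i $ j)"
        by (simp add: power2_eq_square power3_eq_cube algebra_simps)
      then show "(?V x ** (R x + C x ** \<Gamma> x)) $ i $ j = (?V x ** (\<Gamma> x ** C' x)) $ i $ j"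
        unfolding VGC matrix_add_ldistrib vector_add_component VR VC\<Gamma> AV\<Gamma> by (simp add: algebra_simps)
    qed
    then have "F x ** (?V x ** (R x + C x ** \<Gamma> x)) = F x ** (?V x ** (\<Gamma> x ** C' x))"
      by simp
    then show ?case
      unfolding matrix_mul_assoc[of "F x"] elim(3) by simp
  qed
  have d\<Gamma>_an: "(\<lambda>x. mat_deriv \<Gamma> x $ i $ j) analytic_on {0}" for i j
    unfolding mat_deriv_def vec_lambda_beta by (intro analytic_intros \<Gamma>_an)
  have R_an: "(\<lambda>x. R x $ i $ j) analytic_on {0}" for i j
    unfolding R_def vec_lambda_beta by (intro analytic_intros d\<Gamma>_an \<Gamma>_an)
  have "\<forall>\<^sub>F x in nhds 0. (R x + C x ** \<Gamma> x) $ i $ j = (\<Gamma> x ** C' x) $ i $ j" for i j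
  proof (rule analytic_eventually_eq)
    show "(\<lambda>x. (R x + C x ** \<Gamma> x) $ i $ j) analytic_on {0}" "(\<lambda>x. (\<Gamma> x ** C' x) $ i $ j) analytic_on {0}"
      unfolding matrix_mult_2 vector_add_component by (intro analytic_intros R_an C(1) C'(1) \<Gamma>_an)+
    show "\<forall>\<^sub>F x in at 0. (R x + C x ** \<Gamma> x) $ i $ j = (\<Gamma> x ** C' x) $ i $ j"
      using rel by eventually_elim simp
  qed
  then have "\<forall>\<^sub>F x in nhds 0. \<forall>i j. (R x + C x ** \<Gamma> x) $ i $ j = (\<Gamma> x ** C' x) $ i $ j"
    by (intro eventually_all_finite)
  then have "\<forall>\<^sub>F x in nhds 0. R x + C x ** \<Gamma> x = \<Gamma> x ** C' x"
    by (rule eventually_mono) (simp add: vec_eq_iff)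
  from fps_matrix_cong[OF this]
  have "fps_matrix R + fps_matrix C ** fps_matrix \<Gamma> = fps_matrix \<Gamma> ** fps_matrix C'"
    by (simp add: fps_matrix_add fps_matrix_mult R_an \<Gamma>_an C(1) C'(1) matrix_mult_2 analytic_intros)
  moreover have "fps_matrix R = (\<chi> i j. fps_X ^ 3 * fps_deriv (fps_matrix \<Gamma> $ i $ j)
      - of_nat N * fps_X\<^sup>2 * fps_matrix \<Gamma> $ i $ j)"
  proof (rule fps_matrix_eqI)
    fix i j
    show "(\<lambda>z. R z $ i $ j) has_fps_expansion (\<chi> i j. fps_X ^ 3 * fps_deriv (fps_matrix \<Gamma> $ i $ j)
      - of_nat N * fps_X\<^sup>2 * fps_matrix \<Gamma> $ i $ j) $ i $ j"
      unfolding R_def mat_deriv_def vec_lambda_beta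
      by (intro fps_expansion_intros has_fps_expansion_fps_matrix \<Gamma>_an
          has_fps_expansion_const[of "of_nat N :: complex", unfolded fps_of_nat])
  qed
  ultimately have eq: "(\<chi> i j. fps_X ^ 3 * fps_deriv (fps_matrix \<Gamma> $ i $ j)
      - of_nat N * fps_X\<^sup>2 * fps_matrix \<Gamma> $ i $ j) + fps_matrix C ** fps_matrix \<Gamma> = fps_matrix \<Gamma> ** fps_matrix C'"
    by simp
  have "fps_matrix \<Gamma> \<noteq> 0"
  proof
    assume "fps_matrix \<Gamma> = 0"
    then have "\<forall>\<^sub>F z in nhds 0. \<Gamma> z = 0"
      by (rule fps_matrix_0_imp[OF \<Gamma>_an])
    then have "\<forall>\<^sub>F z in at 0. \<Gamma> z = 0"
      by (simp add: eventually_nhds_conv_at)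
    with V\<Gamma> F' eventually_neq_at_within[of 0] have "\<forall>\<^sub>F z in at (0::complex). False"
    proof eventually_elim
      case (elim z)
      have "?V' z = 0"
        using elim(1,3,4) by (simp add: vec_eq_iff)
      then have "(mat 1 :: complex^2^2) = 0"
        using elim(2) by simp
      then show False
        by (simp add: vec_eq_iff forall_2 mat_def)
    qed
    then show False by simp
  qed
  then obtain L :: "complex^2^2" where L: "L \<noteq> 0"
    "(\<chi> i j. fps_nth (fps_matrix C $ i $ j) 0) ** L = L ** (\<chi> i j. fps_nth (fps_matrix C' $ i $ j) 0)"
    by (rule leading_coefficient_intertwines[OF eq])
  have "(\<chi> i j. fps_nth (fps_matrix C $ i $ j) 0) = P" "(\<chi> i j. fps_nth (fps_matrix C' $ i $ j) 0) = P'"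
    by (simp_all add: vec_eq_iff fps_nth_fps_matrix_0 C(1,2) C'(1,2))
  with L show ?thesis using that by simp
qed

end



section \<open>The pullback of a normalised structure\<close>

lemma eventually_at_0_power:
  assumes "\<forall>\<^sub>F z in at (0::complex). P z" "n > 0"
  shows "\<forall>\<^sub>F x in at 0. P (x ^ n)"
proof -
  have "filterlim (\<lambda>x::complex. x ^ n) (at 0) (at 0)"
    unfolding filterlim_at
  proof
    show "\<forall>\<^sub>F x::complex in at 0. x ^ n \<in> UNIV \<and> x ^ n \<noteq> 0"
      using eventually_neq_at_within[of 0] by eventually_elim simp
    show "((\<lambda>x::complex. x ^ n) \<longlongrightarrow> 0) (at 0)"
      using \<open>n > 0\<close> by (auto intro!: tendsto_eq_intros simp: power_0_left)
  qed
  then show ?thesis using assms(1) by (rule filterlim_iff[THEN iffD1, rule_format])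
qed

lemma square_of_semisimple:
  assumes "semisimple_with_eigenvalues P \<kappa> (- \<kappa>)"
  shows "(P ** P) = mat (\<kappa>\<^sup>2)"
proof -
  let ?D = "vector [vector [\<kappa>, 0], vector [0, - \<kappa>]] :: complex^2^2"
  obtain Q :: "complex^2^2" where Q: "invertible Q" "P ** Q = Q ** ?D"
    using assms unfolding semisimple_with_eigenvalues_def by blast
  have DD: "?D ** ?D = mat (\<kappa>\<^sup>2)"
    by (simp add: vec_eq_iff forall_2 matrix_mult_2 mat_def power2_eq_square)
  have comm: "Q ** mat (\<kappa>\<^sup>2) = mat (\<kappa>\<^sup>2) ** Q"
    by (simp add: vec_eq_iff forall_2 matrix_mult_2 mat_def mult.commute)
  have "P ** P ** Q = P ** (Q ** ?D)"
    by (simp only: matrix_mul_assoc[symmetric] Q(2))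
  also have "\<dots> = Q ** (?D ** ?D)"
    by (simp only: matrix_mul_assoc Q(2))
  finally have "P ** P ** Q = mat (\<kappa>\<^sup>2) ** Q"
    by (simp only: DD comm)
  then have "P ** P ** (Q ** matrix_inv Q) = mat (\<kappa>\<^sup>2) ** (Q ** matrix_inv Q)"
    by (simp only: matrix_mul_assoc)
  then show ?thesis
    by (simp add: invertible_matrix_inv[OF Q(1)])
qed

context normalised_te_chart
begin

abbreviation "K \<equiv> pullback4 H"
abbreviation "V \<equiv> (\<lambda>x::complex. x ^ 4) -` U"
abbreviation "\<psi> \<equiv> \<lambda>p :: complex \<times> _. \<phi> (snd p)"

lemma pullback_pointed_conn_chart:
  "pointed_conn_chart K V \<psi> (\<lambda>x. \<chi> i j. 4 * x ^ 3 * (M (x ^ 4) $ i $ j / (x ^ 4)\<^sup>2))"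
proof (intro pointed_conn_chart.intro pointed_chart.intro pointed_chart_axioms.intro)
  show "bundle_chart K V \<psi>" by (rule pullback_chart)
  show "0 \<in> V" using zero_in_U by simp
  show "conn_chart K V \<psi> (\<lambda>x. \<chi> i j. 4 * x ^ 3 * (M (x ^ 4) $ i $ j / (x ^ 4)\<^sup>2))"
    using conn_chart_pullback4[OF conn_chart pullback_chart] by simp
qed

sublocale K: pointed_conn_chart K V \<psi> "\<lambda>x. \<chi> i j. 4 * x ^ 3 * (M (x ^ 4) $ i $ j / (x ^ 4)\<^sup>2)"
  by (rule pullback_pointed_conn_chart)

text \<open>
  In coordinates both conditions say that the components are meromorphic: the pullbacks of the two
  coordinate sections generate all meromorphic germs.
\<close>

lemma pullback4_module_iff: "pullback4_module H t \<longleftrightarrow> mero_germ_section K t"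
proof
  assume "pullback4_module H t"
  then show "mero_germ_section K t"
  proof induction
    case (generator s f t)
    have sT: "\<forall>\<^sub>F z in at 0. s z \<in> Tot H \<and> pr H (s z) = z" and s_mero: "\<And>i. (\<lambda>z. \<phi> (s z) $ i) meromorphic_on {0}"
      using generator(1) unfolding mero_germ_section_iff by auto
    have sT4: "\<forall>\<^sub>F x in at 0. s (x ^ 4) \<in> Tot H \<and> pr H (s (x ^ 4)) = x ^ 4"
      by (rule eventually_at_0_power[OF sT]) simp
    show ?case
      unfolding K.mero_germ_section_iff
    proof (intro conjI allI)
      show "\<forall>\<^sub>F x in at 0. t x \<in> Tot K \<and> pr K (t x) = x"
        using generator(3) sT4 by eventually_elim (simp add: Tot_fscale pr_fscale)
      fix i
      have ev: "\<forall>\<^sub>F x in at 0. \<psi> (t x) $ i = f x * \<phi> (s (x ^ 4)) $ i"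
        using generator(3) sT4 K.eventually_in_U by eventually_elim (simp add: chart_fscale)
      have "(\<lambda>x. \<phi> (s (x ^ 4)) $ i) meromorphic_on {0}"
        by (rule meromorphic_on_compose[OF s_mero]) (auto intro!: analytic_intros)
      then have "(\<lambda>x. f x * \<phi> (s (x ^ 4)) $ i) meromorphic_on {0}"
        by (intro meromorphic_intros generator(2))
      then show "(\<lambda>x. \<psi> (t x) $ i) meromorphic_on {0}"
        by (simp only: meromorphic_on_0_cong[OF ev])
    qed
  next
    case (add t1 t2 t)
    have T: "\<forall>\<^sub>F x in at 0. t1 x \<in> Tot K \<and> pr K (t1 x) = x" "\<forall>\<^sub>F x in at 0. t2 x \<in> Tot K \<and> pr K (t2 x) = x"
      and mero: "\<And>i. (\<lambda>x. \<psi> (t1 x) $ i) meromorphic_on {0}" "\<And>i. (\<lambda>x. \<psi> (t2 x) $ i) meromorphic_on {0}"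
      using add(4,5) unfolding K.mero_germ_section_iff by auto
    show ?case
      unfolding K.mero_germ_section_iff
    proof (intro conjI allI)
      show "\<forall>\<^sub>F x in at 0. t x \<in> Tot K \<and> pr K (t x) = x"
        using add(3) T
      proof eventually_elim
        case (elim x)
        then show ?case using K.Tot_fadd[of "t1 x" "t2 x"] K.pr_fadd[of "t1 x" "t2 x"] by metis
      qed
      fix i
      have ev: "\<forall>\<^sub>F x in at 0. \<psi> (t x) $ i = \<psi> (t1 x) $ i + \<psi> (t2 x) $ i"
        using add(3) T K.eventually_in_U
      proof eventually_elim
        case (elim x)
        then have "\<psi> (t x) = \<psi> (t1 x) + \<psi> (t2 x)"
          using K.chart_fadd[of "t1 x" "t2 x"] by metis
        then show ?case by simp
      qed
      show "(\<lambda>x. \<psi> (t x) $ i) meromorphic_on {0}"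
        unfolding meromorphic_on_0_cong[OF ev] by (intro meromorphic_intros mero)
    qed
  qed
next
  assume "mero_germ_section K t"
  then have T: "\<forall>\<^sub>F x in at 0. t x \<in> Tot K \<and> pr K (t x) = x" and mero: "\<And>i. (\<lambda>x. \<psi> (t x) $ i) meromorphic_on {0}"
    unfolding K.mero_germ_section_iff by auto
  define e where "e j z = pt z (axis j 1)" for j :: 2 and z
  define t' where "t' j x = fscale K (\<psi> (t x) $ j) (x, e j (x ^ 4))" for j x
  have e_mero: "mero_germ_section H (e j)" for j
    unfolding mero_germ_section_iff e_def
  proof (intro conjI allI)
    show "\<forall>\<^sub>F z in at 0. pt z (axis j 1) \<in> Tot H \<and> pr H (pt z (axis j 1)) = z"
      using eventually_in_U by eventually_elim (simp add: Tot_pt pr_pt)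
    fix i
    have ev: "\<forall>\<^sub>F z in at 0. \<phi> (pt z (axis j 1)) $ i = axis j 1 $ i"
      using eventually_in_U by eventually_elim (simp add: chart_pt)
    show "(\<lambda>z. \<phi> (pt z (axis j 1)) $ i) meromorphic_on {0}"
      unfolding meromorphic_on_0_cong[OF ev] by (rule meromorphic_on_const)
  qed
  have gen: "pullback4_module H (t' j)" for j
    by (rule pullback4_module.generator[OF e_mero[of j] mero[of j]]) (simp add: t'_def)
  have "\<forall>\<^sub>F x in at 0. t x = fadd K (t' 1 x) (t' 2 x)"
    using T K.eventually_in_U
  proof eventually_elim
    case (elim x)
    have x4: "x ^ 4 \<in> U" using elim(2) by simp
    have t'T: "t' j x \<in> Tot K" "pr K (t' j x) = x" for j
      by (simp_all add: t'_def e_def Tot_fscale pr_fscale Tot_pt[OF x4] pr_pt[OF x4])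
    have "\<psi> (t' j x) = \<psi> (t x) $ j *s axis j 1" for j
      by (simp add: t'_def e_def chart_fscale Tot_pt[OF x4] pr_pt[OF x4] chart_pt[OF x4] x4)
    then have "\<psi> (fadd K (t' 1 x) (t' 2 x)) = \<psi> (t x)"
      using K.chart_fadd[OF t'T(1) t'T(1), of 1 2] t'T(2) elim(2)
      by (simp add: vec2_eq_iff axis_def)
    then show ?case
      using K.Tot_fadd[OF t'T(1) t'T(1), of 1 2] K.pr_fadd[OF t'T(1) t'T(1), of 1 2] t'T(2) elim
      by (intro K.chart_inj[of _ _ x]) simp_all
  qed
  then show "pullback4_module H t"
    by (rule pullback4_module.add[OF gen gen])
qed

text \<open>
  The pole part of the basis \<open>(v\<^sub>1, x\<^sup>2 v\<^sub>2)\<close> of the pullback.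
\<close>

definition pullback_pole :: "complex^2^2" where
  "pullback_pole = vector [vector [0, 4], vector [- 4 * delta H 1, 0]]"

lemma pullback_pole_square: "pullback_pole ** pullback_pole = mat (- 16 * delta H 1)"
  by (simp add: pullback_pole_def vec_eq_iff forall_2 matrix_mult_2 mat_def)

text \<open>
  The coefficient of the pullback is \<open>4 M(x\<^sup>4) / x\<^sup>5\<close>. The basis change \<open>diag (1, x\<^sup>2)\<close> balances its two
  off-diagonal entries \<open>4 b12 / x\<^sup>5\<close> and \<open>4 b21 / x\<close>: both get order \<open>-3\<close>, while the diagonal
  contributes only from order \<open>-1\<close> on.
\<close>

lemma order3_pole_part_pullback: "\<exists>w. order3_pole_part K w pullback_pole"
proof -
  define c :: "2 \<Rightarrow> complex \<Rightarrow> complex^2" where "c j x = (if j = 1 then axis 1 1 else x\<^sup>2 *s axis 2 1)" for j x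
  define w where "w j x = K.pt x (c j x)" for j x
  define D :: "complex \<Rightarrow> complex^2^2" where "D x = vector [vector [1, 0], vector [0, x\<^sup>2]]" for x
  define C :: "complex \<Rightarrow> complex^2^2" where
    "C x = vector [vector [4 * x\<^sup>2 * b11 (x ^ 4), 4 * b12 (x ^ 4)],
                   vector [4 * b21 (x ^ 4), 2 * x\<^sup>2 + 4 * x\<^sup>2 * b22 (x ^ 4)]]" for x
  have c_hol: "(\<lambda>x. c j x $ i) holomorphic_on S" for i j S
    by (cases "j = 1") (simp_all add: c_def holomorphic_intros)
  have w_sec: "hol_section K V (w j)" for j
    unfolding w_def by (rule K.hol_section_pt[OF K.open_U subset_refl c_hol])
  have w_mero: "mero_germ_section K (w j)" for j
    unfolding mero_germ_section_def
  proof (intro exI conjI)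
    show "germ_section K (w j)"
      unfolding germ_section_def by (intro exI[of _ V] conjI w_sec K.zero_in_U)
    show "\<forall>\<^sub>F x in at 0. w j x = fscale K (inverse (x ^ 0)) (w j x)"
      using K.eventually_in_U
    proof eventually_elim
      case (elim x)
      show ?case
        by (rule K.chart_inj[of _ _ x])
          (use elim K.Tot_pt[OF elim] K.pr_pt[OF elim] in \<open>simp_all add: w_def Tot_fscale pr_fscale chart_fscale\<close>)
    qed
  qed
  have \<psi>w: "\<psi> (w j x) = c j x" if "x \<in> V" for j x
    using K.chart_pt[OF that] by (simp add: w_def)
  have frame: "frame_matrix \<psi> (\<lambda>j. w j x) = D x" if "x \<in> V" for x
    using \<psi>w[OF that] by (simp add: frame_matrix_def D_def c_def vec_eq_iff forall_2 axis_def)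
  have basis: "mero_germ_basis K w"
  proof (rule K.mero_germ_basisI[OF w_mero])
    show "\<forall>\<^sub>F x in at 0. frame_matrix \<psi> (\<lambda>j. w j x) = D x"
      using K.eventually_in_U by eventually_elim (rule frame)
    let ?F = "\<lambda>x. vector [vector [1, 0], vector [0, inverse (x\<^sup>2)]] :: complex^2^2"
    show "(\<lambda>x. ?F x $ i $ j) meromorphic_on {0}" for i j
      using exhaust_2[of i] exhaust_2[of j] by (auto intro!: meromorphic_intros)
    show "\<forall>\<^sub>F x in at 0. ?F x ** D x = mat 1"
      using eventually_neq_at_within[of 0]
      by eventually_elim (simp add: D_def vec_eq_iff forall_2 matrix_mult_2 mat_def)
  qed
  have C_an: "(\<lambda>x. C x $ i $ j) analytic_on {0}" for i j
  proof -
    have "(\<lambda>x. f (x ^ 4)) analytic_on {0}" if "f holomorphic_on U" for f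
      using holomorphic_on_power_arg[OF that, of V 4] K.open_U K.zero_in_U by (auto simp: analytic_at)
    note b = this[OF b_hol(1)] this[OF b_hol(2)] this[OF b_hol(3)] this[OF b_hol(4)]
    show ?thesis
      using exhaust_2[of i] exhaust_2[of j] by (auto simp: C_def intro!: analytic_intros b)
  qed
  have C_0: "C 0 = pullback_pole"
    by (simp add: C_def pullback_pole_def b12_0 b21_0 vec_eq_iff forall_2)
  have "\<forall>\<^sub>F x in at 0. fscale K x (conn K (w j) x) = lincomb K (inverse (x\<^sup>2) *s column j (C x)) (\<lambda>i. w i x)" for j
    using K.eventually_in_U eventually_neq_at_within[of 0]
  proof eventually_elim
    case (elim x)
    have wT: "w i x \<in> Tot K" "pr K (w i x) = x" for i
      using K.Tot_pt[OF elim(1)] K.pr_pt[OF elim(1)] by (simp_all add: w_def)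
    note cw = K.conn_section[OF w_sec elim(1,1,2), of j]
    have "vec_deriv (\<lambda>y. \<psi> (w j y)) x = vec_deriv (c j) x"
      using eventually_nhds_in_open[OF K.open_U elim(1)]
      by (intro vec_deriv_cong) (auto elim!: eventually_mono intro: \<psi>w)
    also have "\<dots> = (if j = 1 then 0 else (2 * x) *s axis 2 1)"
      by (rule vec_deriv_eqI)
        (use exhaust_2[of j] in \<open>auto simp: c_def axis_def intro!: derivative_eq_intros\<close>)
    finally have vd: "vec_deriv (\<lambda>y. \<psi> (w j y)) x = (if j = 1 then 0 else (2 * x) *s axis 2 1)" .
    have "\<psi> (fscale K x (conn K (w j) x)) = x *s \<psi> (conn K (w j) x)"
      using cw elim(1) by (intro K.chart_fscale) auto
    also have "\<dots> = x *s ((if j = 1 then 0 else (2 * x) *s axis 2 1) +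
        (\<chi> i j. 4 * x ^ 3 * (M (x ^ 4) $ i $ j / (x ^ 4)\<^sup>2)) *v c j x)"
      using cw vd \<psi>w[OF elim(1)] by simp
    also have "\<dots> = D x *v (inverse (x\<^sup>2) *s column j (C x))"
      using elim(2) exhaust_2[of j]
      by (auto simp: vec2_eq_iff matrix_vector_mult_2 D_def C_def column_def c_def axis_def M_entries
          field_simps eval_nat_numeral)
    also have "\<dots> = \<psi> (lincomb K (inverse (x\<^sup>2) *s column j (C x)) (\<lambda>i. w i x))"
      using K.chart_lincomb[OF elim(1) wT] frame[OF elim(1)] by simp
    finally show ?case
      using cw K.Tot_fscale[of "conn K (w j) x" x] K.pr_fscale[of "conn K (w j) x" x]
        K.Tot_lincomb[OF elim(1) wT] K.pr_lincomb[OF elim(1) wT]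
      by (intro K.chart_inj[of _ _ x]) (use elim(1) in auto)
  qed
  moreover have "pullback_pole \<noteq> 0"
  proof
    assume "pullback_pole = 0"
    from arg_cong[OF this, of "\<lambda>P. P $ 1 $ 2"] show False by (simp add: pullback_pole_def)
  qed
  ultimately have "order3_pole_part K w pullback_pole"
    unfolding order3_pole_part_def using basis C_an C_0 by blast
  then show ?thesis by blast
qed

text \<open>
  Squares of the intertwined pole parts are scalars, and a nonzero intertwiner makes them equal.
\<close>

lemma pullback_eigenvalue_square:
  assumes "pullback_eigenvalue H \<kappa>"
  shows "\<kappa>\<^sup>2 = - 16 * delta H 1"
proof -
  obtain w' P' where P': "order3_pole_part K w' P'" "semisimple_with_eigenvalues P' \<kappa> (- \<kappa>)"
    using assms unfolding pullback_eigenvalue_def by blast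
  obtain w where w: "order3_pole_part K w pullback_pole"
    using order3_pole_part_pullback by blast
  obtain L :: "complex^2^2" where L: "L \<noteq> 0" "pullback_pole ** L = L ** P'"
    by (rule K.order3_pole_parts_intertwined[OF w P'(1)]) (rule that)
  have "pullback_pole ** pullback_pole ** L = pullback_pole ** (L ** P')"
    by (simp only: matrix_mul_assoc[symmetric] L(2))
  also have "\<dots> = L ** (P' ** P')"
    by (simp only: matrix_mul_assoc L(2))
  finally have "mat (- 16 * delta H 1) ** L = L ** mat (\<kappa>\<^sup>2)"
    by (simp only: pullback_pole_square square_of_semisimple[OF P'(2)])
  then have "(- 16 * delta H 1) * L $ i $ j = \<kappa>\<^sup>2 * L $ i $ j" for i j
    using exhaust_2[of i] exhaust_2[of j]
    by (auto simp: vec_eq_iff forall_2 matrix_mult_2 mat_def mult.commute)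
  moreover obtain i j where "L $ i $ j \<noteq> 0"
    using L(1) by (auto simp: vec_eq_iff)
  ultimately show ?thesis by (metis mult_right_cancel)
qed

lemma pullback_eigenvalue_exists:
  assumes \<delta>: "delta H 1 \<noteq> 0"
  shows "\<exists>\<kappa>. pullback_eigenvalue H \<kappa>"
proof -
  define \<kappa> where "\<kappa> = csqrt (- 16 * delta H 1)"
  have \<kappa>: "\<kappa> * \<kappa> = - 16 * delta H 1"
    by (simp add: \<kappa>_def flip: power2_eq_square)
  then have "\<kappa> \<noteq> 0" using \<delta> by auto
  define Q :: "complex^2^2" where "Q = vector [vector [4, 4], vector [\<kappa>, - \<kappa>]]"
  have "invertible Q"
    using \<open>\<kappa> \<noteq> 0\<close> by (simp add: invertible_det_nz det_2 Q_def)
  moreover have "pullback_pole ** Q = Q ** vector [vector [\<kappa>, 0], vector [0, - \<kappa>]]"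
    by (simp add: vec_eq_iff forall_2 matrix_mult_2 Q_def pullback_pole_def \<kappa>)
  ultimately have "semisimple_with_eigenvalues pullback_pole \<kappa> (- \<kappa>)"
    unfolding semisimple_with_eigenvalues_def by blast
  then show ?thesis
    using order3_pole_part_pullback unfolding pullback_eigenvalue_def by blast
qed

lemma regular_singular_iff: "regular_singular H \<longleftrightarrow> delta H 1 = 0"
  using type_Bra_not_regular type_Reg_regular by blast

lemma pole_part_nilpotent:
  assumes "e \<in> Tot H" "pr H e = 0"
  shows "pole_part H (pole_part H e) = fscale H 0 e"
proof (rule chart_inj[of _ _ 0])
  note pt0 = Tot_pt[OF zero_in_U] pr_pt[OF zero_in_U] chart_pt[OF zero_in_U]
  show "pole_part H (pole_part H e) \<in> Tot H" "pr H (pole_part H (pole_part H e)) = 0"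
    by (simp_all add: pole_part_eq assms pt0)
  have "M 0 ** M 0 = 0"
    by (simp add: M_0 vec_eq_iff forall_2 matrix_mult_2)
  then show "\<phi> (pole_part H (pole_part H e)) = \<phi> (fscale H 0 e)"
    by (simp add: pole_part_eq assms pt0 chart_fscale zero_in_U matrix_vector_mul_assoc)
qed (use assms zero_in_U in \<open>simp_all add: Tot_fscale pr_fscale\<close>)

lemma pole_part_nonzero: "\<exists>e\<in>Tot H. pr H e = 0 \<and> pole_part H e \<noteq> fscale H 0 e"
proof (intro bexI conjI)
  let ?e = "pt 0 (axis 2 1)"
  note pt0 = Tot_pt[OF zero_in_U] pr_pt[OF zero_in_U] chart_pt[OF zero_in_U]
  show "?e \<in> Tot H" "pr H ?e = 0" by (simp_all add: pt0)
  have "\<phi> (pole_part H ?e) $ 1 = 1"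
    by (simp add: pole_part_eq pt0 matrix_vector_mult_2 M_0_entries axis_def)
  moreover have "\<phi> (fscale H 0 ?e) $ 1 = 0"
    by (simp add: chart_fscale pt0 zero_in_U)
  ultimately show "pole_part H ?e \<noteq> fscale H 0 ?e" by auto
qed

end

section \<open>Formal invariance and the theorem\<close>

text \<open>
  Two charts are linked by three base changes: from one chart to a basis, formally to a basis of the
  other structure, and from there to its chart.
\<close>

lemma formally_isomorphic_pole:
  assumes iso: "formally_isomorphic H H'" and te: "te_chart H U \<phi> M" and te': "te_chart H' U' \<phi>' M'"
  shows "delta H' 1 = delta H 1" "trace (M' 0) = trace (M 0)" "det (M' 0) = det (M 0)" "M' 0 = 0 \<longleftrightarrow> M 0 = 0"
proof -
  interpret te_chart H U \<phi> M by (rule te)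
  interpret H': te_chart H' U' \<phi>' M' by (rule te')
  obtain v B v' B' G where B: "conn_matrix H v B" and B': "conn_matrix H' v' B'" and G: "invertible G"
    "(\<chi> i j. fps_X\<^sup>2 * fps_deriv (G $ i $ j)) + fps_matrix B ** G = G ** fps_matrix B'"
    using iso unfolding formally_isomorphic_def by blast
  note g = gauge_invariants[OF G] and i = conn_matrix_invariants[OF B] and i' = H'.conn_matrix_invariants[OF B']
  have tr: "fps_nth (trace (fps_matrix M')) 0 = fps_nth (trace (fps_matrix M)) 0"
    using g(1)[of 0] i(1)[of 0] i'(1)[of 0] by simp
  have dt: "fps_nth (det (fps_matrix M')) k = fps_nth (det (fps_matrix M)) k" if "k \<le> 1" for k
    using g(2)[OF that] i(2)[OF that] i'(2)[OF that] by simp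
  show "delta H' 1 = delta H 1"
    by (simp add: delta_eq H'.delta_eq dt)
  note m = fps_nth_fps_matrix_0[OF M_analytic] fps_nth_fps_matrix_0[OF H'.M_analytic]
  show "trace (M' 0) = trace (M 0)"
    using tr by (simp add: trace_2 m)
  show "det (M' 0) = det (M 0)"
    using dt[of 0] by (simp add: det_2 m)
  have "(\<lambda>z. B z $ i $ j) analytic_on {0}" "(\<lambda>z. B' z $ i $ j) analytic_on {0}" for i j
    using B B' unfolding conn_matrix_def by blast+
  then have "B' 0 = 0 \<longleftrightarrow> B 0 = 0"
    using g(3) by (simp add: fps_nth_fps_matrix_0 vec_eq_iff)
  then show "M' 0 = 0 \<longleftrightarrow> M 0 = 0"
    using i(3) i'(3) by simp
qed

theorem lemma4p9:
  fixes H :: "'e conn_bundle"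
  assumes "TE_structure H"
    and "type_Bra H \<or> type_Reg H"
    and "trace_free H"
  shows
    "(\<forall>e\<in>Tot H. pr H e = 0 \<longrightarrow> pole_part H (pole_part H e) = fscale H 0 e) \<and>
     (\<exists>e\<in>Tot H. pr H e = 0 \<and> pole_part H e \<noteq> fscale H 0 e) \<and>
     (regular_singular H \<longleftrightarrow> type_Reg H) \<and>
     (type_Bra H \<longrightarrow>
        holomorphic_bundle (pullback4 H) \<and> connection_off_0 (pullback4 H) \<and>
        (\<forall>t. pullback4_module H t \<longleftrightarrow> mero_germ_section (pullback4 H) t) \<and>
        delta H 1 \<noteq> 0 \<and>
        (\<exists>\<kappa>\<^sub>1. pullback_eigenvalue H \<kappa>\<^sub>1) \<and>
        (\<forall>\<kappa>\<^sub>1. pullback_eigenvalue H \<kappa>\<^sub>1 \<longrightarrow> - (1 / 16) * \<kappa>\<^sub>1\<^sup>2 = delta H 1) \<and>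
        (\<forall>H' :: 'f conn_bundle. TE_structure H' \<and> formally_isomorphic H H' \<longrightarrow>
           (\<exists>\<kappa>'. pullback_eigenvalue H' \<kappa>') \<and>
           (\<forall>\<kappa>\<^sub>1 \<kappa>'. pullback_eigenvalue H \<kappa>\<^sub>1 \<and> pullback_eigenvalue H' \<kappa>' \<longrightarrow> \<kappa>'\<^sup>2 = \<kappa>\<^sub>1\<^sup>2)))"
proof -
  have jordan: "single_jordan_block H"
    using assms(2) by (auto simp: type_Bra_def type_Reg_def)
  have nilp: "M 0 \<noteq> 0 \<and> trace (M 0) = 0 \<and> det (M 0) = 0" if "te_chart H U \<phi> M" for U \<phi> M
    using te_chart.nilpotent_pole[OF that assms(3) jordan] by blast
  obtain U \<phi> M where chart: "normalised_te_chart H U \<phi> M"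
    by (rule normalised_te_chart_exists[OF assms(1)], erule nilp, erule that)
  interpret normalised_te_chart H U \<phi> M by (rule chart)
  have Reg: "type_Reg H \<longleftrightarrow> delta H 1 = 0" and Bra: "type_Bra H \<longleftrightarrow> delta H 1 \<noteq> 0"
    using jordan by (simp_all add: type_Reg_def type_Bra_def rho_0)
  have H: "holomorphic_bundle H" "connection_off_0 H"
    using assms(1) by (auto simp: TE_structure_def)
  have formal: "(\<exists>\<kappa>'. pullback_eigenvalue H' \<kappa>') \<and>
      (\<forall>\<kappa> \<kappa>'. pullback_eigenvalue H \<kappa> \<and> pullback_eigenvalue H' \<kappa>' \<longrightarrow> \<kappa>'\<^sup>2 = \<kappa>\<^sup>2)"
    if \<delta>: "delta H 1 \<noteq> 0" and H': "TE_structure H'" "formally_isomorphic H H'" for H' :: "'f conn_bundle"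
  proof -
    have te: "te_chart H U \<phi> M" by unfold_locales
    have nilp': "M' 0 \<noteq> 0 \<and> trace (M' 0) = 0 \<and> det (M' 0) = 0" if "te_chart H' U' \<phi>' M'" for U' \<phi>' M'
      using formally_isomorphic_pole(2-4)[OF H'(2) te that] nilp[OF te] by simp
    obtain U' \<phi>' M' where chart': "normalised_te_chart H' U' \<phi>' M'"
      by (rule normalised_te_chart_exists[OF H'(1)], erule nilp', erule that)
    interpret H': normalised_te_chart H' U' \<phi>' M' by (rule chart')
    have "delta H' 1 = delta H 1"
      by (rule formally_isomorphic_pole(1)[OF H'(2) te]) unfold_locales
    then show ?thesis
      using H'.pullback_eigenvalue_exists H'.pullback_eigenvalue_square pullback_eigenvalue_square \<delta> by metis
  qed
  show ?thesis
  proof (intro conjI impI allI ballI)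
    show "pole_part H (pole_part H e) = fscale H 0 e" if "e \<in> Tot H" "pr H e = 0" for e
      using that by (rule pole_part_nilpotent)
    show "\<exists>e\<in>Tot H. pr H e = 0 \<and> pole_part H e \<noteq> fscale H 0 e"
      by (rule pole_part_nonzero)
    show "regular_singular H \<longleftrightarrow> type_Reg H"
      unfolding Reg by (rule regular_singular_iff)
    assume "type_Bra H"
    then have \<delta>: "delta H 1 \<noteq> 0" unfolding Bra .
    show "holomorphic_bundle (pullback4 H)" "connection_off_0 (pullback4 H)"
      by (rule holomorphic_bundle_pullback4[OF H(1)], rule connection_off_0_pullback4[OF H])
    show "pullback4_module H t \<longleftrightarrow> mero_germ_section (pullback4 H) t" for t
      by (rule pullback4_module_iff)
    show "delta H 1 \<noteq> 0" by (rule \<delta>)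
    show "\<exists>\<kappa>\<^sub>1. pullback_eigenvalue H \<kappa>\<^sub>1"
      by (rule pullback_eigenvalue_exists[OF \<delta>])
    show "- (1 / 16) * \<kappa>\<^sub>1\<^sup>2 = delta H 1" if "pullback_eigenvalue H \<kappa>\<^sub>1" for \<kappa>\<^sub>1
      using pullback_eigenvalue_square[OF that] by simp
    fix H' :: "'f conn_bundle" assume "TE_structure H' \<and> formally_isomorphic H H'"
    then show "\<exists>\<kappa>'. pullback_eigenvalue H' \<kappa>'"
      "pullback_eigenvalue H \<kappa>\<^sub>1 \<and> pullback_eigenvalue H' \<kappa>' \<Longrightarrow> \<kappa>'\<^sup>2 = \<kappa>\<^sub>1\<^sup>2" for \<kappa>\<^sub>1 \<kappa>'
      using formal[OF \<delta>, of H'] by blast+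
  qed
qed

end
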